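(* Let $j:Y\hookrightarrow X$ be an embedding of Banach spaces and let $\alpha$ be a finitely generated $m$-tensor norm. The following conditions are equivalent: (1) $Y$ is locally complemented in $X$ through $j$. (2) $\widetilde\otimes_\alpha^m Y$ is locally complemented in $\widetilde\otimes_\alpha^m X$ through $\otimes_\alpha^m j$. (3) $\mathcal A_m(Y)$ is complemented in $\mathcal A_m(X)$, i.e. the restriction map $\mathcal A_m(X)\to\mathcal A_m(Y)$, $\varphi\mapsto\varphi\circ(j,\dots,j)$, admits a bounded linear right inverse.
   Context: An $m$-tensor norm $\alpha$ assigns to every $m$-tuple of normed spaces $E_1,\dots,E_m$ a norm on $E_1\otimes\cdots\otimes E_m$ (the resulting space is $\otimes_\alpha^m E_i$, its completion $\widetilde\otimes_\alpha^m E_i$) such that $\varepsilon\le\alpha\le\pi$ (injective and projective norms) and $\|T_1\otimes\cdots\otimes T_m:\otimes_\alpha^m E_i\to\otimes_\alpha^m G_i\|\le\|T_1\|\cdots\|T_m\|$ for bounded operators $T_i:E_i\to G_i$. It is finitely generated if $\|z\|_{\otimes_\alpha^m E_i}=\inf\{\|z\|_{\otimes_\alpha^m M_i}\}$, the infimum taken over finite-dimensional subspaces $M_i\subseteq E_i$ with $z\in\otimes^m M_i$. If all $E_i=E$ one writes $\otimes_\alpha^m E$, $\widetilde\otimes_\alpha^m E$. $\mathcal A_m(E):=(\widetilde\otimes_\alpha^m E)^*$, whose elements are identified with $m$-linear forms on $E$. For Banach spaces $Y,X$ and a bounded linear map $i:Y\to X$, $Y$ is locally complemented in $X$ through $i$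 if there is a constant $\lambda>0$ such that for every finite-dimensional subspace $F\subseteq X$ there is a linear operator $r_F:F\to Y$ with $\|r_F\|\le\lambda$ and $r_F(i(y))=y$ for all $y\in Y$ with $i(y)\in F$ (this forces $i$ to be an isomorphic embedding). *)

theory Defs
  imports "HOL-Analysis.Analysis" "HOL-Library.Function_Algebras"
begin

section \<open>Normed spaces\<close>

text \<open>
  Scalars range over a type \<open>'k :: {real_normed_field, euclidean_space}\<close>. Up to isomorphism the
  only such fields are the real and the complex numbers, so both cases are covered at once.

  A normed space is a linear subspace \<open>vecs E\<close> of a vector space type together with a norm,
  whose values outside \<open>vecs E\<close> are irrelevant. In this way one can quantify over all normed
  spaces that live inside a given type, in particular over all subspaces of a given space.
\<close>

record ('k, 'v) nspace =
  vecs :: "'v set"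
  smul :: "'k \<Rightarrow> 'v \<Rightarrow> 'v"
  nrm :: "'v \<Rightarrow> real"

definition normed_space ::
    "('k::{real_normed_field,euclidean_space}, 'v::ab_group_add) nspace \<Rightarrow> bool" where
  "normed_space E \<longleftrightarrow>
     vector_space (smul E) \<and> module.subspace (smul E) (vecs E) \<and>
     (\<forall>x\<in>vecs E. nrm E x = 0 \<longleftrightarrow> x = 0) \<and>
     (\<forall>x\<in>vecs E. \<forall>y\<in>vecs E. nrm E (x + y) \<le> nrm E x + nrm E y) \<and>
     (\<forall>c. \<forall>x\<in>vecs E. nrm E (smul E c x) = norm c * nrm E x)"

definition banach_space ::
    "('k::{real_normed_field,euclidean_space}, 'v::ab_group_add) nspace \<Rightarrow> bool" where
  "banach_space E \<longleftrightarrow> normed_space E \<and>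
     (\<forall>s :: nat \<Rightarrow> 'v. (\<forall>n. s n \<in> vecs E) \<and>
          (\<forall>e>0. \<exists>N. \<forall>p\<ge>N. \<forall>q\<ge>N. nrm E (s p - s q) < e) \<longrightarrow>
        (\<exists>l\<in>vecs E. (\<lambda>n. nrm E (s n - l)) \<longlonglongrightarrow> 0))"

definition sub :: "('k, 'v) nspace \<Rightarrow> 'v set \<Rightarrow> ('k, 'v) nspace" where
  "sub E M = E\<lparr>vecs := M\<rparr>"

definition fd_subspace ::
    "('k::{real_normed_field,euclidean_space}, 'v::ab_group_add) nspace \<Rightarrow> 'v set \<Rightarrow> bool" where
  "fd_subspace E M \<longleftrightarrow> (\<exists>B. finite B \<and> B \<subseteq> vecs E \<and> M = module.span (smul E) B)"

definition linear_map ::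
    "('k, 'v::ab_group_add) nspace \<Rightarrow> ('k, 'w::ab_group_add) nspace \<Rightarrow> ('v \<Rightarrow> 'w) \<Rightarrow> bool" where
  "linear_map E G T \<longleftrightarrow>
     (\<forall>x\<in>vecs E. T x \<in> vecs G) \<and>
     (\<forall>x\<in>vecs E. \<forall>y\<in>vecs E. T (x + y) = T x + T y) \<and>
     (\<forall>c. \<forall>x\<in>vecs E. T (smul E c x) = smul G c (T x))"

definition bounded_op ::
    "('k, 'v::ab_group_add) nspace \<Rightarrow> ('k, 'w::ab_group_add) nspace \<Rightarrow> ('v \<Rightarrow> 'w) \<Rightarrow> bool" where
  "bounded_op E G T \<longleftrightarrow> linear_map E G T \<and> (\<exists>C. \<forall>x\<in>vecs E. nrm G (T x) \<le> C * nrm E x)"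

text \<open>As for \<open>onorm\<close>, the vector \<open>0\<close> contributes the value \<open>0 / 0 = 0\<close>.\<close>

definition op_norm :: "('k, 'v) nspace \<Rightarrow> ('k, 'w) nspace \<Rightarrow> ('v \<Rightarrow> 'w) \<Rightarrow> real" where
  "op_norm E G T = (SUP x\<in>vecs E. nrm G (T x) / nrm E x)"

definition embedding ::
    "('k, 'v::ab_group_add) nspace \<Rightarrow> ('k, 'w::ab_group_add) nspace \<Rightarrow> ('v \<Rightarrow> 'w) \<Rightarrow> bool" where
  "embedding E G T \<longleftrightarrow> bounded_op E G T \<and> (\<exists>c>0. \<forall>x\<in>vecs E. c * nrm E x \<le> nrm G (T x))"

definition scalars :: "('k::{real_normed_field,euclidean_space}, 'k) nspace" where
  "scalars = \<lparr>vecs = UNIV, smul = (*), nrm = norm\<rparr>"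

text \<open>
  Functionals are extended by \<open>0\<close> outside the space, so that equal functionals are equal functions.
\<close>

definition dual ::
    "('k::{real_normed_field,euclidean_space}, 'v::ab_group_add) nspace \<Rightarrow> ('k, 'v \<Rightarrow> 'k) nspace"
  where
  "dual E = \<lparr>vecs = {f. bounded_op E scalars f \<and> (\<forall>x. x \<notin> vecs E \<longrightarrow> f x = 0)},
             smul = (\<lambda>c f x. c * f x),
             nrm = op_norm E scalars\<rparr>"

text \<open>\<open>C\<close> is a completion of \<open>N\<close> via the dense isometric embedding \<open>\<iota>\<close>.\<close>

definition is_completion ::
    "('k::{real_normed_field,euclidean_space}, 'v::ab_group_add) nspace \<Rightarrow>
     ('k, 'c::ab_group_add) nspace \<Rightarrow> ('v \<Rightarrow> 'c) \<Rightarrow> bool" where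
  "is_completion N C \<iota> \<longleftrightarrow>
     banach_space C \<and> linear_map N C \<iota> \<and> (\<forall>z\<in>vecs N. nrm C (\<iota> z) = nrm N z) \<and>
     (\<forall>x\<in>vecs C. \<forall>e>0. \<exists>z\<in>vecs N. nrm C (x - \<iota> z) < e)"

text \<open>
  The continuous extension to the completions \<open>C\<close> and \<open>D\<close> of a bounded operator \<open>T\<close> on \<open>N\<close>;
  it is uniquely determined on \<open>vecs C\<close>.
\<close>

definition completed_op ::
    "('k, 'v) nspace \<Rightarrow> ('k, 'c::ab_group_add) nspace \<Rightarrow> ('v \<Rightarrow> 'c) \<Rightarrow>
     ('k, 'd::ab_group_add) nspace \<Rightarrow> ('w \<Rightarrow> 'd) \<Rightarrow> ('v \<Rightarrow> 'w) \<Rightarrow> 'c \<Rightarrow> 'd" where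
  "completed_op N C \<iota> D \<kappa> T = (SOME J. bounded_op C D J \<and> (\<forall>z\<in>vecs N. J (\<iota> z) = \<kappa> (T z)))"

definition locally_complemented ::
    "('k::{real_normed_field,euclidean_space}, 'v::ab_group_add) nspace \<Rightarrow>
     ('k, 'w::ab_group_add) nspace \<Rightarrow> ('v \<Rightarrow> 'w) \<Rightarrow> bool" where
  "locally_complemented Y X i \<longleftrightarrow> bounded_op Y X i \<and>
     (\<exists>l>0. \<forall>F. fd_subspace X F \<longrightarrow>
        (\<exists>r. bounded_op (sub X F) Y r \<and> op_norm (sub X F) Y r \<le> l \<and>
             (\<forall>y\<in>vecs Y. i y \<in> F \<longrightarrow> r (i y) = y)))"

definition has_bounded_right_inverse ::
    "('k, 'v::ab_group_add) nspace \<Rightarrow> ('k, 'w::ab_group_add) nspace \<Rightarrow> ('v \<Rightarrow> 'w) \<Rightarrow> bool" where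
  "has_bounded_right_inverse E G R \<longleftrightarrow> (\<exists>S. bounded_op G E S \<and> (\<forall>y\<in>vecs G. R (S y) = y))"


section \<open>Algebraic tensor products\<close>

text \<open>
  The index set of an \<open>m\<close>-fold tensor product is a finite type \<open>'m\<close>, with \<open>m = CARD('m)\<close>, and
  \<open>m\<close>-tuples are functions on \<open>'m\<close>. The elementary tensor \<open>x\<^sub>1 \<otimes> \<dots> \<otimes> x\<^sub>m\<close> is evaluation at
  \<open>(x\<^sub>1, \<dots>, x\<^sub>m)\<close>, a linear functional on the space of \<open>m\<close>-linear forms, and tensors are finite sums
  of these. The forms are taken on the whole ambient vector spaces; hence
  \<open>\<otimes> M\<^sub>i \<subseteq> \<otimes> E\<^sub>i\<close> holds literally for subspaces \<open>M\<^sub>i \<subseteq> E\<^sub>i\<close>.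
\<close>

type_synonym ('m, 'k, 'u) tensor = "(('m \<Rightarrow> 'u) \<Rightarrow> 'k) \<Rightarrow> 'k"

definition tuples :: "('m \<Rightarrow> ('k, 'u) nspace) \<Rightarrow> ('m \<Rightarrow> 'u) set" where
  "tuples E = {x. \<forall>i. x i \<in> vecs (E i)}"

definition ambient_form ::
    "('m \<Rightarrow> ('k::field, 'u::ab_group_add) nspace) \<Rightarrow> (('m \<Rightarrow> 'u) \<Rightarrow> 'k) \<Rightarrow> bool" where
  "ambient_form E \<phi> \<longleftrightarrow> (\<forall>x i. Vector_Spaces.linear (smul (E i)) (*) (\<lambda>t. \<phi> (x(i := t))))"

definition elementary_tensor ::
    "('m \<Rightarrow> ('k::field, 'u::ab_group_add) nspace) \<Rightarrow> ('m \<Rightarrow> 'u) \<Rightarrow> ('m, 'k, 'u) tensor" where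
  "elementary_tensor E x = (\<lambda>\<phi>. if ambient_form E \<phi> then \<phi> x else 0)"

definition tensor_sum ::
    "('m \<Rightarrow> ('k::field, 'u::ab_group_add) nspace) \<Rightarrow> ('m \<Rightarrow> 'u) list \<Rightarrow> ('m, 'k, 'u) tensor" where
  "tensor_sum E xs = (\<Sum>x\<leftarrow>xs. elementary_tensor E x)"

text \<open>The tensor product of the spaces \<open>E i\<close>, normed by \<open>\<nu>\<close>.\<close>

definition tensor_space ::
    "('m \<Rightarrow> ('k::field, 'u::ab_group_add) nspace) \<Rightarrow> (('m, 'k, 'u) tensor \<Rightarrow> real) \<Rightarrow>
     ('k, ('m, 'k, 'u) tensor) nspace" where
  "tensor_space E \<nu> = \<lparr>vecs = {tensor_sum E xs | xs. set xs \<subseteq> tuples E},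
                       smul = (\<lambda>c z \<phi>. c * z \<phi>),
                       nrm = \<nu>\<rparr>"

text \<open>
  The linearization of a multilinear map \<open>B\<close> on the product of the \<open>E i\<close>, mapping
  \<open>\<Sum> x\<^sub>1 \<otimes> \<dots> \<otimes> x\<^sub>m\<close> to \<open>\<Sum> B (x\<^sub>1, \<dots>, x\<^sub>m)\<close>. Lemma \<open>tensor_lift_sum\<close> below shows that it is well defined.
\<close>

definition tensor_lift ::
    "('m \<Rightarrow> ('k::field, 'u::ab_group_add) nspace) \<Rightarrow> (('m \<Rightarrow> 'u) \<Rightarrow> 'w::ab_group_add) \<Rightarrow>
     ('m, 'k, 'u) tensor \<Rightarrow> 'w" where
  "tensor_lift E B z =
     (THE w. \<exists>xs. set xs \<subseteq> tuples E \<and> z = tensor_sum E xs \<and> w = (\<Sum>x\<leftarrow>xs. B x))"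

definition tensor_map ::
    "('m \<Rightarrow> ('k::field, 'u::ab_group_add) nspace) \<Rightarrow> ('m \<Rightarrow> ('k, 'u) nspace) \<Rightarrow>
     ('m \<Rightarrow> 'u \<Rightarrow> 'u) \<Rightarrow> ('m, 'k, 'u) tensor \<Rightarrow> ('m, 'k, 'u) tensor" where
  "tensor_map E G T = tensor_lift E (\<lambda>x. elementary_tensor G (\<lambda>i. T i (x i)))"

lemma ex_projection:
  assumes "vector_space s" "module.subspace s V"
  shows "\<exists>P. Vector_Spaces.linear s s P \<and> (\<forall>x. P x \<in> V) \<and> (\<forall>x\<in>V. P x = x)"
proof -
  interpret vector_space s by fact
  interpret vector_space_pair s s by unfold_locales
  have "Vector_Spaces.linear s s (\<lambda>x. x)"
    by unfold_locales simp_all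
  from linear_exists_left_inverse_on[OF this assms(2)] obtain P
    where "range P \<subseteq> V" "Vector_Spaces.linear s s P" "\<forall>x\<in>V. P x = x"
    by (metis inj_on_def)
  then show ?thesis by blast
qed

lemma ex_separating_functional:
  assumes "vector_space s" "w \<noteq> (0 :: 'w::ab_group_add)"
  shows "\<exists>l :: 'w \<Rightarrow> 'k::field. Vector_Spaces.linear s (*) l \<and> l w = 1"
proof -
  interpret A: vector_space s by fact
  interpret B: vector_space "(*) :: 'k \<Rightarrow> 'k \<Rightarrow> 'k"
    by unfold_locales (auto simp: algebra_simps)
  interpret vector_space_pair s "(*) :: 'k \<Rightarrow> 'k \<Rightarrow> 'k" by unfold_locales
  have "A.independent {w}"
    using assms(2) A.dependent_single by metis
  from linear_independent_extend[OF this, of "\<lambda>_. 1"] show ?thesis by blast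
qed

lemma tensor_sum_eqD:
  fixes E :: "'m \<Rightarrow> ('k::{real_normed_field,euclidean_space}, 'u::ab_group_add) nspace"
    and s :: "'k \<Rightarrow> 'w::ab_group_add \<Rightarrow> 'w"
  assumes E: "\<And>i. normed_space (E i)" and s: "vector_space s"
    and add: "\<And>x i u v. \<lbrakk>x \<in> tuples E; u \<in> vecs (E i); v \<in> vecs (E i)\<rbrakk> \<Longrightarrow>
                B (x(i := u + v)) = B (x(i := u)) + B (x(i := v))"
    and scale: "\<And>x i c u. \<lbrakk>x \<in> tuples E; u \<in> vecs (E i)\<rbrakk> \<Longrightarrow>
                B (x(i := smul (E i) c u)) = s c (B (x(i := u)))"
    and xs: "set xs \<subseteq> tuples E" and ys: "set ys \<subseteq> tuples E"
    and eq: "tensor_sum E xs = tensor_sum E ys"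
  shows "(\<Sum>x\<leftarrow>xs. B x) = (\<Sum>x\<leftarrow>ys. B x)"
proof (rule ccontr)
  assume neq: "(\<Sum>x\<leftarrow>xs. B x) \<noteq> (\<Sum>x\<leftarrow>ys. B x)"
  have "\<forall>i. \<exists>P. Vector_Spaces.linear (smul (E i)) (smul (E i)) P \<and>
          (\<forall>x. P x \<in> vecs (E i)) \<and> (\<forall>x\<in>vecs (E i). P x = x)"
    using E by (intro allI ex_projection) (simp_all add: normed_space_def)
  from choice[OF this] obtain P where
    P: "\<And>i. Vector_Spaces.linear (smul (E i)) (smul (E i)) (P i)"
      "\<And>i x. P i x \<in> vecs (E i)" "\<And>i x. x \<in> vecs (E i) \<Longrightarrow> P i x = x" by auto
  obtain l :: "'w \<Rightarrow> 'k" where l: "Vector_Spaces.linear s (*) l"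
    "l ((\<Sum>x\<leftarrow>xs. B x) - (\<Sum>x\<leftarrow>ys. B x)) = 1"
    using ex_separating_functional[OF s] neq by (metis right_minus_eq)
  interpret l: Vector_Spaces.linear s "(*)" l by (fact l(1))
  define \<phi> where "\<phi> = (\<lambda>x. l (B (\<lambda>i. P i (x i))))"
  have upd: "(\<lambda>k. P k ((x(i := t)) k)) = (\<lambda>k. P k (x k))(i := P i t)" for x i t
    by auto
  have tup: "(\<lambda>k. P k (x k)) \<in> tuples E" for x
    using P(2) by (simp add: tuples_def)
  have form: "ambient_form E \<phi>"
    unfolding ambient_form_def
  proof (intro allI)
    fix x i
    interpret Pi: Vector_Spaces.linear "smul (E i)" "smul (E i)" "P i" by (fact P(1))
    show "Vector_Spaces.linear (smul (E i)) (*) (\<lambda>t. \<phi> (x(i := t)))"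
    proof unfold_locales
      fix b1 b2 c b
      let ?y = "\<lambda>k. P k (x k)"
      have val: "\<phi> (x(i := t)) = l (B (?y(i := P i t)))" for t
        unfolding \<phi>_def upd ..
      show "\<phi> (x(i := b1 + b2)) = \<phi> (x(i := b1)) + \<phi> (x(i := b2))"
        unfolding val Pi.add add[OF tup P(2) P(2)] l.add ..
      show "\<phi> (x(i := smul (E i) c b)) = c * \<phi> (x(i := b))"
        unfolding val Pi.scale scale[OF tup P(2)] l.scale ..
    qed
  qed
  have fix_: "\<phi> x = l (B x)" if "x \<in> tuples E" for x
  proof -
    have "(\<lambda>i. P i (x i)) = x" using that P(3) by (auto simp: tuples_def)
    then show ?thesis by (simp add: \<phi>_def)
  qed
  have ev: "tensor_sum E zs \<phi> = l (\<Sum>x\<leftarrow>zs. B x)" if "set zs \<subseteq> tuples E" for zs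
    using that
    by (induction zs)
      (auto simp: tensor_sum_def elementary_tensor_def form fix_ l.add l.zero)
  from ev[OF xs] ev[OF ys] eq l(2) show False by (simp add: l.diff)
qed

lemma tensor_lift_sum:
  fixes E :: "'m \<Rightarrow> ('k::{real_normed_field,euclidean_space}, 'u::ab_group_add) nspace"
    and s :: "'k \<Rightarrow> 'w::ab_group_add \<Rightarrow> 'w"
  assumes "\<And>i. normed_space (E i)" "vector_space s"
    and "\<And>x i u v. \<lbrakk>x \<in> tuples E; u \<in> vecs (E i); v \<in> vecs (E i)\<rbrakk> \<Longrightarrow>
                B (x(i := u + v)) = B (x(i := u)) + B (x(i := v))"
    and "\<And>x i c u. \<lbrakk>x \<in> tuples E; u \<in> vecs (E i)\<rbrakk> \<Longrightarrow>
                B (x(i := smul (E i) c u)) = s c (B (x(i := u)))"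
    and "set xs \<subseteq> tuples E"
  shows "tensor_lift E B (tensor_sum E xs) = (\<Sum>x\<leftarrow>xs. B x)"
  unfolding tensor_lift_def
proof (rule the_equality)
  show "\<exists>ys. set ys \<subseteq> tuples E \<and> tensor_sum E xs = tensor_sum E ys \<and>
          (\<Sum>x\<leftarrow>xs. B x) = (\<Sum>x\<leftarrow>ys. B x)"
    using assms(5) by blast
next
  fix w
  assume "\<exists>ys. set ys \<subseteq> tuples E \<and> tensor_sum E xs = tensor_sum E ys \<and> w = (\<Sum>x\<leftarrow>ys. B x)"
  then obtain ys where ys: "set ys \<subseteq> tuples E" "tensor_sum E ys = tensor_sum E xs"
    "w = (\<Sum>x\<leftarrow>ys. B x)" by metis
  show "w = (\<Sum>x\<leftarrow>xs. B x)"
    unfolding ys(3)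
    by (rule tensor_sum_eqD[where E = E and s = s]) (fact assms ys)+
qed


section \<open>Tensor norms\<close>

definition injective_norm ::
    "('m::finite \<Rightarrow> ('k::{real_normed_field,euclidean_space}, 'u::ab_group_add) nspace) \<Rightarrow>
     ('m, 'k, 'u) tensor \<Rightarrow> real" where
  "injective_norm E z =
     (SUP f \<in> {f. \<forall>i. f i \<in> vecs (dual (E i)) \<and> nrm (dual (E i)) (f i) \<le> 1}.
        norm (tensor_lift E (\<lambda>x. \<Prod>i\<in>UNIV. f i (x i)) z))"

definition projective_norm ::
    "('m::finite \<Rightarrow> ('k::{real_normed_field,euclidean_space}, 'u::ab_group_add) nspace) \<Rightarrow>
     ('m, 'k, 'u) tensor \<Rightarrow> real" where
  "projective_norm E z =
     (INF xs \<in> {xs. set xs \<subseteq> tuples E \<and> z = tensor_sum E xs}.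
        \<Sum>x\<leftarrow>xs. \<Prod>i\<in>UNIV. nrm (E i) (x i))"

text \<open>
  A tensor norm is defined on all tuples of normed spaces inside the (arbitrary) type \<open>'u\<close>; every
  tensor norm on the class of all normed spaces restricts to one in this sense.
\<close>

definition tensor_norm ::
    "(('m::finite \<Rightarrow> ('k::{real_normed_field,euclidean_space}, 'u::ab_group_add) nspace) \<Rightarrow>
      ('m, 'k, 'u) tensor \<Rightarrow> real) \<Rightarrow> bool" where
  "tensor_norm \<alpha> \<longleftrightarrow>
     (\<forall>E. (\<forall>i. normed_space (E i)) \<longrightarrow>
        normed_space (tensor_space E (\<alpha> E)) \<and>
        (\<forall>z\<in>vecs (tensor_space E (\<alpha> E)).
           injective_norm E z \<le> \<alpha> E z \<and> \<alpha> E z \<le> projective_norm E z)) \<and>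
     (\<forall>E G T. (\<forall>i. normed_space (E i)) \<and> (\<forall>i. normed_space (G i)) \<and>
              (\<forall>i. bounded_op (E i) (G i) (T i)) \<longrightarrow>
        bounded_op (tensor_space E (\<alpha> E)) (tensor_space G (\<alpha> G)) (tensor_map E G T) \<and>
        op_norm (tensor_space E (\<alpha> E)) (tensor_space G (\<alpha> G)) (tensor_map E G T)
          \<le> (\<Prod>i\<in>UNIV. op_norm (E i) (G i) (T i)))"

definition finitely_generated ::
    "(('m::finite \<Rightarrow> ('k::{real_normed_field,euclidean_space}, 'u::ab_group_add) nspace) \<Rightarrow>
      ('m, 'k, 'u) tensor \<Rightarrow> real) \<Rightarrow> bool" where
  "finitely_generated \<alpha> \<longleftrightarrow>
     (\<forall>E. (\<forall>i. normed_space (E i)) \<longrightarrow>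
        (\<forall>z\<in>vecs (tensor_space E (\<alpha> E)).
           \<alpha> E z = Inf {\<alpha> (\<lambda>i. sub (E i) (M i)) z | M.
              (\<forall>i. fd_subspace (E i) (M i)) \<and>
              z \<in> vecs (tensor_space (\<lambda>i. sub (E i) (M i)) (\<alpha> (\<lambda>i. sub (E i) (M i))))}))"

definition tensor_power ::
    "(('m \<Rightarrow> ('k::field, 'u::ab_group_add) nspace) \<Rightarrow> ('m, 'k, 'u) tensor \<Rightarrow> real) \<Rightarrow>
     ('k, 'u) nspace \<Rightarrow> ('k, ('m, 'k, 'u) tensor) nspace" where
  "tensor_power \<alpha> E = tensor_space (\<lambda>_. E) (\<alpha> (\<lambda>_. E))"


section \<open>Multilinear forms\<close>

text \<open>
  Let \<open>C\<close> be a completion of a tensor power of \<open>E\<close> via \<open>\<iota>\<close>. A functional \<open>\<Phi>\<close> on \<open>C\<close> is identified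
  with the multilinear form \<open>(x\<^sub>1, \<dots>, x\<^sub>m) \<mapsto> \<Phi> (\<iota> (x\<^sub>1 \<otimes> \<dots> \<otimes> x\<^sub>m))\<close> on \<open>E\<close>, extended by \<open>0\<close> to
  tuples outside \<open>E\<close>; the form carries the norm of the functional.
\<close>

definition form_of ::
    "('k::{real_normed_field,euclidean_space}, 'u::ab_group_add) nspace \<Rightarrow>
     (('m, 'k, 'u) tensor \<Rightarrow> 'c) \<Rightarrow> ('c \<Rightarrow> 'k) \<Rightarrow> ('m \<Rightarrow> 'u) \<Rightarrow> 'k" where
  "form_of E \<iota> \<Phi> =
     (\<lambda>x. if x \<in> tuples (\<lambda>_. E) then \<Phi> (\<iota> (elementary_tensor (\<lambda>_. E) x)) else 0)"

definition form_space ::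
    "('k::{real_normed_field,euclidean_space}, 'u::ab_group_add) nspace \<Rightarrow>
     ('k, 'c::ab_group_add) nspace \<Rightarrow> (('m, 'k, 'u) tensor \<Rightarrow> 'c) \<Rightarrow>
     ('k, ('m \<Rightarrow> 'u) \<Rightarrow> 'k) nspace" where
  "form_space E C \<iota> =
     \<lparr>vecs = form_of E \<iota> ` vecs (dual C),
      smul = (\<lambda>c \<phi> x. c * \<phi> x),
      nrm = (\<lambda>\<phi>. nrm (dual C) (the_inv_into (vecs (dual C)) (form_of E \<iota>) \<phi>))\<rparr>"

definition restrict_form ::
    "('k, 'u) nspace \<Rightarrow> ('u \<Rightarrow> 'u) \<Rightarrow> (('m \<Rightarrow> 'u) \<Rightarrow> 'k::zero) \<Rightarrow> ('m \<Rightarrow> 'u) \<Rightarrow> 'k" where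
  "restrict_form Y j \<phi> = (\<lambda>x. if x \<in> tuples (\<lambda>_. Y) then \<phi> (\<lambda>i. j (x i)) else 0)"

end

theory Submission
  imports Defs
begin

text \<open>
  Write \<open>D\<close> for the existence of a bounded extension operator
  \<open>S : (\<otimes>\<^sup>m Y)\<^sup>* \<rightarrow> (\<otimes>\<^sup>m X)\<^sup>*\<close> between the duals of the completed tensor powers, that is, of a bounded
  linear right inverse of the adjoint of the completed tensor power of \<open>j\<close>. All three conditions of
  the theorem are equivalent to \<open>D\<close>.

  The bridge between local and dual statements is the following fact about a bounded operator \<open>i\<close>
  from \<open>Y\<close> to \<open>X\<close>: the space \<open>Y\<close> is locally complemented in \<open>X\<close> through \<open>i\<close> if and only if the
  restriction map \<open>X\<^sup>* \<rightarrow> Y\<^sup>*\<close> has a bounded linear right inverse.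

  From left to right (\<open>dual_operator_of_locally_complemented\<close>), the local projections \<open>r\<^sub>F : F \<rightarrow> Y\<close>
  form a net of uniformly bounded operators indexed by the finite-dimensional subspaces \<open>F\<close>, and
  \<open>(S f) x = lim f (r\<^sub>F x)\<close> along an ultrafilter. The choice of one ultrafilter for all \<open>f\<close> and \<open>x\<close>
  makes \<open>S\<close> linear.

  From right to left (\<open>locally_complemented_of_dual_operator\<close>), a projection on \<open>F\<close> is an operator
  with prescribed values on the part of \<open>F\<close> that lies in the image of \<open>Y\<close>, and only its size on a
  finite net \<open>N\<close> of the unit ball of \<open>F\<close> has to be controlled. By the Hahn-Banach theorem the
  obstruction to choosing such an operator of small size is a finite family of functionals
  \<open>g\<^sub>s \<in> Y\<^sup>*\<close>, \<open>s \<in> N\<close>, with \<open>\<Sum> \<parallel>g\<^sub>s\<parallel> \<le> 1\<close>, whose combinations with the coordinates outside the image of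
  \<open>Y\<close> vanish. Since \<open>S\<close> is linear and \<open>S g\<close> extends \<open>g\<close>, the obstruction equals
  \<open>\<Sum> (S g\<^sub>s) s\<close>, which is at most \<open>2 \<parallel>S\<parallel>\<close>. This is the finite-dimensional core of the principle of
  local reflexivity, without biduals.

  Applied to the completed tensor powers, the bridge yields (2) \<open>\<longleftrightarrow>\<close> \<open>D\<close>. Condition (3) is \<open>D\<close> read
  through the isometric identification of functionals with multilinear forms
  (\<open>forms_complemented_iff\<close>).

  For (1) \<open>\<Longrightarrow>\<close> \<open>D\<close> (\<open>extension_operator_of_locally_complemented\<close>) the ultrafilter limit is applied to
  the operators \<open>\<otimes>\<^sup>m r\<^sub>F\<close>. They are defined on \<open>\<otimes>\<^sup>m F\<close> and have norm at most \<open>\<lambda>\<^sup>m\<close> there, for the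
  norm \<open>\<alpha>\<close> of \<open>\<otimes>\<^sup>m F\<close>. Finite generation of \<open>\<alpha>\<close> says precisely that these norms approach the norm of
  \<open>\<otimes>\<^sup>m X\<close> as \<open>F\<close> grows.

  For \<open>D\<close> \<open>\<Longrightarrow>\<close> (1) (\<open>locally_complemented_of_extension_operator\<close>) fix \<open>y\<^sub>0 \<in> Y\<close> and \<open>g \<in> Y\<^sup>*\<close> with
  \<open>g y\<^sub>0 = 1\<close>. Then \<open>Y\<close> and its dual embed into the tensor power and its dual through
  \<open>y \<mapsto> y \<otimes> y\<^sub>0 \<otimes> \<dots> \<otimes> y\<^sub>0\<close> and \<open>f \<mapsto> f \<otimes> g \<otimes> \<dots> \<otimes> g\<close>, which are bounded since \<open>\<epsilon> \<le> \<alpha> \<le> \<pi>\<close>. In this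
  way \<open>S\<close> induces a right inverse of \<open>X\<^sup>* \<rightarrow> Y\<^sup>*\<close>, and the bridge applies once more.
\<close>

section \<open>Limits along minimal filters\<close>

text \<open>
  These are the ultrafilters. Minimality in the order of filters is the form in which Zorn's lemma
  produces them and in which convergence is read off below.
\<close>

definition minimal_filter :: "'a filter \<Rightarrow> bool" where
  "minimal_filter U \<longleftrightarrow> U \<noteq> bot \<and> (\<forall>G. G \<le> U \<longrightarrow> G \<noteq> bot \<longrightarrow> G = U)"

lemma ex_minimal_filter:
  fixes F :: "'a filter"
  assumes "F \<noteq> bot"
  shows "\<exists>U\<le>F. minimal_filter U"
proof -
  let ?A = "{G. G \<le> F \<and> G \<noteq> bot}"
  let ?P = "\<lambda>G H :: 'a filter. H \<le> G"
  have "\<exists>M\<in>?A. \<forall>G\<in>?A. ?P M G \<longrightarrow> G = M"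
  proof (rule predicate_Zorn)
    show "partial_order_on ?A (relation_of ?P ?A)"
      by (intro partial_order_on_relation_ofI) auto
  next
    fix C assume C: "C \<in> Chains (relation_of ?P ?A)"
    show "\<exists>u\<in>?A. \<forall>G\<in>C. ?P G u"
    proof (cases "C = {}")
      case True
      then show ?thesis using assms by auto
    next
      case False
      have sub: "C \<subseteq> ?A" using C by (auto simp: Chains_def relation_of_def)
      have lin: "G \<le> H \<or> H \<le> G" if "G \<in> C" "H \<in> C" for G H
        using C that by (auto simp: Chains_def relation_of_def)
      have "eventually (\<lambda>_. False) (Inf C) \<longleftrightarrow> (\<exists>G\<in>C. eventually (\<lambda>_. False) G)"
        using lin by (intro eventually_Inf_base[OF False]) (metis inf.absorb1 inf.absorb2 order_refl)
      then have "Inf C \<noteq> bot"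
        using sub by (auto simp: trivial_limit_def)
      moreover obtain G where "G \<in> C" "G \<le> F" using False sub by auto
      then have "Inf C \<le> F" by (rule Inf_lower2)
      ultimately show ?thesis by (intro bexI[of _ "Inf C"]) (auto intro: Inf_lower)
    qed
  qed
  then obtain M where "M \<le> F" "M \<noteq> bot" and min: "\<And>G. \<lbrakk>G \<le> F; G \<noteq> bot; G \<le> M\<rbrakk> \<Longrightarrow> G = M"
    by auto
  moreover have "G = M" if "G \<le> M" "G \<noteq> bot" for G
    using that min order_trans[OF that(1) \<open>M \<le> F\<close>] by blast
  ultimately show ?thesis unfolding minimal_filter_def by blast
qed

text \<open>
  A cluster point of \<open>f\<close> along \<open>U\<close> exists by compactness. The filter that forces \<open>f\<close> towards this
  point is compatible with \<open>U\<close>, so by minimality it is already contained in \<open>U\<close>.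
\<close>

lemma minimal_filter_tendsto:
  fixes f :: "'a \<Rightarrow> 'b::heine_borel"
  assumes U: "minimal_filter U" and K: "compact K" "eventually (\<lambda>x. f x \<in> K) U"
  shows "\<exists>l. (f \<longlongrightarrow> l) U"
proof -
  have ne: "filtermap f U \<noteq> bot"
    using U by (simp add: minimal_filter_def filtermap_bot_iff)
  have "eventually (\<lambda>y. y \<in> K) (filtermap f U)"
    using K(2) by (simp add: eventually_filtermap)
  with K(1) ne obtain l where l: "inf (nhds l) (filtermap f U) \<noteq> bot"
    unfolding compact_filter by blast
  have "inf (filtercomap f (nhds l)) U \<noteq> bot"
  proof
    assume "inf (filtercomap f (nhds l)) U = bot"
    then have "eventually (\<lambda>_. False) (inf (filtercomap f (nhds l)) U)" by simp
    then obtain P Q where PQ: "eventually P (filtercomap f (nhds l))" "eventually Q U"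
      "\<And>x. P x \<and> Q x \<longrightarrow> False" unfolding eventually_inf by blast
    then obtain R where R: "eventually R (nhds l)" "\<And>x. R (f x) \<Longrightarrow> P x"
      unfolding eventually_filtercomap by blast
    have "eventually (\<lambda>y. \<not> R y) (filtermap f U)"
      unfolding eventually_filtermap using PQ(2)
      by eventually_elim (use PQ(3) R(2) in blast)
    with R(1) have "eventually (\<lambda>_. False) (inf (nhds l) (filtermap f U))"
      unfolding eventually_inf by blast
    with l show False by (simp add: trivial_limit_def)
  qed
  then have "inf (filtercomap f (nhds l)) U = U"
    using U unfolding minimal_filter_def by (meson inf_le2)
  then have "U \<le> filtercomap f (nhds l)" by (metis inf.orderI inf.commute)
  then have "(f \<longlongrightarrow> l) U" by (simp add: filterlim_iff_le_filtercomap)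
  then show ?thesis ..
qed

section \<open>The Hahn-Banach theorem\<close>

definition sublinear :: "(real \<Rightarrow> 'v::ab_group_add \<Rightarrow> 'v) \<Rightarrow> ('v \<Rightarrow> real) \<Rightarrow> bool" where
  "sublinear s p \<longleftrightarrow> p 0 = 0 \<and> (\<forall>x y. p (x + y) \<le> p x + p y) \<and> (\<forall>t>0. \<forall>x. p (s t x) \<le> t * p x)"

lemma sublinearD:
  assumes "sublinear s p"
  shows "p 0 = 0" "p (x + y) \<le> p x + p y" "t > 0 \<Longrightarrow> p (s t x) \<le> t * p x"
    "- p (- x) \<le> p x"
proof -
  show *: "p 0 = 0" "p (x + y) \<le> p x + p y" "t > 0 \<Longrightarrow> p (s t x) \<le> t * p x" for x y
    using assms by (auto simp: sublinear_def)
  show "- p (- x) \<le> p x" using *(1) *(2)[of x "- x"] by simp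
qed

lemma sublinear_scale_eq:
  assumes "vector_space s" "sublinear s p" "t > 0"
  shows "p (s t x) = t * p x"
proof -
  interpret vector_space s by fact
  have "p x = p (s (1 / t) (s t x))" using assms(3) by simp
  also have "\<dots> \<le> (1 / t) * p (s t x)" using assms(3) by (intro sublinearD[OF assms(2)]) simp
  finally have "t * p x \<le> p (s t x)" using assms(3) by (simp add: field_simps)
  with sublinearD(3)[OF assms(2,3)] show ?thesis by (simp add: antisym)
qed

text \<open>
  The largest sublinear functional below \<open>p\<close> that is linear along \<open>y\<close> with slope \<open>p y\<close>. It serves twice:
  a minimal sublinear functional coincides with all its tilts and is therefore linear, and a linear
  functional below the tilt of \<open>p\<close> agrees with \<open>p\<close> at \<open>y\<close>.
\<close>

lemma sublinear_tilt:
  fixes p :: "'v::ab_group_add \<Rightarrow> real" and y :: 'v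
  assumes vs: "vector_space s" and p: "sublinear s p"
  defines "q \<equiv> \<lambda>x. INF t\<in>{0..}. p (x + s t y) - t * p y"
  shows "sublinear s q" and "\<And>x t. t \<ge> 0 \<Longrightarrow> q x \<le> p (x + s t y) - t * p y"
proof -
  interpret vector_space s by fact
  have hom: "p (s t x) = t * p x" if "t \<ge> 0" for t x
    using sublinear_scale_eq[OF vs p, of t] sublinearD(1)[OF p] that by (cases "t = 0") auto
  have bdd: "bdd_below ((\<lambda>t. p (x + s t y) - t * p y) ` {0..})" for x
  proof (rule bdd_belowI2[of _ "- p (- x)"])
    fix t :: real assume "t \<in> {0..}"
    then have "t * p y = p ((x + s t y) + - x)" using hom by simp
    also have "\<dots> \<le> p (x + s t y) + p (- x)" by (rule sublinearD[OF p])
    finally show "- p (- x) \<le> p (x + s t y) - t * p y" by simp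
  qed
  show le: "q x \<le> p (x + s t y) - t * p y" if "t \<ge> 0" for x t
    unfolding q_def using that by (intro cINF_lower[OF bdd]) simp
  show "sublinear s q" unfolding sublinear_def
  proof (intro conjI allI impI)
    have "(\<lambda>t. p (0 + s t y) - t * p y) ` {0..} = {0}"
      using hom by (auto simp: image_iff intro!: exI[of _ 0] bexI[of _ 0])
    then show "q 0 = 0" unfolding q_def by simp
  next
    fix x x'
    have main: "q (x + x') \<le> (p (x + s t y) - t * p y) + (p (x' + s t' y) - t' * p y)"
      if "t \<ge> 0" "t' \<ge> 0" for t t'
    proof -
      have "q (x + x') \<le> p (x + x' + s (t + t') y) - (t + t') * p y"
        using that by (intro le) simp
      also have "x + x' + s (t + t') y = (x + s t y) + (x' + s t' y)"
        by (simp add: scale_left_distrib)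
      also have "p \<dots> \<le> p (x + s t y) + p (x' + s t' y)" by (rule sublinearD[OF p])
      finally show ?thesis by (simp add: algebra_simps)
    qed
    have "q (x + x') - (p (x + s t y) - t * p y) \<le> q x'" if "t \<ge> 0" for t
      unfolding q_def[THEN meta_eq_to_obj_eq, THEN fun_cong, of x'] using main[OF that] by (intro cINF_greatest) (auto simp: algebra_simps)
    then have "q (x + x') - q x' \<le> q x"
      unfolding q_def[THEN meta_eq_to_obj_eq, THEN fun_cong, of x] by (intro cINF_greatest) (auto simp: algebra_simps)
    then show "q (x + x') \<le> q x + q x'" by simp
  next
    fix r :: real and x assume r: "r > 0"
    have "q (s r x) / r \<le> p (x + s t y) - t * p y" if "t \<ge> 0" for t
    proof -
      have "q (s r x) \<le> p (s r x + s (r * t) y) - (r * t) * p y"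
        using that r by (intro le) simp
      also have "s r x + s (r * t) y = s r (x + s t y)"
        by (simp add: scale_right_distrib)
      also have "p \<dots> = r * p (x + s t y)" using r hom by simp
      finally show ?thesis using r by (simp add: field_simps)
    qed
    then have "q (s r x) / r \<le> q x"
      unfolding q_def[THEN meta_eq_to_obj_eq, THEN fun_cong, of x] by (intro cINF_greatest) auto
    then show "q (s r x) \<le> r * q x" using r by (simp add: field_simps)
  qed
qed

text \<open>
  The algebraic core of the Hahn-Banach theorem: a minimal sublinear functional is linear. Pointwise
  infima of chains are again sublinear, because the chain is bounded below by \<open>- p (- x)\<close>.
\<close>

lemma ex_linear_below_sublinear:
  assumes vs: "vector_space s" and p: "sublinear s p"
  shows "\<exists>f. Vector_Spaces.linear s (*) f \<and> (\<forall>x. f x \<le> (p x :: real))"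
proof -
  interpret vector_space s by fact
  let ?A = "{q. sublinear s q \<and> (\<forall>x. q x \<le> p x)}"
  let ?P = "\<lambda>q r. \<forall>x. (r x :: real) \<le> q x"
  have "\<exists>M\<in>?A. \<forall>q\<in>?A. ?P M q \<longrightarrow> q = M"
  proof (rule predicate_Zorn)
    show "partial_order_on ?A (relation_of ?P ?A)"
      by (intro partial_order_on_relation_ofI) (auto intro!: ext intro: order_trans antisym)
  next
    fix C assume C: "C \<in> Chains (relation_of ?P ?A)"
    show "\<exists>u\<in>?A. \<forall>q\<in>C. ?P q u"
    proof (cases "C = {}")
      case True
      then show ?thesis using p by auto
    next
      case False
      have sub: "sublinear s q" "q x \<le> p x" if "q \<in> C" for q x
        using C that by (auto simp: Chains_def relation_of_def)
      have lin: "?P q r \<or> ?P r q" if "q \<in> C" "r \<in> C" for q r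
        using C that by (auto simp: Chains_def relation_of_def)
      define u where "u = (\<lambda>x. INF q\<in>C. q x)"
      have bdd: "bdd_below ((\<lambda>q. q x) ` C)" for x
      proof (rule bdd_belowI2[of _ "- p (- x)"])
        fix q assume "q \<in> C"
        then show "- p (- x) \<le> q x"
          using sublinearD(4)[OF sub(1), of q x] sub(2)[of q "- x"] by simp
      qed
      have le: "u x \<le> q x" if "q \<in> C" for q x
        unfolding u_def using that by (intro cINF_lower[OF bdd])
      have "sublinear s u" unfolding sublinear_def
      proof (intro conjI allI impI)
        have "(\<lambda>q. q 0) ` C = {0}" using sub sublinearD(1) False by fastforce
        then show "u 0 = 0" unfolding u_def by simp
      next
        fix x y
        have main: "u (x + y) \<le> q x + r y" if qr: "q \<in> C" "r \<in> C" for q r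
          using lin[OF qr]
        proof
          assume "?P q r"
          then show ?thesis
            using le[OF qr(2), of "x + y"] sublinearD(2)[OF sub(1)[OF qr(2)], of x y]
            by (smt (verit))
        next
          assume "?P r q"
          then show ?thesis
            using le[OF qr(1), of "x + y"] sublinearD(2)[OF sub(1)[OF qr(1)], of x y]
            by (smt (verit))
        qed
        have "u (x + y) - q x \<le> u y" if "q \<in> C" for q
          unfolding u_def[THEN fun_cong, of y] using main[OF that] False
          by (intro cINF_greatest) (auto simp: algebra_simps)
        then have "u (x + y) - u y \<le> u x"
          unfolding u_def[THEN fun_cong, of x] using False
          by (intro cINF_greatest) (auto simp: algebra_simps)
        then show "u (x + y) \<le> u x + u y" by simp
      next
        fix t :: real and x assume t: "t > 0"
        have "u (s t x) / t \<le> q x" if "q \<in> C" for q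
          using le[OF that, of "s t x"] sublinearD(3)[OF sub(1)[OF that] t, of x] t
          by (simp add: field_simps)
        then have "u (s t x) / t \<le> u x"
          unfolding u_def[THEN fun_cong, of x] using False by (intro cINF_greatest) auto
        then show "u (s t x) \<le> t * u x" using t by (simp add: field_simps)
      qed
      moreover have "u x \<le> p x" for x
        using False le sub(2) by (meson all_not_in_conv order_trans)
      ultimately show ?thesis using le by blast
    qed
  qed
  then obtain q where q: "sublinear s q" "\<And>x. q x \<le> p x"
    and *: "\<forall>r\<in>?A. ?P q r \<longrightarrow> r = q" by auto
  have min: "r = q" if r: "sublinear s r" "\<And>x. r x \<le> q x" for r
  proof -
    have "r x \<le> p x" for x using r(2) q(2) order_trans by blast
    with * r show ?thesis by blast
  qed
  have super: "q x + q y \<le> q (x + y)" for x y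
  proof -
    let ?q = "\<lambda>x. INF t\<in>{0..}. q (x + s t y) - t * q y"
    note tilt = sublinear_tilt[OF vs q(1), where y = y]
    have "?q = q" by (rule min[OF tilt(1)]) (use tilt(2)[of 0] in simp)
    from fun_cong[OF this, of x] have "q x \<le> q (x + s 1 y) - 1 * q y"
      using tilt(2)[of 1 x] by simp
    then show ?thesis by simp
  qed
  have add: "q (x + y) = q x + q y" for x y
    using super sublinearD(2)[OF q(1)] by (simp add: antisym)
  have neg: "q (- x) = - q x" for x
    using add[of x "- x"] sublinearD(1)[OF q(1)] by simp
  have "q (s t x) = t * q x" for t x
  proof (cases t "0 :: real" rule: linorder_cases)
    case less
    then show ?thesis using sublinear_scale_eq[OF vs q(1), of "- t" x] neg[of "s t x"]
      by (simp add: scale_minus_left)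
  qed (use sublinear_scale_eq[OF vs q(1)] sublinearD(1)[OF q(1)] in auto)
  then have "Vector_Spaces.linear s (*) q"
    using add by unfold_locales (auto simp: algebra_simps)
  with q(2) show ?thesis by blast
qed

text \<open>
  Multiplication by a scalar is a similarity, by polarization of the multiplicative norm. This
  makes it irrelevant whether the field is real or complex.
\<close>

lemma inner_mult_mult:
  fixes a b t :: "'k::{real_normed_field,euclidean_space}"
  shows "inner (t * a) (t * b) = (norm t)\<^sup>2 * inner a b"
proof -
  have polar: "4 * inner x y = (norm (x + y))\<^sup>2 - (norm (x - y))\<^sup>2" for x y :: 'k
    by (simp add: power2_norm_eq_inner inner_add inner_diff inner_commute)
  have "4 * inner (t * a) (t * b) = (norm (t * (a + b)))\<^sup>2 - (norm (t * (a - b)))\<^sup>2"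
    unfolding polar distrib_left right_diff_distrib ..
  also have "\<dots> = (norm t)\<^sup>2 * (4 * inner a b)"
    unfolding polar norm_mult power_mult_distrib by (simp add: right_diff_distrib)
  finally show ?thesis by simp
qed

text \<open>
  The functional \<open>f\<close> is recovered as the real part of a linear functional \<open>g\<close> over the field itself,
  where the real part of \<open>a\<close> is its inner product with \<open>1\<close>. For fixed \<open>x\<close>, the map
  \<open>t \<mapsto> f (t x)\<close> is real linear on the field, hence an inner product with some \<open>v\<close>, and \<open>g x\<close> has to
  be the conjugate of \<open>v\<close>.
\<close>

lemma ex_functional_real_part:
  fixes s :: "'k::{real_normed_field,euclidean_space} \<Rightarrow> 'v::ab_group_add \<Rightarrow> 'v"
  assumes vs: "vector_space s"
    and f: "Vector_Spaces.linear (\<lambda>t. s (of_real t)) (*) f"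
  shows "\<exists>g. Vector_Spaces.linear s (*) g \<and> (\<forall>x t. inner (t * g x) 1 = (f (s t x) :: real))"
proof -
  interpret vector_space s by fact
  interpret f: Vector_Spaces.linear "\<lambda>t. s (of_real t)" "(*)" f by fact
  have ex: "\<exists>u. \<forall>t. inner (t * u) 1 = f (s t x)" for x
  proof -
    define v where "v = (\<Sum>b\<in>Basis. f (s b x) *\<^sub>R b)"
    have v: "inner t v = f (s t x)" for t
    proof -
      have "f (s t x) = f (s (\<Sum>b\<in>Basis. inner t b *\<^sub>R b) x)" by (simp add: euclidean_representation)
      also have "\<dots> = (\<Sum>b\<in>Basis. inner t b * f (s b x))"
        by (simp add: scale_sum_left f.sum f.scale scaleR_conv_of_real flip: scale_scale)
      also have "\<dots> = inner t v"
        by (simp add: v_def inner_sum_right mult.commute)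
      finally show ?thesis by simp
    qed
    show ?thesis
    proof (cases "v = 0")
      case True
      then show ?thesis using v by (intro exI[of _ 0]) simp
    next
      case False
      \<comment> \<open>Complex conjugation, expressed through the norm.\<close>
      define u where "u = of_real ((norm v)\<^sup>2) * inverse v"
      have "inner (t * u) 1 = inner t v" for t
      proof -
        have "(norm v)\<^sup>2 * inner (t * u) 1 = inner (v * (t * u)) (v * 1)"
          by (rule inner_mult_mult[symmetric])
        also have "v * (t * u) = (norm v)\<^sup>2 *\<^sub>R t"
          using False by (simp add: u_def scaleR_conv_of_real field_simps)
        finally show ?thesis using False by simp
      qed
      then show ?thesis using v by auto
    qed
  qed
  then obtain g where g: "\<And>x t. inner (t * g x) 1 = f (s t x)" by metis
  have uniq: "a = b" if "\<And>t. inner (t * a) 1 = inner (t * b) (1::'k)" for a b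
  proof (rule ccontr)
    assume "a \<noteq> b"
    then have "inner (inverse (a - b) * (a - b)) (1::'k) = 1"
      by (simp add: inner_same_Basis power2_norm_eq_inner[symmetric])
    with that[of "inverse (a - b)"] show False
      by (simp add: right_diff_distrib inner_diff_left)
  qed
  have "Vector_Spaces.linear s (*) g"
  proof unfold_locales
    show "g (x + y) = g x + g y" for x y
      by (rule uniq) (simp add: g distrib_left inner_add_left scale_right_distrib f.add)
    show "g (s c x) = c * g x" for c x
      by (rule uniq) (simp add: g flip: mult.assoc)
  qed
  with g show ?thesis by blast
qed

definition seminorm ::
    "('k::real_normed_field \<Rightarrow> 'v::ab_group_add \<Rightarrow> 'v) \<Rightarrow> ('v \<Rightarrow> real) \<Rightarrow> bool" where
  "seminorm s p \<longleftrightarrow> (\<forall>x y. p (x + y) \<le> p x + p y) \<and> (\<forall>c x. p (s c x) = norm c * p x)"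

lemma seminormI:
  assumes "vector_space s" and add: "\<And>x y. p (x + y) \<le> p x + p y"
    and scale: "\<And>c x. p (s c x) \<le> norm c * p x"
  shows "seminorm s p"
proof -
  interpret vector_space s by fact
  have "norm c * p x \<le> p (s c x)" for c x
  proof (cases "c = 0")
    case True
    then show ?thesis using add[of 0 0] by simp
  next
    case False
    have "p x \<le> norm (inverse c) * p (s c x)" using scale[of "inverse c" "s c x"] False by simp
    then have "norm c * p x \<le> norm c * (norm (inverse c) * p (s c x))"
      by (rule mult_left_mono) simp
    then show ?thesis using False by (simp add: norm_inverse flip: mult.assoc)
  qed
  with add scale show ?thesis by (auto simp: seminorm_def intro: antisym)
qed

lemma seminormD:
  assumes "vector_space s" "seminorm s p"
  shows "p (x + y) \<le> p x + p y" "p (s c x) = norm c * p x" "p 0 = 0" "p (- x) = p x" "p x \<ge> 0"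
proof -
  interpret vector_space s by fact
  show *: "p (x + y) \<le> p x + p y" "p (s c x) = norm c * p x" for x y c
    using assms(2) by (auto simp: seminorm_def)
  show **: "p 0 = 0" using *(2)[of 0 0] by simp
  show ***: "p (- x) = p x" using *(2)[of "- 1" x] by simp
  show "p x \<ge> 0" using *(1)[of x "- x"] ** *** by simp
qed

text \<open>
  A real functional below the tilt of \<open>p\<close> in the direction \<open>b\<close> attains \<open>p\<close> at \<open>b\<close>. Passing to the
  functional with this real part loses nothing: after multiplication of \<open>x\<close> by \<open>1 / g x\<close> the value
  of \<open>g\<close> is its real part.
\<close>

theorem Hahn_Banach_seminorm:
  fixes s :: "'k::{real_normed_field,euclidean_space} \<Rightarrow> 'v::ab_group_add \<Rightarrow> 'v" and b :: 'v
  assumes vs: "vector_space s" and p: "seminorm s p"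
  shows "\<exists>g. Vector_Spaces.linear s (*) g \<and> (\<forall>x. norm (g x) \<le> p x) \<and> p b \<le> norm (g b)"
proof -
  interpret vector_space s by fact
  let ?s = "\<lambda>t. s (of_real t)"
  have rvs: "vector_space ?s"
    by unfold_locales (simp_all add: scale_right_distrib scale_left_distrib)
  note sd = seminormD[OF vs p]
  have sub: "sublinear ?s p" by (simp add: sublinear_def sd)
  let ?q = "\<lambda>x. INF t\<in>{0..}. p (x + ?s t b) - t * p b"
  note tilt = sublinear_tilt[OF rvs sub, where y = b]
  from ex_linear_below_sublinear[OF rvs tilt(1)] obtain f
    where f: "Vector_Spaces.linear ?s (*) f" "\<And>x. f x \<le> ?q x" by blast
  interpret f: Vector_Spaces.linear ?s "(*)" f by fact
  have fp: "f x \<le> p x" for x using f(2)[of x] tilt(2)[of 0 x] by simp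
  have fb: "p b \<le> f b" using f(2)[of "- b"] tilt(2)[of 1 "- b"] by (simp add: f.neg sd)
  from ex_functional_real_part[OF vs f(1)] obtain g
    where g: "Vector_Spaces.linear s (*) g" "\<And>x t. inner (t * g x) 1 = f (s t x)" by blast
  have "norm (g x) \<le> p x" for x
  proof (cases "g x = 0")
    case False
    have "1 = f (s (inverse (g x)) x)"
      using g(2)[of "inverse (g x)" x] False by (simp add: power2_norm_eq_inner[symmetric])
    also have "\<dots> \<le> p x / norm (g x)"
      using fp[of "s (inverse (g x)) x"] by (simp add: sd norm_inverse divide_inverse mult.commute)
    finally show ?thesis using False by (simp add: field_simps)
  qed (simp add: sd)
  moreover have "p b \<le> norm (g b)"
  proof -
    have "p b \<le> inner (g b) 1" using fb g(2)[of 1 b] by simp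
    also have "\<dots> \<le> norm (g b)" using norm_cauchy_schwarz[of "g b" 1] by simp
    finally show ?thesis .
  qed
  ultimately show ?thesis using g(1) by blast
qed

text \<open>
  The dual description of the distance from \<open>b\<close> to \<open>M\<close>: the quotient seminorm, that is the distance
  to \<open>M\<close>, is dominated by \<open>p\<close> and vanishes on \<open>M\<close>, and so does any functional below it.
\<close>

corollary Hahn_Banach_distance:
  fixes s :: "'k::{real_normed_field,euclidean_space} \<Rightarrow> 'v::ab_group_add \<Rightarrow> 'v"
  assumes vs: "vector_space s" and p: "seminorm s p" and M: "module.subspace s M"
    and bound: "\<And>g. \<lbrakk>Vector_Spaces.linear s (*) g; \<And>x. norm (g x) \<le> p x; \<And>x. x \<in> M \<Longrightarrow> g x = 0\<rbrakk>
                  \<Longrightarrow> norm (g b) \<le> c"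
    and "c < c'"
  shows "\<exists>x\<in>M. p (b - x) < c'"
proof -
  interpret vector_space s by fact
  note sd = seminormD[OF vs p]
  define q where "q = (\<lambda>x. INF y\<in>M. p (x - y))"
  have M0: "0 \<in> M" using M by (rule subspace_0)
  then have ne: "M \<noteq> {}" by auto
  have bdd: "bdd_below ((\<lambda>y. p (x - y)) ` M)" for x
    by (rule bdd_belowI2[of _ 0]) (simp add: sd)
  have le: "q x \<le> p (x - y)" if "y \<in> M" for x y
    unfolding q_def using that by (intro cINF_lower[OF bdd])
  have ge: "a \<le> q x" if "\<And>y. y \<in> M \<Longrightarrow> a \<le> p (x - y)" for a x
    unfolding q_def using that ne by (intro cINF_greatest) auto
  have add: "q (x + x') \<le> q x + q x'" for x x'
  proof -
    have main: "q (x + x') \<le> p (x - y) + p (x' - y')" if "y \<in> M" "y' \<in> M" for y y'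
    proof -
      have "q (x + x') \<le> p (x + x' - (y + y'))" using that M by (intro le subspace_add)
      also have "x + x' - (y + y') = (x - y) + (x' - y')" by simp
      also have "p \<dots> \<le> p (x - y) + p (x' - y')" by (rule sd)
      finally show ?thesis .
    qed
    have "q (x + x') - p (x - y) \<le> q x'" if "y \<in> M" for y
      by (rule ge) (use main[OF that] in \<open>simp add: algebra_simps\<close>)
    then have "q (x + x') - q x' \<le> q x" by (intro ge) (simp add: algebra_simps)
    then show ?thesis by simp
  qed
  have qM: "q x = 0" if "x \<in> M" for x
    using le[OF that, of x] ge[of 0 x] by (simp add: sd)
  have scale: "q (s a x) \<le> norm a * q x" for a x
  proof (cases "a = 0")
    case True
    then show ?thesis using qM[OF M0] by simp
  next
    case False
    have "q (s a x) / norm a \<le> q x"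
    proof (rule ge)
      fix y assume "y \<in> M"
      then have "q (s a x) \<le> p (s a x - s a y)" using M by (intro le subspace_scale)
      also have "\<dots> = norm a * p (x - y)" by (simp add: sd flip: scale_right_diff_distrib)
      finally show "q (s a x) / norm a \<le> p (x - y)" using False by (simp add: field_simps)
    qed
    then show ?thesis using False by (simp add: field_simps)
  qed
  have "seminorm s q" using vs add scale by (rule seminormI)
  from Hahn_Banach_seminorm[OF vs this, of b] obtain g where g:
    "Vector_Spaces.linear s (*) g" "\<And>x. norm (g x) \<le> q x" "q b \<le> norm (g b)" by blast
  have "norm (g b) \<le> c"
  proof (rule bound[OF g(1)])
    show "norm (g x) \<le> p x" for x using g(2)[of x] le[OF M0, of x] by simp
    show "g x = 0" if "x \<in> M" for x using g(2)[of x] qM[OF that] by simp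
  qed
  with g(3) \<open>c < c'\<close> have "q b < c'" by simp
  then show ?thesis unfolding q_def using ne bdd by (simp add: cINF_less_iff)
qed

section \<open>Normed spaces and bounded operators\<close>

locale normed =
  fixes E :: "('k::{real_normed_field,euclidean_space}, 'v::ab_group_add) nspace"
  assumes normed: "normed_space E"
begin

sublocale vector_space "smul E"
  using normed by (simp add: normed_space_def)

lemma vecs_subspace: "subspace (vecs E)"
  using normed by (simp add: normed_space_def)

lemmas zero_in [simp] = subspace_0[OF vecs_subspace]
lemmas add_in = subspace_add[OF vecs_subspace]
lemmas diff_in = subspace_diff[OF vecs_subspace]
lemmas neg_in = subspace_neg[OF vecs_subspace]
lemmas scale_in = subspace_scale[OF vecs_subspace]
lemmas sum_in = subspace_sum[OF vecs_subspace]

lemma nrm_eq_0: "x \<in> vecs E \<Longrightarrow> nrm E x = 0 \<longleftrightarrow> x = 0"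
  and nrm_add: "\<lbrakk>x \<in> vecs E; y \<in> vecs E\<rbrakk> \<Longrightarrow> nrm E (x + y) \<le> nrm E x + nrm E y"
  and nrm_scale: "x \<in> vecs E \<Longrightarrow> nrm E (smul E c x) = norm c * nrm E x"
  using normed by (auto simp: normed_space_def)

lemma nrm_0 [simp]: "nrm E 0 = 0"
  using nrm_eq_0[OF zero_in] by simp

lemma nrm_minus: "x \<in> vecs E \<Longrightarrow> nrm E (- x) = nrm E x"
  using nrm_scale[of x "- 1"] by simp

lemma nrm_ge_0: assumes "x \<in> vecs E" shows "0 \<le> nrm E x"
  using nrm_add[OF assms neg_in[OF assms]] by (simp add: nrm_minus assms)

lemma nrm_diff: "\<lbrakk>x \<in> vecs E; y \<in> vecs E\<rbrakk> \<Longrightarrow> nrm E (x - y) \<le> nrm E x + nrm E y"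
  using nrm_add[of x "- y"] by (simp add: neg_in nrm_minus)

lemma nrm_diff_commute: "\<lbrakk>x \<in> vecs E; y \<in> vecs E\<rbrakk> \<Longrightarrow> nrm E (x - y) = nrm E (y - x)"
  using nrm_minus[of "x - y"] by (simp add: diff_in)

lemma nrm_triangle_diff:
  "\<lbrakk>x \<in> vecs E; y \<in> vecs E; z \<in> vecs E\<rbrakk> \<Longrightarrow> nrm E (x - z) \<le> nrm E (x - y) + nrm E (y - z)"
  using nrm_add[of "x - y" "y - z"] by (simp add: diff_in)

lemma nrm_le_diff: "\<lbrakk>x \<in> vecs E; y \<in> vecs E\<rbrakk> \<Longrightarrow> nrm E x \<le> nrm E y + nrm E (x - y)"
  using nrm_add[of y "x - y"] by (simp add: diff_in)

lemma nrm_sum: "(\<And>i. i \<in> I \<Longrightarrow> f i \<in> vecs E) \<Longrightarrow> nrm E (\<Sum>i\<in>I. f i) \<le> (\<Sum>i\<in>I. nrm E (f i))"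
proof (induction I rule: infinite_finite_induct)
  case (insert i I)
  then show ?case using nrm_add[of "f i" "\<Sum>i\<in>I. f i"] by (simp add: sum_in)
qed auto

lemma normed_sub: "subspace M \<Longrightarrow> M \<subseteq> vecs E \<Longrightarrow> normed_space (sub E M)"
  unfolding normed_space_def sub_def using vector_space_axioms
  by (auto simp: subset_iff nrm_eq_0 nrm_add nrm_scale)

end

lemma sub_simps [simp]: "vecs (sub E M) = M" "smul (sub E M) = smul E" "nrm (sub E M) = nrm E"
  by (simp_all add: sub_def)

locale op = E: normed E + G: normed G
  for E :: "('k::{real_normed_field,euclidean_space}, 'v::ab_group_add) nspace"
    and G :: "('k, 'w::ab_group_add) nspace" +
  fixes T :: "'v \<Rightarrow> 'w"
  assumes lin: "linear_map E G T"
begin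

lemma in_vecs: "x \<in> vecs E \<Longrightarrow> T x \<in> vecs G"
  and add: "\<lbrakk>x \<in> vecs E; y \<in> vecs E\<rbrakk> \<Longrightarrow> T (x + y) = T x + T y"
  and scale: "x \<in> vecs E \<Longrightarrow> T (smul E c x) = smul G c (T x)"
  using lin by (auto simp: linear_map_def)

lemma zero: "T 0 = 0"
  using add[of 0 0] by simp

lemma minus: "x \<in> vecs E \<Longrightarrow> T (- x) = - T x"
  using add[of x "- x"] by (simp add: E.neg_in zero add_eq_0_iff)

lemma diff: "\<lbrakk>x \<in> vecs E; y \<in> vecs E\<rbrakk> \<Longrightarrow> T (x - y) = T x - T y"
  using add[of x "- y"] by (simp add: E.neg_in minus)

lemma sum: "(\<And>i. i \<in> I \<Longrightarrow> f i \<in> vecs E) \<Longrightarrow> T (\<Sum>i\<in>I. f i) = (\<Sum>i\<in>I. T (f i))"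
  by (induction I rule: infinite_finite_induct) (auto simp: zero add E.sum_in)

lemma op_norm_le:
  assumes "C \<ge> 0" "\<And>x. x \<in> vecs E \<Longrightarrow> nrm G (T x) \<le> C * nrm E x"
  shows "op_norm E G T \<le> C"
  unfolding op_norm_def
proof (rule cSUP_least)
  fix x assume x: "x \<in> vecs E"
  show "nrm G (T x) / nrm E x \<le> C"
  proof (cases "x = 0")
    case False
    then have "nrm E x > 0" using E.nrm_ge_0[OF x] E.nrm_eq_0[OF x] by simp
    then show ?thesis using assms(2)[OF x] by (simp add: field_simps)
  qed (use assms in simp)
qed (use E.zero_in in blast)

lemma quotient_le_op_norm:
  assumes "bounded_op E G T" and x: "x \<in> vecs E"
  shows "nrm G (T x) / nrm E x \<le> op_norm E G T"
proof -
  obtain C where C: "\<And>x. x \<in> vecs E \<Longrightarrow> nrm G (T x) \<le> C * nrm E x"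
    using assms(1) by (auto simp: bounded_op_def)
  have "bdd_above ((\<lambda>x. nrm G (T x) / nrm E x) ` vecs E)"
  proof (rule bdd_aboveI2[of _ _ "max C 0"])
    fix x assume x: "x \<in> vecs E"
    show "nrm G (T x) / nrm E x \<le> max C 0"
    proof (cases "x = 0")
      case False
      then have "nrm E x > 0" using E.nrm_ge_0[OF x] E.nrm_eq_0[OF x] by simp
      then show ?thesis using C[OF x] by (simp add: field_simps le_max_iff_disj)
    qed simp
  qed
  then show ?thesis unfolding op_norm_def using x by (rule cSUP_upper[rotated])
qed

lemma op_norm_ge_0: "bounded_op E G T \<Longrightarrow> 0 \<le> op_norm E G T"
  using quotient_le_op_norm[of 0] by (simp add: zero)

lemma le_op_norm:
  assumes "bounded_op E G T" and x: "x \<in> vecs E"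
  shows "nrm G (T x) \<le> op_norm E G T * nrm E x"
proof (cases "x = 0")
  case False
  then have "nrm E x > 0" using E.nrm_ge_0[OF x] E.nrm_eq_0[OF x] by simp
  then show ?thesis using quotient_le_op_norm[OF assms] by (simp add: field_simps)
qed (simp add: zero)

lemma bounded_opI: "(\<And>x. x \<in> vecs E \<Longrightarrow> nrm G (T x) \<le> C * nrm E x) \<Longrightarrow> bounded_op E G T"
  using lin by (auto simp: bounded_op_def)

end

lemma op_of_bounded:
  "\<lbrakk>normed_space E; normed_space G; bounded_op E G T\<rbrakk> \<Longrightarrow> op E G T"
  by unfold_locales (auto simp: bounded_op_def)

lemma banach_normed: "banach_space E \<Longrightarrow> normed_space E"
  by (simp add: banach_space_def)

lemma banach_limit:
  assumes "banach_space E" "\<And>n. s n \<in> vecs E"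
    "\<And>e. e > 0 \<Longrightarrow> \<exists>N. \<forall>p\<ge>N. \<forall>q\<ge>N. nrm E (s p - s q) < e"
  shows "\<exists>l\<in>vecs E. (\<lambda>n. nrm E (s n - l)) \<longlonglongrightarrow> 0"
  using assms unfolding banach_space_def by simp

section \<open>Dual spaces\<close>

lemma scalars_simps [simp]:
  "vecs scalars = UNIV" "smul scalars = (*)" "nrm scalars = norm"
  by (simp_all add: scalars_def)

lemma normed_scalars: "normed_space (scalars :: ('k::{real_normed_field,euclidean_space}, 'k) nspace)"
proof -
  have vs: "vector_space ((*) :: 'k \<Rightarrow> 'k \<Rightarrow> 'k)"
    by unfold_locales (auto simp: algebra_simps)
  interpret vector_space "(*) :: 'k \<Rightarrow> 'k \<Rightarrow> 'k" by (rule vs)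
  show ?thesis unfolding normed_space_def
    by (simp add: vs subspace_UNIV norm_triangle_ineq norm_mult)
qed

lemma banach_scalars: "banach_space (scalars :: ('k::{real_normed_field,euclidean_space}, 'k) nspace)"
  unfolding banach_space_def
proof (intro conjI allI impI normed_scalars)
  fix s :: "nat \<Rightarrow> 'k"
  assume *: "(\<forall>n. s n \<in> vecs scalars) \<and>
    (\<forall>e>0. \<exists>N. \<forall>p\<ge>N. \<forall>q\<ge>N. nrm scalars (s p - s q) < e)"
  then have "Cauchy s" by (simp add: Cauchy_def dist_norm)
  then obtain l where "s \<longlonglongrightarrow> l" using Cauchy_convergent convergent_def by blast
  then show "\<exists>l\<in>vecs scalars. (\<lambda>n. nrm scalars (s n - l)) \<longlonglongrightarrow> 0"
    by (auto simp: tendsto_norm_zero_iff LIM_zero_iff)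
qed

lemma dual_simps [simp]:
  "smul (dual E) = (\<lambda>c f x. c * f x)" "nrm (dual E) = op_norm E scalars"
  by (simp_all add: dual_def)

lemma in_dual_iff: "f \<in> vecs (dual E) \<longleftrightarrow> bounded_op E scalars f \<and> (\<forall>x. x \<notin> vecs E \<longrightarrow> f x = 0)"
  by (simp add: dual_def)

context normed
begin

lemma op_dual: "f \<in> vecs (dual E) \<Longrightarrow> op E scalars f"
  using op_of_bounded[OF normed normed_scalars] by (simp add: in_dual_iff)

lemma dualI:
  assumes "\<And>x y. \<lbrakk>x \<in> vecs E; y \<in> vecs E\<rbrakk> \<Longrightarrow> f (x + y) = f x + f y"
    and "\<And>c x. x \<in> vecs E \<Longrightarrow> f (smul E c x) = c * f x"
    and "\<And>x. x \<in> vecs E \<Longrightarrow> norm (f x) \<le> C * nrm E x"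
    and "\<And>x. x \<notin> vecs E \<Longrightarrow> f x = 0"
  shows "f \<in> vecs (dual E)"
  unfolding in_dual_iff bounded_op_def linear_map_def
  using assms by (auto intro!: exI[of _ C])

lemma dual_le:
  assumes f: "f \<in> vecs (dual E)" and x: "x \<in> vecs E"
  shows "norm (f x) \<le> op_norm E scalars f * nrm E x"
  using op.le_op_norm[OF op_dual[OF f] _ x] f by (simp add: in_dual_iff)

lemma dual_norm_le:
  assumes f: "f \<in> vecs (dual E)" and "C \<ge> 0" "\<And>x. x \<in> vecs E \<Longrightarrow> norm (f x) \<le> C * nrm E x"
  shows "op_norm E scalars f \<le> C"
  using op.op_norm_le[OF op_dual[OF f]] assms by simp

lemma dual_norm_ge_0: "f \<in> vecs (dual E) \<Longrightarrow> 0 \<le> op_norm E scalars f"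
  using op.op_norm_ge_0[OF op_dual] by (simp add: in_dual_iff)

lemma dual_eqI:
  "\<lbrakk>f \<in> vecs (dual E); g \<in> vecs (dual E); \<And>x. x \<in> vecs E \<Longrightarrow> f x = g x\<rbrakk> \<Longrightarrow> f = g"
  by (rule ext) (metis in_dual_iff)

lemma dual_add_in:
  assumes f: "f \<in> vecs (dual E)" and g: "g \<in> vecs (dual E)"
  shows "(\<lambda>x. f x + g x) \<in> vecs (dual E)"
proof -
  interpret f: op E scalars f by (rule op_dual) fact
  interpret g: op E scalars g by (rule op_dual) fact
  show ?thesis
  proof (rule dualI)
    fix x assume x: "x \<in> vecs E"
    show "norm (f x + g x) \<le> (op_norm E scalars f + op_norm E scalars g) * nrm E x"
      using norm_triangle_ineq[of "f x" "g x"] dual_le[OF f x] dual_le[OF g x]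
      by (simp add: algebra_simps)
  qed (use f g in \<open>auto simp: f.add g.add f.scale g.scale algebra_simps in_dual_iff\<close>)
qed

lemma dual_scale_in:
  assumes f: "f \<in> vecs (dual E)"
  shows "(\<lambda>x. c * f x) \<in> vecs (dual E)"
proof -
  interpret f: op E scalars f by (rule op_dual) fact
  show ?thesis
  proof (rule dualI)
    fix x assume x: "x \<in> vecs E"
    show "norm (c * f x) \<le> (norm c * op_norm E scalars f) * nrm E x"
      using mult_left_mono[OF dual_le[OF f x] norm_ge_zero[of c]] by (simp add: norm_mult mult.assoc)
  qed (use f in \<open>auto simp: f.add f.scale algebra_simps in_dual_iff\<close>)
qed

lemma normed_dual: "normed_space (dual E)"
proof -
  have vs: "vector_space (smul (dual E))"
    by unfold_locales (auto simp: algebra_simps fun_eq_iff)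
  interpret D: vector_space "smul (dual E)" by (rule vs)
  have sub: "D.subspace (vecs (dual E))"
    unfolding D.subspace_def
  proof (intro conjI ballI allI)
    show "0 \<in> vecs (dual E)" by (rule dualI[where C = 0]) auto
    show "f + g \<in> vecs (dual E)" if "f \<in> vecs (dual E)" "g \<in> vecs (dual E)" for f g
      using dual_add_in[OF that] by (simp add: plus_fun_def)
    show "smul (dual E) c f \<in> vecs (dual E)" if "f \<in> vecs (dual E)" for c f
      using dual_scale_in[OF that] by simp
  qed
  have zero: "op_norm E scalars f = 0 \<longleftrightarrow> f = 0" if f: "f \<in> vecs (dual E)" for f
  proof
    assume "op_norm E scalars f = 0"
    then show "f = 0" using dual_le[OF f] f by (intro ext) (fastforce simp: in_dual_iff)
  next
    assume f0: "f = 0"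
    show "op_norm E scalars f = 0"
      using dual_norm_le[OF f, of 0] dual_norm_ge_0[OF f] by (simp add: f0)
  qed
  have scale: "op_norm E scalars (\<lambda>x. c * f x) = norm c * op_norm E scalars f"
    if f: "f \<in> vecs (dual E)" for c f
  proof -
    have le: "op_norm E scalars (\<lambda>x. c * f x) \<le> norm c * op_norm E scalars f"
      if f: "f \<in> vecs (dual E)" for c f
      using mult_left_mono[OF dual_le[OF f] norm_ge_zero[of c]]
      by (intro dual_norm_le dual_scale_in f mult_nonneg_nonneg dual_norm_ge_0)
        (auto simp: norm_mult mult.assoc)
    show ?thesis
    proof (cases "c = 0")
      case True
      then show ?thesis using le[OF f, of c] dual_norm_ge_0[OF dual_scale_in[OF f, of c]] by simp
    next
      case False
      have "norm c * op_norm E scalars f \<le> op_norm E scalars (\<lambda>x. c * f x)"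
        using le[OF dual_scale_in[OF f, of c], of "inverse c"] False
        by (simp add: norm_inverse pos_le_divide_eq mult.commute flip: mult.assoc divide_inverse_commute)
      with le[OF f] show ?thesis by (simp add: antisym)
    qed
  qed
  have add: "op_norm E scalars (f + g) \<le> op_norm E scalars f + op_norm E scalars g"
    if f: "f \<in> vecs (dual E)" and g: "g \<in> vecs (dual E)" for f g
  proof (rule dual_norm_le)
    show "f + g \<in> vecs (dual E)" using f g by (rule D.subspace_add[OF sub])
    show "0 \<le> op_norm E scalars f + op_norm E scalars g"
      using f g by (simp add: dual_norm_ge_0)
    fix x assume x: "x \<in> vecs E"
    show "norm ((f + g) x) \<le> (op_norm E scalars f + op_norm E scalars g) * nrm E x"
      using norm_triangle_ineq[of "f x" "g x"] dual_le[OF f x] dual_le[OF g x]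
      by (simp add: algebra_simps)
  qed
  show ?thesis unfolding normed_space_def
    using vs sub zero scale add by simp
qed

text \<open>
  The norm is composed with an algebraic projection of the ambient vector space onto the space, so
  that the Hahn-Banach theorem applies on the whole type.
\<close>

lemma ex_seminorm_extension:
  "\<exists>p. seminorm (smul E) p \<and> (\<forall>x\<in>vecs E. p x = nrm E x)"
proof -
  obtain P where P: "Vector_Spaces.linear (smul E) (smul E) P" "\<And>x. P x \<in> vecs E"
    "\<And>x. x \<in> vecs E \<Longrightarrow> P x = x"
    using ex_projection[OF vector_space_axioms vecs_subspace] by blast
  interpret P: Vector_Spaces.linear "smul E" "smul E" P by fact
  show ?thesis
    by (rule exI[of _ "\<lambda>x. nrm E (P x)"])
      (auto simp: seminorm_def P.add P.scale nrm_add nrm_scale P(2,3))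
qed

lemma ex_dual_eq_1:
  assumes x: "x \<in> vecs E" "x \<noteq> 0"
  shows "\<exists>f\<in>vecs (dual E). f x = 1"
proof -
  obtain p where p: "seminorm (smul E) p" "\<And>x. x \<in> vecs E \<Longrightarrow> p x = nrm E x"
    using ex_seminorm_extension by blast
  obtain g where g: "Vector_Spaces.linear (smul E) (*) g" "\<And>y. norm (g y) \<le> p y" "p x \<le> norm (g x)"
    using Hahn_Banach_seminorm[OF vector_space_axioms p(1)] by blast
  interpret g: Vector_Spaces.linear "smul E" "(*)" g by fact
  have gx: "g x \<noteq> 0" using g(3) p(2)[OF x(1)] nrm_ge_0[OF x(1)] nrm_eq_0[OF x(1)] x(2) by auto
  let ?f = "\<lambda>y. if y \<in> vecs E then inverse (g x) * g y else 0"
  have "?f \<in> vecs (dual E)"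
  proof (rule dualI)
    fix y assume y: "y \<in> vecs E"
    show "norm (?f y) \<le> norm (inverse (g x)) * nrm E y"
      using g(2)[of y] p(2)[OF y] y by (simp add: norm_mult mult_left_mono)
  qed (auto simp: add_in scale_in g.add g.scale algebra_simps)
  then show ?thesis using gx x by (intro bexI[of _ ?f]) auto
qed

lemma ex_almost_norming:
  assumes f: "f \<in> vecs (dual E)" and "e > 0"
  shows "\<exists>y\<in>vecs E. nrm E y \<le> 1 \<and> op_norm E scalars f - e < norm (f y)"
proof -
  interpret f: op E scalars f by (rule op_dual) fact
  have "op_norm E scalars f - e < (SUP x\<in>vecs E. norm (f x) / nrm E x)"
    using \<open>e > 0\<close> by (simp add: op_norm_def)
  then obtain x where x: "x \<in> vecs E" "op_norm E scalars f - e < norm (f x) / nrm E x"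
    using zero_in by (metis (no_types, lifting) empty_iff less_cSUP_iff[THEN iffD1] cSUP_least linorder_not_less)
  show ?thesis
  proof (cases "x = 0")
    case True
    then show ?thesis using x by (intro bexI[of _ 0]) (auto simp: f.zero)
  next
    case False
    then have "nrm E x > 0" using nrm_ge_0[OF x(1)] nrm_eq_0[OF x(1)] by simp
    then show ?thesis using x
      by (intro bexI[of _ "smul E (of_real (inverse (nrm E x))) x"])
        (auto simp: nrm_scale f.scale scale_in norm_mult norm_inverse divide_inverse mult.commute)
  qed
qed

end

section \<open>Completions\<close>

locale completion = N: normed N
  for N :: "('k::{real_normed_field,euclidean_space}, 'v::ab_group_add) nspace" +
  fixes C :: "('k, 'c::ab_group_add) nspace" and \<iota> :: "'v \<Rightarrow> 'c"
  assumes compl: "is_completion N C \<iota>"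
begin

lemma banach: "banach_space C"
  using compl by (simp add: is_completion_def)

sublocale C: normed C
  by unfold_locales (rule banach_normed[OF banach])

sublocale \<iota>: op N C \<iota>
  using compl by unfold_locales (simp add: is_completion_def)

lemma isometry: "z \<in> vecs N \<Longrightarrow> nrm C (\<iota> z) = nrm N z"
  using compl by (simp add: is_completion_def)

lemma dense: "\<lbrakk>x \<in> vecs C; e > 0\<rbrakk> \<Longrightarrow> \<exists>z\<in>vecs N. nrm C (x - \<iota> z) < e"
  using compl by (simp add: is_completion_def)

lemma dist_isometry: "\<lbrakk>z \<in> vecs N; z' \<in> vecs N\<rbrakk> \<Longrightarrow> nrm C (\<iota> z - \<iota> z') = nrm N (z - z')"
  by (simp add: N.diff_in isometry flip: \<iota>.diff)

lemma bounded_op_eqI: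
  assumes D: "normed_space D" and S: "bounded_op C D S" and T: "bounded_op C D T"
    and eq: "\<And>z. z \<in> vecs N \<Longrightarrow> S (\<iota> z) = T (\<iota> z)" and x: "x \<in> vecs C"
  shows "S x = T x"
proof -
  interpret D: normed D by unfold_locales fact
  interpret S: op C D S using C.normed D S by (rule op_of_bounded)
  interpret T: op C D T using C.normed D T by (rule op_of_bounded)
  let ?K = "op_norm C D S + op_norm C D T"
  have K: "?K \<ge> 0" using S.op_norm_ge_0[OF S] T.op_norm_ge_0[OF T] by simp
  have "nrm D (S x - T x) \<le> 0 + e" if e: "e > 0" for e
  proof -
    obtain z where z: "z \<in> vecs N" "nrm C (x - \<iota> z) < e / (?K + 1)"
      using dense[OF x, of "e / (?K + 1)"] e K by auto
    have d: "x - \<iota> z \<in> vecs C" using x z by (simp add: C.diff_in \<iota>.in_vecs)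
    have "S x - T x = S (x - \<iota> z) - T (x - \<iota> z)"
      using x z eq by (simp add: S.diff T.diff \<iota>.in_vecs)
    also have "nrm D \<dots> \<le> nrm D (S (x - \<iota> z)) + nrm D (T (x - \<iota> z))"
      using d by (intro D.nrm_diff S.in_vecs T.in_vecs)
    also have "\<dots> \<le> ?K * nrm C (x - \<iota> z)"
      using S.le_op_norm[OF S d] T.le_op_norm[OF T d] by (simp add: algebra_simps)
    also have "\<dots> \<le> ?K * (e / (?K + 1))" using z K by (intro mult_left_mono) auto
    also have "\<dots> \<le> e" using K e by (simp add: field_simps)
    finally show ?thesis by simp
  qed
  then have "nrm D (S x - T x) \<le> 0" by (rule field_le_epsilon)
  moreover have d: "S x - T x \<in> vecs D" using x by (simp add: D.diff_in S.in_vecs T.in_vecs)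
  ultimately show ?thesis using D.nrm_ge_0[OF d] D.nrm_eq_0[OF d] by simp
qed

text \<open>
  The value \<open>l\<close> at \<open>x\<close> is characterized by the relation \<open>L x l\<close>: arbitrarily close to \<open>(x, l)\<close> there
  are points of the graph of \<open>T\<close>. Completeness of \<open>D\<close> gives existence, boundedness of \<open>T\<close> gives
  uniqueness, and the relation is evidently compatible with the linear structure.
\<close>

lemma extend:
  assumes D: "banach_space D" and T: "linear_map N D T" and "K \<ge> 0"
    and K: "\<And>z. z \<in> vecs N \<Longrightarrow> nrm D (T z) \<le> K * nrm N z"
  shows "\<exists>J. linear_map C D J \<and> (\<forall>x\<in>vecs C. nrm D (J x) \<le> K * nrm C x) \<and>
             (\<forall>z\<in>vecs N. J (\<iota> z) = T z)"
proof -
  interpret D: normed D by unfold_locales (rule banach_normed[OF D])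
  interpret T: op N D T by unfold_locales fact
  define L where "L = (\<lambda>x l. l \<in> vecs D \<and>
    (\<forall>e>0. \<exists>z\<in>vecs N. nrm C (x - \<iota> z) < e \<and> nrm D (l - T z) < e))"
  have ex: "\<exists>l. L x l" if x: "x \<in> vecs C" for x
  proof -
    have "\<forall>n. \<exists>z\<in>vecs N. nrm C (x - \<iota> z) < inverse (real (Suc n))"
      using dense[OF x] by simp
    then obtain z where z: "\<And>n. z n \<in> vecs N" "\<And>n. nrm C (x - \<iota> (z n)) < inverse (real (Suc n))"
      by metis
    have cauchy: "\<exists>M. \<forall>p\<ge>M. \<forall>q\<ge>M. nrm D (T (z p) - T (z q)) < e" if e: "e > 0" for e
    proof -
      define d where "d = e / (2 * (K + 1))"
      have d: "d > 0" using e \<open>K \<ge> 0\<close> by (simp add: d_def)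
      obtain M where M: "inverse (real (Suc M)) < d" using reals_Archimedean[OF d] by blast
      have near: "nrm C (x - \<iota> (z n)) < d" if "n \<ge> M" for n
      proof -
        have "inverse (real (Suc n)) \<le> inverse (real (Suc M))" using that by (simp add: field_simps)
        with z(2)[of n] M show ?thesis by linarith
      qed
      have "nrm D (T (z p) - T (z q)) < e" if "p \<ge> M" "q \<ge> M" for p q
      proof -
        have "nrm D (T (z p) - T (z q)) \<le> K * nrm N (z p - z q)"
          using K[of "z p - z q"] z(1) by (simp add: N.diff_in T.diff)
        also have "nrm N (z p - z q) = nrm C (\<iota> (z p) - \<iota> (z q))"
          using z(1) by (simp add: dist_isometry)
        also have "\<dots> \<le> nrm C (\<iota> (z p) - x) + nrm C (x - \<iota> (z q))"
          using z(1) x by (intro C.nrm_triangle_diff \<iota>.in_vecs) auto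
        also have "nrm C (\<iota> (z p) - x) = nrm C (x - \<iota> (z p))"
          using z(1) x by (intro C.nrm_diff_commute \<iota>.in_vecs) auto
        also have "K * (nrm C (x - \<iota> (z p)) + nrm C (x - \<iota> (z q))) \<le> K * (2 * d)"
          using near[OF that(1)] near[OF that(2)] \<open>K \<ge> 0\<close> by (intro mult_left_mono) auto
        also have "\<dots> < e" using e \<open>K \<ge> 0\<close> by (simp add: d_def field_simps)
        finally show ?thesis using \<open>K \<ge> 0\<close> by (simp add: mult_left_mono)
      qed
      then show ?thesis by blast
    qed
    obtain l where l: "l \<in> vecs D" "(\<lambda>n. nrm D (T (z n) - l)) \<longlonglongrightarrow> 0"
      using banach_limit[OF D T.in_vecs[OF z(1)] cauchy] by blast
    have "\<exists>z\<in>vecs N. nrm C (x - \<iota> z) < e \<and> nrm D (l - T z) < e" if e: "e > 0" for e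
    proof -
      have "eventually (\<lambda>n. nrm D (T (z n) - l) < e) sequentially"
        using order_tendstoD(2)[OF l(2) e] .
      moreover have "eventually (\<lambda>n. inverse (real (Suc n)) < e) sequentially"
        using order_tendstoD(2)[OF LIMSEQ_inverse_real_of_nat e] .
      ultimately have "eventually (\<lambda>n. nrm D (T (z n) - l) < e \<and> inverse (real (Suc n)) < e) sequentially"
        by (rule eventually_conj)
      then obtain n where n: "nrm D (T (z n) - l) < e" "inverse (real (Suc n)) < e"
        by (auto dest: eventually_happens)
      have "nrm D (l - T (z n)) < e"
        using n(1) l(1) z(1) by (simp add: D.nrm_diff_commute T.in_vecs)
      with less_trans[OF z(2)[of n] n(2)] z(1) show ?thesis by blast
    qed
    with l(1) show ?thesis unfolding L_def by blast
  qed
  have uniq: "l = l'" if "L x l" "L x l'" and x: "x \<in> vecs C" for x l l'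
  proof -
    have ld: "l \<in> vecs D" "l' \<in> vecs D" using that by (auto simp: L_def)
    have "nrm D (l - l') \<le> 0 + e" if e: "e > 0" for e
    proof -
      define d where "d = e / (2 * (K + 1))"
      have d: "d > 0" using e \<open>K \<ge> 0\<close> by (simp add: d_def)
      obtain z where z: "z \<in> vecs N" "nrm C (x - \<iota> z) < d" "nrm D (l - T z) < d"
        using \<open>L x l\<close> d unfolding L_def by blast
      obtain z' where z': "z' \<in> vecs N" "nrm C (x - \<iota> z') < d" "nrm D (l' - T z') < d"
        using \<open>L x l'\<close> d unfolding L_def by blast
      have "nrm N (z - z') = nrm C (\<iota> z - \<iota> z')" using z z' by (simp add: dist_isometry)
      also have "\<dots> \<le> nrm C (\<iota> z - x) + nrm C (x - \<iota> z')"
        using z z' x by (intro C.nrm_triangle_diff \<iota>.in_vecs) auto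
      also have "nrm C (\<iota> z - x) = nrm C (x - \<iota> z)"
        using z x by (intro C.nrm_diff_commute \<iota>.in_vecs) auto
      finally have zz: "nrm N (z - z') \<le> 2 * d" using z z' by simp
      have "nrm D (T z - T z') \<le> K * nrm N (z - z')"
        using K[of "z - z'"] z z' by (simp add: N.diff_in T.diff)
      also have "\<dots> \<le> K * (2 * d)" using zz \<open>K \<ge> 0\<close> by (rule mult_left_mono)
      finally have "nrm D (T z - T z') \<le> K * (2 * d)" .
      moreover have "nrm D (l - l') \<le> nrm D (l - T z) + nrm D (T z - l')"
        using ld z by (intro D.nrm_triangle_diff T.in_vecs) auto
      moreover have "nrm D (T z - l') \<le> nrm D (T z - T z') + nrm D (T z' - l')"
        using ld z z' by (intro D.nrm_triangle_diff T.in_vecs) auto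
      moreover have "nrm D (T z' - l') = nrm D (l' - T z')"
        using ld z' by (intro D.nrm_diff_commute T.in_vecs) auto
      moreover have "2 * d + K * (2 * d) = (2 * (K + 1)) * d" by (simp add: algebra_simps)
      moreover have "(2 * (K + 1)) * d = e" using \<open>K \<ge> 0\<close> by (simp add: d_def)
      ultimately show ?thesis using z z' by simp
    qed
    then have "nrm D (l - l') \<le> 0" by (rule field_le_epsilon)
    then show ?thesis using D.nrm_ge_0[of "l - l'"] D.nrm_eq_0[of "l - l'"] ld by (simp add: D.diff_in)
  qed
  define J where "J = (\<lambda>x. SOME l. L x l)"
  have L: "L x (J x)" if "x \<in> vecs C" for x
    unfolding J_def using ex[OF that] by (rule someI_ex)
  have JD: "J x \<in> vecs D" if "x \<in> vecs C" for x using L[OF that] by (simp add: L_def)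
  have "J (x + y) = J x + J y" if x: "x \<in> vecs C" and y: "y \<in> vecs C" for x y
  proof (rule uniq[OF L])
    show "L (x + y) (J x + J y)" unfolding L_def
    proof (intro conjI allI impI)
      show "J x + J y \<in> vecs D" using x y by (simp add: JD D.add_in)
      fix e :: real assume "e > 0"
      then have e: "e / 2 > 0" by simp
      obtain z where z: "z \<in> vecs N" "nrm C (x - \<iota> z) < e / 2" "nrm D (J x - T z) < e / 2"
        using L[OF x] e unfolding L_def by blast
      obtain z' where z': "z' \<in> vecs N" "nrm C (y - \<iota> z') < e / 2" "nrm D (J y - T z') < e / 2"
        using L[OF y] e unfolding L_def by blast
      have "nrm C ((x - \<iota> z) + (y - \<iota> z')) < e"
        using C.nrm_add[of "x - \<iota> z" "y - \<iota> z'"] x y z z' by (simp add: C.diff_in \<iota>.in_vecs)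
      moreover have "nrm D ((J x - T z) + (J y - T z')) < e"
        using D.nrm_add[of "J x - T z" "J y - T z'"] x y z z' by (simp add: D.diff_in T.in_vecs JD)
      ultimately show "\<exists>z\<in>vecs N. nrm C (x + y - \<iota> z) < e \<and> nrm D (J x + J y - T z) < e"
        using z z' by (intro bexI[of _ "z + z'"]) (auto simp: \<iota>.add T.add N.add_in algebra_simps)
    qed
  qed (use x y in \<open>auto simp: C.add_in\<close>)
  moreover have "J (smul C c x) = smul D c (J x)" if x: "x \<in> vecs C" for c x
  proof (rule uniq[OF L])
    show "L (smul C c x) (smul D c (J x))" unfolding L_def
    proof (intro conjI allI impI)
      show "smul D c (J x) \<in> vecs D" using x by (simp add: JD D.scale_in)
      fix e :: real assume "e > 0"
      then have e: "e / (norm c + 1) > 0" by (simp add: add_nonneg_pos)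
      obtain z where z: "z \<in> vecs N" "nrm C (x - \<iota> z) < e / (norm c + 1)"
        "nrm D (J x - T z) < e / (norm c + 1)"
        using L[OF x] e unfolding L_def by blast
      have small: "norm c * a < e" if "a < e / (norm c + 1)" "a \<ge> 0" for a
      proof -
        have "norm c * a \<le> (norm c + 1) * a" using that by (simp add: mult_right_mono)
        also have "\<dots> < e"
          using that(1) by (simp add: pos_less_divide_eq add_nonneg_pos mult.commute)
        finally show ?thesis .
      qed
      have "nrm C (smul C c (x - \<iota> z)) < e"
        using x z by (simp add: C.nrm_scale C.diff_in \<iota>.in_vecs small C.nrm_ge_0 del: C.scale_right_diff_distrib)
      moreover have "nrm D (smul D c (J x - T z)) < e"
        using x z by (simp add: D.nrm_scale D.diff_in T.in_vecs JD small D.nrm_ge_0)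
      ultimately show "\<exists>z\<in>vecs N. nrm C (smul C c x - \<iota> z) < e \<and> nrm D (smul D c (J x) - T z) < e"
        using z by (intro bexI[of _ "smul N c z"])
          (auto simp: \<iota>.scale T.scale N.scale_in C.scale_right_diff_distrib D.scale_right_diff_distrib)
    qed
  qed (use x in \<open>auto simp: C.scale_in\<close>)
  ultimately have "linear_map C D J" by (simp add: linear_map_def JD)
  moreover have "nrm D (J x) \<le> K * nrm C x" if x: "x \<in> vecs C" for x
  proof (rule field_le_epsilon)
    fix e :: real assume e: "e > 0"
    define d where "d = e / (K + 1)"
    have d: "d > 0" using e \<open>K \<ge> 0\<close> by (simp add: d_def)
    obtain z where z: "z \<in> vecs N" "nrm C (x - \<iota> z) < d" "nrm D (J x - T z) < d"
      using L[OF x] d unfolding L_def by blast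
    have "nrm N z \<le> nrm C x + d"
      using C.nrm_le_diff[of "\<iota> z" x] C.nrm_diff_commute[of x "\<iota> z"] x z
      by (simp add: \<iota>.in_vecs isometry)
    then have "K * nrm N z \<le> K * (nrm C x + d)" using \<open>K \<ge> 0\<close> by (rule mult_left_mono)
    moreover have "nrm D (J x) \<le> nrm D (T z) + nrm D (J x - T z)"
      using x z by (intro D.nrm_le_diff) (auto simp: JD T.in_vecs)
    moreover have "K * d + d = (K + 1) * d" by (simp add: algebra_simps)
    moreover have "(K + 1) * d = e" using \<open>K \<ge> 0\<close> by (simp add: d_def)
    ultimately show "nrm D (J x) \<le> K * nrm C x + e" using z K[OF z(1)] by (simp add: algebra_simps)
  qed
  moreover have "J (\<iota> z) = T z" if z: "z \<in> vecs N" for z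
  proof (rule uniq[OF L])
    show "L (\<iota> z) (T z)" unfolding L_def
      using z by (auto simp: T.in_vecs intro!: bexI[of _ z])
  qed (use z \<iota>.in_vecs in auto)
  ultimately show ?thesis by blast
qed

lemma ex_dual_extension:
  "\<exists>S. bounded_op (dual N) (dual C) S \<and> (\<forall>f\<in>vecs (dual N). \<forall>z\<in>vecs N. S f (\<iota> z) = f z)"
proof -
  have "\<exists>g. g \<in> vecs (dual C) \<and> op_norm C scalars g \<le> op_norm N scalars f \<and>
      (\<forall>z\<in>vecs N. g (\<iota> z) = f z)" if f: "f \<in> vecs (dual N)" for f
  proof -
    have "linear_map N scalars f" using f by (simp add: in_dual_iff bounded_op_def)
    from extend[OF banach_scalars this N.dual_norm_ge_0[OF f]] N.dual_le[OF f]
    obtain J where J: "linear_map C scalars J"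
      "\<And>x. x \<in> vecs C \<Longrightarrow> norm (J x) \<le> op_norm N scalars f * nrm C x"
      "\<And>z. z \<in> vecs N \<Longrightarrow> J (\<iota> z) = f z" by auto
    let ?g = "\<lambda>x. if x \<in> vecs C then J x else 0"
    have "?g \<in> vecs (dual C)"
      by (rule C.dualI[where C = "op_norm N scalars f"])
        (use J in \<open>auto simp: C.add_in C.scale_in linear_map_def\<close>)
    moreover from this have "op_norm C scalars ?g \<le> op_norm N scalars f"
      by (rule C.dual_norm_le) (use J N.dual_norm_ge_0[OF f] in auto)
    ultimately show ?thesis using J(3) \<iota>.in_vecs by (intro exI[of _ ?g]) auto
  qed
  then obtain S where S: "\<And>f. f \<in> vecs (dual N) \<Longrightarrow> S f \<in> vecs (dual C)"
    "\<And>f. f \<in> vecs (dual N) \<Longrightarrow> op_norm C scalars (S f) \<le> op_norm N scalars f"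
    "\<And>f z. \<lbrakk>f \<in> vecs (dual N); z \<in> vecs N\<rbrakk> \<Longrightarrow> S f (\<iota> z) = f z" by metis
  interpret DN: normed "dual N" by unfold_locales (rule N.normed_dual)
  interpret DC: normed "dual C" by unfold_locales (rule C.normed_dual)
  have eq: "g = h" if "g \<in> vecs (dual C)" "h \<in> vecs (dual C)"
    "\<And>z. z \<in> vecs N \<Longrightarrow> g (\<iota> z) = h (\<iota> z)" for g h
    by (rule C.dual_eqI[OF that(1,2)], rule bounded_op_eqI[OF normed_scalars])
      (use that in \<open>auto simp: in_dual_iff\<close>)
  have "linear_map (dual N) (dual C) S" unfolding linear_map_def
  proof (intro conjI ballI allI)
    fix f g assume f: "f \<in> vecs (dual N)" and g: "g \<in> vecs (dual N)"
    show "S (f + g) = S f + S g"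
      by (rule eq) (use f g in \<open>auto simp: S DN.add_in DC.add_in\<close>)
  next
    fix c f assume f: "f \<in> vecs (dual N)"
    show "S (smul (dual N) c f) = smul (dual C) c (S f)"
      using DN.scale_in[OF f, of c] DC.scale_in[OF S(1)[OF f], of c] f
      by (intro eq) (auto simp: S)
  qed (rule S)
  then have "bounded_op (dual N) (dual C) S"
    unfolding bounded_op_def using S(2) by (auto intro!: exI[of _ 1])
  with S(3) show ?thesis by blast
qed

end

section \<open>Operators between duals from nets of almost operators\<close>

text \<open>
  The maps \<open>R i\<close> need to be linear, bounded and \<open>B\<close>-valued only eventually, for each fixed choice of
  arguments. This is the situation of operators that are defined on larger and larger subspaces. The
  operator \<open>S f = lim f \<circ> R i\<close> along an ultrafilter is then linear in \<open>f\<close> as well, since the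
  ultrafilter is the same for all \<open>f\<close>.
\<close>

lemma ex_dual_operator_of_net:
  fixes R :: "'i \<Rightarrow> 'a::ab_group_add \<Rightarrow> 'b::ab_group_add"
    and A :: "('k::{real_normed_field,euclidean_space}, 'a) nspace" and B :: "('k, 'b) nspace"
  assumes A: "normed_space A" and B: "normed_space B" and F: "F \<noteq> bot" and "l \<ge> 0"
    and add: "\<And>x y. \<lbrakk>x \<in> vecs A; y \<in> vecs A\<rbrakk> \<Longrightarrow> eventually (\<lambda>i. R i (x + y) = R i x + R i y) F"
    and scale: "\<And>c x. x \<in> vecs A \<Longrightarrow> eventually (\<lambda>i. R i (smul A c x) = smul B c (R i x)) F"
    and maps: "\<And>x. x \<in> vecs A \<Longrightarrow> eventually (\<lambda>i. R i x \<in> vecs B) F"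
    and bound: "\<And>x e. \<lbrakk>x \<in> vecs A; e > 0\<rbrakk> \<Longrightarrow> eventually (\<lambda>i. nrm B (R i x) \<le> l * nrm A x + e) F"
  shows "\<exists>S. bounded_op (dual B) (dual A) S \<and>
    (\<forall>f\<in>vecs (dual B). \<forall>x\<in>vecs A. \<forall>y. eventually (\<lambda>i. R i x = y) F \<longrightarrow> S f x = f y)"
proof -
  interpret A: normed A by unfold_locales fact
  interpret B: normed B by unfold_locales fact
  interpret DB: normed "dual B" by unfold_locales (rule B.normed_dual)
  interpret DA: normed "dual A" by unfold_locales (rule A.normed_dual)
  obtain U where U: "U \<le> F" "minimal_filter U" using ex_minimal_filter[OF F] by blast
  have U_ne: "U \<noteq> bot" using U(2) by (simp add: minimal_filter_def)
  have evU: "eventually P U" if "eventually P F" for P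
    using that U(1) by (simp add: le_filter_def)
  have normb: "eventually (\<lambda>i. norm (f (R i x)) \<le> op_norm B scalars f * (l * nrm A x + e)) U"
    if f: "f \<in> vecs (dual B)" and x: "x \<in> vecs A" and e: "e > 0" for f x e
    using evU[OF bound[OF x e]] evU[OF maps[OF x]]
  proof eventually_elim
    case (elim i)
    show ?case
      using order_trans[OF B.dual_le[OF f elim(2)]]
        mult_left_mono[OF elim(1) B.dual_norm_ge_0[OF f]] by blast
  qed
  define S where "S = (\<lambda>(f :: 'b \<Rightarrow> 'k) x. if x \<in> vecs A then Lim U (\<lambda>i. f (R i x)) else 0)"
  have lim: "((\<lambda>i. f (R i x)) \<longlongrightarrow> S f x) U"
    if f: "f \<in> vecs (dual B)" and x: "x \<in> vecs A" for f x
  proof -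
    have "eventually (\<lambda>i. f (R i x) \<in> cball 0 (op_norm B scalars f * (l * nrm A x + 1))) U"
      using normb[OF f x zero_less_one] by simp
    from minimal_filter_tendsto[OF U(2) compact_cball this]
    obtain a where "((\<lambda>i. f (R i x)) \<longlongrightarrow> a) U" by blast
    then show ?thesis using x U_ne by (simp add: S_def tendsto_Lim)
  qed
  have limI: "S f x = a" if "((\<lambda>i. f (R i x)) \<longlongrightarrow> a) U" "f \<in> vecs (dual B)" "x \<in> vecs A" for f x a
    using tendsto_unique[OF U_ne lim[OF that(2,3)] that(1)] .
  have Sbound: "norm (S f x) \<le> (l * op_norm B scalars f) * nrm A x"
    if f: "f \<in> vecs (dual B)" and x: "x \<in> vecs A" for f x
  proof -
    let ?n = "op_norm B scalars f"
    have n: "?n \<ge> 0" by (rule B.dual_norm_ge_0[OF f])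
    have "norm (S f x) \<le> ?n * (l * nrm A x) + e" if e: "e > 0" for e
    proof -
      have "e / (?n + 1) > 0" using e n by simp
      from tendsto_upperbound[OF tendsto_norm[OF lim[OF f x]] normb[OF f x this] U_ne]
      have "norm (S f x) \<le> ?n * (l * nrm A x) + ?n * (e / (?n + 1))" by (simp add: distrib_left)
      also have "?n * (e / (?n + 1)) \<le> e" using e n by (simp add: field_simps)
      finally show ?thesis by simp
    qed
    then have "norm (S f x) \<le> ?n * (l * nrm A x)" by (rule field_le_epsilon)
    then show ?thesis by (simp add: mult_ac)
  qed
  have Sin: "S f \<in> vecs (dual A)" if f: "f \<in> vecs (dual B)" for f
  proof -
    interpret f: op B scalars f by (rule B.op_dual) fact
    show ?thesis
    proof (rule A.dualI)
      fix x y assume xy: "x \<in> vecs A" "y \<in> vecs A"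
      show "S f (x + y) = S f x + S f y"
      proof (rule limI)
        have "eventually (\<lambda>i. f (R i x) + f (R i y) = f (R i (x + y))) U"
          using evU[OF add[OF xy]] evU[OF maps[OF xy(1)]] evU[OF maps[OF xy(2)]]
          by eventually_elim (simp add: f.add)
        from Lim_transform_eventually[OF tendsto_add[OF lim[OF f xy(1)] lim[OF f xy(2)]] this]
        show "((\<lambda>i. f (R i (x + y))) \<longlongrightarrow> S f x + S f y) U" .
      qed (use f xy A.add_in in auto)
    next
      fix c x assume x: "x \<in> vecs A"
      show "S f (smul A c x) = c * S f x"
      proof (rule limI)
        have "eventually (\<lambda>i. c * f (R i x) = f (R i (smul A c x))) U"
          using evU[OF scale[OF x, of c]] evU[OF maps[OF x]]
          by eventually_elim (simp add: f.scale)
        from Lim_transform_eventually[OF tendsto_mult_left[OF lim[OF f x]] this]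
        show "((\<lambda>i. f (R i (smul A c x))) \<longlongrightarrow> c * S f x) U" .
      qed (use f x A.scale_in in auto)
    qed (use Sbound[OF f] in \<open>auto simp: S_def\<close>)
  qed
  have "linear_map (dual B) (dual A) S" unfolding linear_map_def
  proof (intro conjI ballI allI Sin)
    fix f g assume f: "f \<in> vecs (dual B)" and g: "g \<in> vecs (dual B)"
    show "S (f + g) = S f + S g"
    proof (rule A.dual_eqI)
      fix x assume x: "x \<in> vecs A"
      show "S (f + g) x = (S f + S g) x"
        by (rule limI) (use tendsto_add[OF lim[OF f x] lim[OF g x]] x DB.add_in[OF f g] in auto)
    qed (use f g in \<open>auto simp: Sin DB.add_in DA.add_in\<close>)
  next
    fix c f assume f: "f \<in> vecs (dual B)"
    show "S (smul (dual B) c f) = smul (dual A) c (S f)"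
    proof (rule A.dual_eqI)
      fix x assume x: "x \<in> vecs A"
      show "S (smul (dual B) c f) x = smul (dual A) c (S f) x"
        by (rule limI) (use tendsto_mult_left[OF lim[OF f x]] x DB.scale_in[OF f] in auto)
    qed (use f DB.scale_in[OF f] DA.scale_in[OF Sin[OF f]] in \<open>auto simp: Sin\<close>)
  qed
  moreover have "op_norm A scalars (S f) \<le> l * op_norm B scalars f" if f: "f \<in> vecs (dual B)" for f
    by (rule A.dual_norm_le[OF Sin[OF f]])
      (use Sbound[OF f] \<open>l \<ge> 0\<close> B.dual_norm_ge_0[OF f] in auto)
  ultimately have "bounded_op (dual B) (dual A) S" by (auto simp: bounded_op_def)
  moreover have "S f x = f y" if "f \<in> vecs (dual B)" "x \<in> vecs A" "eventually (\<lambda>i. R i x = y) F" for f x y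
  proof (rule limI)
    have "eventually (\<lambda>i. f y = f (R i x)) U" using evU[OF that(3)] by eventually_elim simp
    from Lim_transform_eventually[OF tendsto_const this] show "((\<lambda>i. f (R i x)) \<longlongrightarrow> f y) U" .
  qed (use that in auto)
  ultimately show ?thesis by blast
qed

section \<open>Finite-dimensional subspaces\<close>

context normed
begin

text \<open>
  All norms on a finite-dimensional space are equivalent. The proof is by induction on the basis: by
  the induction hypothesis the span of \<open>B\<close> is complete, so the new basis vector \<open>e\<close> has a positive
  distance \<open>d\<close> from it, and \<open>d\<close> controls the coefficient of \<open>e\<close>.
\<close>

lemma coefficients_bounded:
  assumes "finite B" "independent B" "B \<subseteq> vecs E"
  shows "\<exists>C\<ge>0. \<forall>a. \<forall>b\<in>B. norm (a b) \<le> C * nrm E (\<Sum>b\<in>B. smul E (a b) b)"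
  using assms
proof (induction B rule: finite_induct)
  case empty
  then show ?case by (auto intro: exI[of _ 0])
next
  case (insert e B)
  have indB: "independent B" and e: "e \<notin> span B"
    using insert.prems(1) insert.hyps(2) by (auto simp: independent_insert)
  have BE: "B \<subseteq> vecs E" and eE: "e \<in> vecs E" using insert.prems(2) by auto
  obtain C where "C \<ge> 0" and C: "\<And>a b. b \<in> B \<Longrightarrow> norm (a b) \<le> C * nrm E (\<Sum>b\<in>B. smul E (a b) b)"
    using insert.IH[OF indB BE] by blast
  have comb: "(\<Sum>b\<in>B. smul E (a b) b) \<in> vecs E" for a
    using BE by (auto intro!: sum_in scale_in)
  have "\<exists>d>0. \<forall>a. d \<le> nrm E (e - (\<Sum>b\<in>B. smul E (a b) b))"
  proof (rule ccontr)
    assume "\<not> ?thesis"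
    then have *: "\<And>d. d > 0 \<Longrightarrow> \<exists>a. nrm E (e - (\<Sum>b\<in>B. smul E (a b) b)) < d"
      by (meson not_le)
    have "\<exists>a. nrm E (e - (\<Sum>b\<in>B. smul E (a b) b)) < inverse (real (Suc n))" for n
      by (rule *) simp
    then obtain a where a: "\<And>n. nrm E (e - (\<Sum>b\<in>B. smul E (a n b) b)) < inverse (real (Suc n))"
      by metis
    let ?z = "\<lambda>n. \<Sum>b\<in>B. smul E (a n b) b"
    have conv: "\<exists>l. (\<lambda>n. a n b) \<longlonglongrightarrow> l" if b: "b \<in> B" for b
    proof -
      have "Cauchy (\<lambda>n. a n b)"
      proof (rule metric_CauchyI)
        fix r :: real assume r: "r > 0"
        then have "r / (2 * (C + 1)) > 0" using \<open>C \<ge> 0\<close> by simp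
        then obtain M where M: "inverse (real (Suc M)) < r / (2 * (C + 1))"
          using reals_Archimedean by blast
        show "\<exists>M. \<forall>m\<ge>M. \<forall>n\<ge>M. dist (a m b) (a n b) < r"
        proof (intro exI allI impI)
          fix m n assume mn: "m \<ge> M" "n \<ge> M"
          have small: "nrm E (e - ?z k) < r / (2 * (C + 1))" if "k \<ge> M" for k
          proof -
            have "inverse (real (Suc k)) \<le> inverse (real (Suc M))" using that by (simp add: field_simps)
            with a[of k] M show ?thesis by linarith
          qed
          have "dist (a m b) (a n b) \<le> C * nrm E (?z m - ?z n)"
            using C[OF b, of "\<lambda>b. a m b - a n b"]
            by (simp add: dist_norm scale_left_diff_distrib sum_subtractf)
          also have "nrm E (?z m - ?z n) \<le> nrm E (?z m - e) + nrm E (e - ?z n)"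
            by (intro nrm_triangle_diff comb eE)
          also have "nrm E (?z m - e) = nrm E (e - ?z m)"
            by (intro nrm_diff_commute comb eE)
          also have "C * (nrm E (e - ?z m) + nrm E (e - ?z n)) \<le> C * (r / (C + 1))"
            using small[OF mn(1)] small[OF mn(2)] \<open>C \<ge> 0\<close> by (intro mult_left_mono) (auto simp: field_simps)
          also have "\<dots> < r" using r \<open>C \<ge> 0\<close> by (simp add: field_simps)
          finally show "dist (a m b) (a n b) < r" using \<open>C \<ge> 0\<close> by (simp add: mult_left_mono)
        qed
      qed
      then show ?thesis using Cauchy_convergent convergent_def by blast
    qed
    then have "\<forall>b. \<exists>l. b \<in> B \<longrightarrow> (\<lambda>n. a n b) \<longlonglongrightarrow> l" by blast
    then obtain l where l: "\<And>b. b \<in> B \<Longrightarrow> (\<lambda>n. a n b) \<longlonglongrightarrow> l b" by metis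
    let ?l = "\<Sum>b\<in>B. smul E (l b) b"
    have le: "nrm E (e - ?l) \<le> inverse (real (Suc n)) + (\<Sum>b\<in>B. norm (a n b - l b) * nrm E b)" for n
    proof -
      have "nrm E (e - ?l) \<le> nrm E (e - ?z n) + nrm E (?z n - ?l)"
        by (intro nrm_triangle_diff comb eE)
      moreover have "?z n - ?l = (\<Sum>b\<in>B. smul E (a n b - l b) b)"
        by (simp add: scale_left_diff_distrib sum_subtractf)
      moreover have "nrm E \<dots> \<le> (\<Sum>b\<in>B. nrm E (smul E (a n b - l b) b))"
        using BE by (intro nrm_sum scale_in) auto
      moreover have "\<dots> = (\<Sum>b\<in>B. norm (a n b - l b) * nrm E b)"
        using BE by (intro sum.cong refl nrm_scale) auto
      ultimately show ?thesis using a[of n] by simp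
    qed
    have "(\<lambda>n. inverse (real (Suc n)) + (\<Sum>b\<in>B. norm (a n b - l b) * nrm E b))
        \<longlonglongrightarrow> 0 + (\<Sum>b\<in>B. 0 * nrm E b)"
      using l by (intro tendsto_add LIMSEQ_inverse_real_of_nat tendsto_sum tendsto_mult_right
          tendsto_norm_zero LIM_zero)
    then have "nrm E (e - ?l) \<le> 0 + (\<Sum>b\<in>B. 0 * nrm E b)"
      by (rule LIMSEQ_le_const) (use le in auto)
    then have "e = ?l" using nrm_ge_0[of "e - ?l"] nrm_eq_0[of "e - ?l"] comb[of l] eE
      by (simp add: diff_in)
    moreover have "?l \<in> span B" by (intro span_sum span_scale span_base)
    ultimately show False using e by simp
  qed
  then obtain d where d: "d > 0" "\<And>a. d \<le> nrm E (e - (\<Sum>b\<in>B. smul E (a b) b))" by blast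
  let ?C = "max (1 / d) (C * (1 + nrm E e / d))"
  have "norm (a b) \<le> ?C * nrm E (\<Sum>b\<in>insert e B. smul E (a b) b)" if b: "b \<in> insert e B" for a b
  proof -
    let ?z = "\<Sum>b\<in>B. smul E (a b) b"
    let ?x = "smul E (a e) e + ?z"
    have x: "?x \<in> vecs E" using comb eE by (intro add_in scale_in)
    have ae: "norm (a e) * d \<le> nrm E ?x"
    proof (cases "a e = 0")
      case True
      then show ?thesis using nrm_ge_0[OF comb] by simp
    next
      case False
      define y where "y = (\<Sum>b\<in>B. smul E (- (inverse (a e) * a b)) b)"
      have y: "smul E (a e) y = - ?z"
        using False by (simp add: y_def scale_sum_right sum_negf flip: mult.assoc)
      have "norm (a e) * d \<le> norm (a e) * nrm E (e - y)"
        unfolding y_def by (intro mult_left_mono d(2)) simp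
      also have "\<dots> = nrm E (smul E (a e) (e - y))"
        unfolding y_def by (intro nrm_scale[symmetric] diff_in comb eE)
      also have "smul E (a e) (e - y) = ?x" by (simp add: scale_right_diff_distrib y)
      finally show ?thesis .
    qed
    have sum: "(\<Sum>b\<in>insert e B. smul E (a b) b) = ?x" using insert.hyps by simp
    have "norm (a b) \<le> ?C * nrm E ?x"
    proof (cases "b = e")
      case True
      then have "norm (a b) \<le> (1 / d) * nrm E ?x" using ae d(1) by (simp add: field_simps)
      also have "\<dots> \<le> ?C * nrm E ?x" using nrm_ge_0[OF x] by (intro mult_right_mono) auto
      finally show ?thesis .
    next
      case False
      then have "norm (a b) \<le> C * nrm E ?z" using b C by blast
      also have "nrm E ?z \<le> nrm E ?x + nrm E (smul E (a e) e)"
        using nrm_diff[OF x scale_in[OF eE, of "a e"]] by simp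
      also have "\<dots> = nrm E ?x + norm (a e) * nrm E e" using eE by (simp add: nrm_scale)
      also have "norm (a e) * nrm E e \<le> (nrm E ?x / d) * nrm E e"
        using ae d(1) nrm_ge_0[OF eE] by (intro mult_right_mono) (simp_all add: field_simps)
      also have "C * (nrm E ?x + nrm E ?x / d * nrm E e) = (C * (1 + nrm E e / d)) * nrm E ?x"
        by (simp add: algebra_simps)
      also have "\<dots> \<le> ?C * nrm E ?x" using nrm_ge_0[OF x] by (intro mult_right_mono) auto
      finally show ?thesis using \<open>C \<ge> 0\<close> by (simp add: mult_left_mono)
    qed
    then show ?thesis using sum by simp
  qed
  moreover have "?C \<ge> 0" using d(1) by (simp add: le_max_iff_disj)
  ultimately show ?case by blast
qed

text \<open>
  The coefficients of vectors in the unit ball range over a compact set, and a finite net for the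
  coefficients yields a net for the vectors.
\<close>

lemma ex_finite_net:
  assumes B: "finite B" "independent B" "B \<subseteq> vecs E" and "\<delta> > 0"
  shows "\<exists>N. finite N \<and> N \<subseteq> span B \<and> (\<forall>s\<in>N. nrm E s \<le> 1 + \<delta>) \<and>
           (\<forall>x\<in>span B. nrm E x \<le> 1 \<longrightarrow> (\<exists>s\<in>N. nrm E (x - s) \<le> \<delta>))"
proof -
  obtain C where "C \<ge> 0" and C: "\<And>a b. b \<in> B \<Longrightarrow> norm (a b) \<le> C * nrm E (\<Sum>b\<in>B. smul E (a b) b)"
    using coefficients_bounded[OF B] by blast
  have BE: "\<And>b. b \<in> B \<Longrightarrow> b \<in> vecs E" using B by auto
  define \<eta> where "\<eta> = \<delta> / (1 + (\<Sum>b\<in>B. nrm E b))"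
  have sum0: "(\<Sum>b\<in>B. nrm E b) \<ge> 0" using BE by (intro sum_nonneg nrm_ge_0)
  then have \<eta>: "\<eta> > 0" using \<open>\<delta> > 0\<close> by (simp add: \<eta>_def)
  obtain K where K: "finite K" "cball (0::'k) C \<subseteq> (\<Union>k\<in>K. ball k \<eta>)"
    using compact_cball[of "0::'k" C] \<eta> unfolding compact_eq_totally_bounded by blast
  let ?N = "(\<lambda>a. \<Sum>b\<in>B. smul E (a b) b) ` (PiE B (\<lambda>_. K))"
  let ?N' = "{s \<in> ?N. nrm E s \<le> 1 + \<delta>}"
  have spanE: "span B \<subseteq> vecs E" using B(3) vecs_subspace by (rule span_minimal)
  have Nspan: "?N \<subseteq> span B" by (intro image_subsetI span_sum span_scale span_base)
  have "\<exists>s\<in>?N'. nrm E (x - s) \<le> \<delta>" if x: "x \<in> span B" "nrm E x \<le> 1" for x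
  proof -
    obtain a where a: "x = (\<Sum>b\<in>B. smul E (a b) b)" using x(1) span_finite[OF B(1)] by auto
    have "\<exists>k\<in>K. norm (a b - k) < \<eta>" if b: "b \<in> B" for b
    proof -
      have "norm (a b) \<le> C * 1"
        using C[OF b, of a, folded a] mult_left_mono[OF x(2) \<open>C \<ge> 0\<close>] by simp
      then have "a b \<in> cball 0 C" by simp
      then obtain k where "k \<in> K" "a b \<in> ball k \<eta>" using K(2) by blast
      then show ?thesis by (auto simp: dist_norm norm_minus_commute)
    qed
    then obtain k where k: "\<And>b. b \<in> B \<Longrightarrow> k b \<in> K" "\<And>b. b \<in> B \<Longrightarrow> norm (a b - k b) < \<eta>" by metis
    let ?k = "restrict k B"
    let ?s = "\<Sum>b\<in>B. smul E (?k b) b"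
    have s: "?s \<in> ?N" using k(1) by (intro imageI) auto
    have "nrm E (x - ?s) = nrm E (\<Sum>b\<in>B. smul E (a b - k b) b)"
      by (simp add: a scale_left_diff_distrib sum_subtractf)
    also have "\<dots> \<le> (\<Sum>b\<in>B. nrm E (smul E (a b - k b) b))"
      using BE by (intro nrm_sum scale_in)
    also have "\<dots> = (\<Sum>b\<in>B. norm (a b - k b) * nrm E b)"
      using BE by (intro sum.cong refl nrm_scale)
    also have "\<dots> \<le> (\<Sum>b\<in>B. \<eta> * nrm E b)"
      using k(2) BE by (intro sum_mono mult_right_mono nrm_ge_0) (auto intro: less_imp_le)
    also have "\<dots> = \<eta> * (\<Sum>b\<in>B. nrm E b)" by (simp add: sum_distrib_left)
    also have "\<dots> \<le> \<delta>" using sum0 \<open>\<delta> > 0\<close> by (simp add: \<eta>_def field_simps)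
    finally have near: "nrm E (x - ?s) \<le> \<delta>" .
    have "x \<in> vecs E" "?s \<in> vecs E" using x(1) s Nspan spanE by auto
    then have "nrm E ?s \<le> nrm E x + nrm E (x - ?s)"
      using nrm_le_diff[of ?s x] nrm_diff_commute[of ?s x] by simp
    with near x(2) s show ?thesis by (intro bexI[of _ ?s]) auto
  qed
  moreover have "finite ?N'" using B(1) K(1) by (simp add: finite_PiE)
  ultimately show ?thesis using Nspan by (intro exI[of _ ?N']) blast
qed

end

section \<open>Local complementation and duals\<close>

text \<open>
  Indexing the local projections by finite sets of vectors, with \<open>F\<close> the span of the set, makes the
  filter of all sufficiently large finite-dimensional subspaces available.
\<close>

theorem dual_operator_of_locally_complemented:
  assumes Y: "normed_space Y" and X: "normed_space X" and lc: "locally_complemented Y X j"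
  shows "\<exists>S. bounded_op (dual Y) (dual X) S \<and> (\<forall>f\<in>vecs (dual Y). \<forall>y\<in>vecs Y. S f (j y) = f y)"
proof -
  interpret Y: normed Y by unfold_locales fact
  interpret X: normed X by unfold_locales fact
  obtain l where j: "bounded_op Y X j" and "l > 0"
    and ex: "\<And>F. fd_subspace X F \<Longrightarrow> \<exists>r. bounded_op (sub X F) Y r \<and> op_norm (sub X F) Y r \<le> l \<and>
             (\<forall>y\<in>vecs Y. j y \<in> F \<longrightarrow> r (j y) = y)"
    using lc unfolding locally_complemented_def by blast
  interpret j: op Y X j using Y X j by (rule op_of_bounded)
  have "\<forall>A. \<exists>r. finite A \<and> A \<subseteq> vecs X \<longrightarrow> bounded_op (sub X (X.span A)) Y r \<and>
      op_norm (sub X (X.span A)) Y r \<le> l \<and> (\<forall>y\<in>vecs Y. j y \<in> X.span A \<longrightarrow> r (j y) = y)"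
    using ex unfolding fd_subspace_def by blast
  then obtain R where R: "\<And>A. \<lbrakk>finite A; A \<subseteq> vecs X\<rbrakk> \<Longrightarrow> bounded_op (sub X (X.span A)) Y (R A)"
    "\<And>A. \<lbrakk>finite A; A \<subseteq> vecs X\<rbrakk> \<Longrightarrow> op_norm (sub X (X.span A)) Y (R A) \<le> l"
    "\<And>A y. \<lbrakk>finite A; A \<subseteq> vecs X; y \<in> vecs Y; j y \<in> X.span A\<rbrakk> \<Longrightarrow> R A (j y) = y"
    by metis
  have R_op: "op (sub X (X.span A)) Y (R A)" if "finite A" "A \<subseteq> vecs X" for A
    using X.span_minimal[OF that(2) X.vecs_subspace]
    by (intro op_of_bounded X.normed_sub Y R that) auto
  let ?F = "finite_subsets_at_top (vecs X)"
  have large: "eventually (\<lambda>A. finite A \<and> A \<subseteq> vecs X \<and> Z \<subseteq> X.span A) ?F"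
    if Z: "finite Z" "Z \<subseteq> vecs X" for Z
    unfolding eventually_finite_subsets_at_top
    using Z by (intro exI[of _ Z]) (auto intro: X.span_base)
  have "\<exists>S. bounded_op (dual Y) (dual X) S \<and>
    (\<forall>f\<in>vecs (dual Y). \<forall>x\<in>vecs X. \<forall>y. eventually (\<lambda>A. R A x = y) ?F \<longrightarrow> S f x = f y)"
  proof (rule ex_dual_operator_of_net[OF X Y _ less_imp_le[OF \<open>l > 0\<close>]])
    fix x y assume xy: "x \<in> vecs X" "y \<in> vecs X"
    show "eventually (\<lambda>A. R A (x + y) = R A x + R A y) ?F"
      using large[of "{x, y}"] xy
      by (auto elim!: eventually_mono dest!: R_op[THEN op.add, of _ x y])
  next
    fix c x assume x: "x \<in> vecs X"
    show "eventually (\<lambda>A. R A (smul X c x) = smul Y c (R A x)) ?F"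
      using large[of "{x}"] x
      by (auto elim!: eventually_mono dest!: R_op[THEN op.scale, of _ x c])
  next
    fix x assume x: "x \<in> vecs X"
    show "eventually (\<lambda>A. R A x \<in> vecs Y) ?F"
      using large[of "{x}"] x
      by (auto elim!: eventually_mono dest!: R_op[THEN op.in_vecs, of _ x])
  next
    fix x and e :: real assume x: "x \<in> vecs X" and e: "e > 0"
    have "eventually (\<lambda>A. finite A \<and> A \<subseteq> vecs X \<and> {x} \<subseteq> X.span A) ?F" using x by (intro large) auto
    then show "eventually (\<lambda>A. nrm Y (R A x) \<le> l * nrm X x + e) ?F"
    proof eventually_elim
      case (elim A)
      then have "nrm Y (R A x) \<le> op_norm (sub X (X.span A)) Y (R A) * nrm X x"
        using op.le_op_norm[OF R_op R(1), of A x] by simp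
      also have "\<dots> \<le> l * nrm X x" using elim R(2) X.nrm_ge_0[OF x] by (intro mult_right_mono) auto
      finally show ?case using e by simp
    qed
  qed simp
  then obtain S where S: "bounded_op (dual Y) (dual X) S"
    "\<And>f x y. \<lbrakk>f \<in> vecs (dual Y); x \<in> vecs X; eventually (\<lambda>A. R A x = y) ?F\<rbrakk> \<Longrightarrow> S f x = f y" by blast
  have "S f (j y) = f y" if f: "f \<in> vecs (dual Y)" and y: "y \<in> vecs Y" for f y
  proof (rule S(2)[OF f j.in_vecs[OF y]])
    have "eventually (\<lambda>A. finite A \<and> A \<subseteq> vecs X \<and> {j y} \<subseteq> X.span A) ?F"
      using y j.in_vecs by (intro large) auto
    then show "eventually (\<lambda>A. R A (j y) = y) ?F"
      by eventually_elim (use R(3) y in auto)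
  qed
  with S(1) show ?thesis by blast
qed

text \<open>
  Let \<open>B\<close> be a basis of \<open>F\<close> that extends a basis \<open>B\<^sub>1\<close> of \<open>F \<inter> j Y\<close>, with coordinates \<open>a\<close>. The
  operators on \<open>F\<close> that invert \<open>j\<close> on \<open>F \<inter> j Y\<close> are the elements of \<open>r\<^sub>0 + M\<close>, where \<open>r\<^sub>0\<close> maps the
  basis vectors outside \<open>B\<^sub>1\<close> to \<open>0\<close> and \<open>M\<close> consists of the operators that vanish on \<open>B\<^sub>1\<close>. They are
  measured by their largest norm \<open>q\<close> on a finite net \<open>N\<close> of the unit ball.

  A functional \<open>g\<close> with \<open>\<bar>g\<bar> \<le> q\<close> is a sum of functionals \<open>G s\<close> on the values at the net points \<open>s\<close>,
  with \<open>\<Sum> \<parallel>G s\<parallel> \<le> 1\<close>. Put \<open>H e = \<Sum>\<^sub>s a s e \<cdot> G s\<close>. If \<open>g\<close> vanishes on \<open>M\<close> then \<open>H e = 0\<close> for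
  \<open>e \<notin> B\<^sub>1\<close>, whereas \<open>H e\<close> takes at the preimage of \<open>e \<in> B\<^sub>1\<close> the value \<open>S (H e) e\<close>. Hence
  \<open>g r\<^sub>0 = \<Sum>\<^sub>e S (H e) e = \<Sum>\<^sub>s S (G s) s\<close>, and this is bounded independently of \<open>F\<close>.
\<close>

theorem locally_complemented_of_dual_operator:
  fixes Y :: "('k::{real_normed_field,euclidean_space}, 'v::ab_group_add) nspace"
    and X :: "('k, 'w::ab_group_add) nspace"
  assumes Y: "normed_space Y" and X: "normed_space X" and j: "bounded_op Y X j"
    and S: "bounded_op (dual Y) (dual X) S"
    and Sj: "\<And>f y. \<lbrakk>f \<in> vecs (dual Y); y \<in> vecs Y\<rbrakk> \<Longrightarrow> S f (j y) = f y"
  shows "locally_complemented Y X j"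
proof -
  interpret Y: normed Y by unfold_locales fact
  interpret X: normed X by unfold_locales fact
  interpret j: op Y X j using Y X j by (rule op_of_bounded)
  interpret DY: normed "dual Y" by unfold_locales (rule Y.normed_dual)
  interpret DX: normed "dual X" by unfold_locales (rule X.normed_dual)
  interpret S: op "dual Y" "dual X" S using Y.normed_dual X.normed_dual S by (rule op_of_bounded)
  define K where "K = op_norm (dual Y) (dual X) S"
  have K0: "K \<ge> 0" unfolding K_def using S by (rule S.op_norm_ge_0)
  have S_bound: "norm (S f x) \<le> K * op_norm Y scalars f * nrm X x"
    if f: "f \<in> vecs (dual Y)" and x: "x \<in> vecs X" for f x
  proof -
    have "norm (S f x) \<le> op_norm X scalars (S f) * nrm X x"
      by (rule X.dual_le[OF S.in_vecs[OF f] x])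
    also have "\<dots> \<le> (K * op_norm Y scalars f) * nrm X x"
      using S.le_op_norm[OF S f] X.nrm_ge_0[OF x] by (intro mult_right_mono) (auto simp: K_def)
    finally show ?thesis .
  qed
  have inj: "y = 0" if y: "y \<in> vecs Y" "j y = 0" for y
  proof (rule ccontr)
    assume "y \<noteq> 0"
    then obtain f where f: "f \<in> vecs (dual Y)" "f y = 1" using Y.ex_dual_eq_1[OF y(1)] by blast
    interpret Sf: op X scalars "S f" by (rule X.op_dual[OF S.in_vecs[OF f(1)]])
    show False using Sj[OF f(1) y(1)] y(2) f(2) Sf.zero by simp
  qed
  have "\<exists>r. bounded_op (sub X F) Y r \<and> op_norm (sub X F) Y r \<le> 4 * K + 2 \<and>
          (\<forall>y\<in>vecs Y. j y \<in> F \<longrightarrow> r (j y) = y)" if F: "fd_subspace X F" for F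
  proof -
    obtain B\<^sub>0 where B\<^sub>0: "finite B\<^sub>0" "B\<^sub>0 \<subseteq> vecs X" "F = X.span B\<^sub>0"
      using F by (auto simp: fd_subspace_def)
    have FX: "F \<subseteq> vecs X" unfolding B\<^sub>0(3) by (rule X.span_minimal[OF B\<^sub>0(2) X.vecs_subspace])
    have F_sub: "X.subspace F" unfolding B\<^sub>0(3) by (rule X.subspace_span)
    let ?T = "F \<inter> j ` vecs Y"
    have T_sub: "X.subspace ?T"
    proof (rule X.subspace_inter[OF F_sub])
      show "X.subspace (j ` vecs Y)" unfolding X.subspace_def
      proof (intro conjI ballI allI)
        show "0 \<in> j ` vecs Y" using j.zero Y.zero_in by (metis imageI)
      qed (auto simp: image_iff simp flip: j.add j.scale intro: Y.add_in Y.scale_in)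
    qed
    obtain B\<^sub>1 where B\<^sub>1: "B\<^sub>1 \<subseteq> ?T" "X.independent B\<^sub>1" "?T \<subseteq> X.span B\<^sub>1"
      by (rule X.basis_exists[of ?T]) blast
    have "B\<^sub>1 \<subseteq> F" using B\<^sub>1 by blast
    from X.maximal_independent_subset_extend[OF this B\<^sub>1(2)]
    obtain B where B: "B\<^sub>1 \<subseteq> B" "B \<subseteq> F" "X.independent B" "F \<subseteq> X.span B" by blast
    have spanB: "X.span B = F" using B(4) X.span_minimal[OF B(2) F_sub] by blast
    have finB: "finite B" using X.independent_span_bound[OF B\<^sub>0(1) B(3)] B(2) B\<^sub>0(3) by blast
    have finB\<^sub>1: "finite B\<^sub>1" using finB B(1) by (rule finite_subset[rotated])
    have BX: "B \<subseteq> vecs X" using B(2) FX by blast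
    define a where "a = (\<lambda>x e. X.representation B x e)"
    have a_sum: "(\<Sum>e\<in>B. smul X (a x e) e) = x" if "x \<in> F" for x
      unfolding a_def using that spanB finB B(3) by (intro X.sum_representation_eq) auto
    have a_add: "a (x + y) e = a x e + a y e" if "x \<in> F" "y \<in> F" for x y e
      unfolding a_def using that spanB B(3) by (simp add: X.representation_add)
    have a_scale: "a (smul X c x) e = c * a x e" if "x \<in> F" for x c e
      unfolding a_def using that spanB B(3) by (simp add: X.representation_scale)
    have a_T: "a x e = 0" if x: "x \<in> ?T" and e: "e \<notin> B\<^sub>1" for x e
    proof -
      have "X.representation B x = X.representation B\<^sub>1 x"
        using x B\<^sub>1(3) by (intro X.representation_extend[OF B(3) _ B(1)]) auto
      then show ?thesis unfolding a_def using X.representation_ne_zero[of B\<^sub>1 x e] e by auto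
    qed
    obtain C where "C \<ge> 0"
      and C: "\<And>a b. b \<in> B \<Longrightarrow> norm (a b) \<le> C * nrm X (\<Sum>b\<in>B. smul X (a b) b)"
      using X.coefficients_bounded[OF finB B(3) BX] by blast
    have a_bound: "norm (a x e) \<le> C * nrm X x" if "x \<in> F" "e \<in> B" for x e
      using C[OF that(2), of "a x"] a_sum[OF that(1)] by simp
    have "\<forall>e. \<exists>y. e \<in> B\<^sub>1 \<longrightarrow> y \<in> vecs Y \<and> j y = e" using B\<^sub>1(1) by blast
    then obtain y\<^sub>1 where y\<^sub>1: "\<And>e. e \<in> B\<^sub>1 \<Longrightarrow> y\<^sub>1 e \<in> vecs Y" "\<And>e. e \<in> B\<^sub>1 \<Longrightarrow> j (y\<^sub>1 e) = e"
      by metis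
    obtain N where N: "finite N" "N \<subseteq> F" "\<And>s. s \<in> N \<Longrightarrow> nrm X s \<le> 2"
      "\<And>x. \<lbrakk>x \<in> F; nrm X x \<le> 1\<rbrakk> \<Longrightarrow> \<exists>s\<in>N. nrm X (x - s) \<le> 1 / 2"
    proof -
      have "(0::real) < 1 / 2" by simp
      from X.ex_finite_net[OF finB B(3) BX this] obtain N where
        "finite N" "N \<subseteq> F" "\<forall>s\<in>N. nrm X s \<le> 1 + 1 / 2"
        "\<forall>x\<in>F. nrm X x \<le> 1 \<longrightarrow> (\<exists>s\<in>N. nrm X (x - s) \<le> 1 / 2)"
        unfolding spanB by blast
      then show thesis by (intro that) force+
    qed
    have NX: "s \<in> vecs X" if "s \<in> N" for s using that N(2) FX by blast
    \<comment> \<open>All these maps are regarded as functions on the whole type; only their values on the net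
      matter for the seminorm.\<close>
    define r\<^sub>0 where "r\<^sub>0 = (\<lambda>x. \<Sum>e\<in>B\<^sub>1. smul Y (a x e) (y\<^sub>1 e))"
    define M where "M = {\<lambda>x. \<Sum>e\<in>B - B\<^sub>1. smul Y (a x e) (u e) | u. \<forall>e. u e \<in> vecs Y}"
    let ?s = "\<lambda>c (h :: 'w \<Rightarrow> 'v) x. smul Y c (h x)"
    obtain p where p: "seminorm (smul Y) p" "\<And>y. y \<in> vecs Y \<Longrightarrow> p y = nrm Y y"
      using Y.ex_seminorm_extension by blast
    note pD = seminormD[OF Y.vector_space_axioms p(1)]
    define q where "q = (\<lambda>h :: 'w \<Rightarrow> 'v. Max (insert 0 ((\<lambda>s. p (h s)) ` N)))"
    have q_le: "q h \<le> c" if "c \<ge> 0" "\<And>s. s \<in> N \<Longrightarrow> p (h s) \<le> c" for h c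
      unfolding q_def using that N(1) by (subst Max_le_iff) auto
    have q_ge: "p (h s) \<le> q h" if "s \<in> N" for h s
      unfolding q_def using that N(1) by (intro Max_ge) auto
    have q_0: "q h \<ge> 0" for h unfolding q_def using N(1) by (intro Max_ge) auto
    interpret W: vector_space ?s
      by unfold_locales (auto simp: fun_eq_iff Y.scale_right_distrib Y.scale_left_distrib)
    have q_semi: "seminorm ?s q"
    proof (rule seminormI[OF W.vector_space_axioms])
      fix h h' :: "'w \<Rightarrow> 'v"
      show "q (h + h') \<le> q h + q h'"
      proof (rule q_le)
        show "p ((h + h') s) \<le> q h + q h'" if "s \<in> N" for s
          using pD(1)[of "h s" "h' s"] q_ge[OF that, of h] q_ge[OF that, of h'] by simp
      qed (use q_0[of h] q_0[of h'] in simp)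
    next
      fix c and h :: "'w \<Rightarrow> 'v"
      show "q (?s c h) \<le> norm c * q h"
        using q_0 q_ge by (intro q_le) (auto simp: pD intro!: mult_left_mono)
    qed
    have M_sub: "W.subspace M" unfolding W.subspace_def
    proof (intro conjI ballI allI)
      show "0 \<in> M" unfolding M_def by (auto intro!: exI[of _ "\<lambda>_. 0"] simp: fun_eq_iff)
    next
      fix h h' assume "h \<in> M" "h' \<in> M"
      then obtain u u' where "\<forall>e. u e \<in> vecs Y" "\<forall>e. u' e \<in> vecs Y"
        "h = (\<lambda>x. \<Sum>e\<in>B - B\<^sub>1. smul Y (a x e) (u e))" "h' = (\<lambda>x. \<Sum>e\<in>B - B\<^sub>1. smul Y (a x e) (u' e))"
        unfolding M_def by blast
      then show "h + h' \<in> M" unfolding M_def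
        by (auto intro!: exI[of _ "\<lambda>e. u e + u' e"] Y.add_in
            simp: fun_eq_iff Y.scale_right_distrib sum.distrib)
    next
      fix c h assume "h \<in> M"
      then obtain u where "\<forall>e. u e \<in> vecs Y" "h = (\<lambda>x. \<Sum>e\<in>B - B\<^sub>1. smul Y (a x e) (u e))"
        unfolding M_def by blast
      then show "?s c h \<in> M" unfolding M_def
        by (auto intro!: exI[of _ "\<lambda>e. smul Y c (u e)"] Y.scale_in
            simp: fun_eq_iff Y.scale_sum_right mult.commute)
    qed
    have "\<exists>m\<in>M. q (r\<^sub>0 - m) < 2 * K + 1"
    proof (rule Hahn_Banach_distance[OF W.vector_space_axioms q_semi M_sub, where c = "2 * K"])
      fix g :: "('w \<Rightarrow> 'v) \<Rightarrow> 'k"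
      assume g: "Vector_Spaces.linear ?s (*) g" and gq: "\<And>h. norm (g h) \<le> q h"
        and gM: "\<And>h. h \<in> M \<Longrightarrow> g h = 0"
      interpret g: Vector_Spaces.linear ?s "(*)" g by fact
      define \<delta> where "\<delta> = (\<lambda>s (y::'v) (x::'w). if x = s then y else 0)"
      define G where "G = (\<lambda>s y. if y \<in> vecs Y then g (\<delta> s y) else 0)"
      have g_eq: "g h = g h'" if "\<And>s. s \<in> N \<Longrightarrow> h s = h' s" for h h'
      proof -
        have "q (h - h') \<le> 0" using that by (intro q_le) (auto simp: pD)
        then have "norm (g (h - h')) \<le> 0" using gq[of "h - h'"] by linarith
        then show ?thesis by (simp add: g.diff)
      qed
      have g_sum: "g h = (\<Sum>s\<in>N. G s (h s))" if "\<And>s. s \<in> N \<Longrightarrow> h s \<in> vecs Y" for h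
      proof -
        have "g h = g (\<Sum>s\<in>N. \<delta> s (h s))"
        proof (rule g_eq)
          fix t assume t: "t \<in> N"
          have "(\<Sum>s\<in>N. \<delta> s (h s)) t = (\<Sum>s\<in>N. \<delta> s (h s) t)"
            by (induction N rule: infinite_finite_induct) auto
          also have "\<dots> = h t" using t N(1) by (simp add: \<delta>_def sum.delta)
          finally show "h t = (\<Sum>s\<in>N. \<delta> s (h s)) t" ..
        qed
        also have "\<dots> = (\<Sum>s\<in>N. g (\<delta> s (h s)))" by (rule g.sum)
        finally show ?thesis using that by (simp add: G_def)
      qed
      have G_in: "G s \<in> vecs (dual Y)" for s
      proof (rule Y.dualI[where C = 1])
        fix y assume y: "y \<in> vecs Y"
        have "q (\<delta> s y) \<le> nrm Y y"
          using y by (intro q_le) (auto simp: \<delta>_def p(2) pD Y.nrm_ge_0)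
        then show "norm (G s y) \<le> 1 * nrm Y y" using gq[of "\<delta> s y"] y by (simp add: G_def)
      next
        fix x y assume "x \<in> vecs Y" "y \<in> vecs Y"
        moreover have "\<delta> s (x + y) = \<delta> s x + \<delta> s y" by (auto simp: \<delta>_def)
        ultimately show "G s (x + y) = G s x + G s y" by (simp add: G_def g.add Y.add_in)
      next
        fix c x assume "x \<in> vecs Y"
        moreover have "\<delta> s (smul Y c x) = ?s c (\<delta> s x)" by (auto simp: \<delta>_def)
        ultimately show "G s (smul Y c x) = c * G s x" by (simp add: G_def g.scale Y.scale_in)
      qed (simp add: G_def)
      have G_norm: "(\<Sum>s\<in>N. op_norm Y scalars (G s)) \<le> 1"
      proof (rule field_le_epsilon)
        fix e :: real assume e: "e > 0"
        define d where "d = e / (1 + real (card N))"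
        have d: "d > 0" using e by (simp add: d_def)
        have "\<forall>s. \<exists>y. y \<in> vecs Y \<and> nrm Y y \<le> 1 \<and> op_norm Y scalars (G s) - d < norm (G s y)"
          using Y.ex_almost_norming[OF G_in d] by blast
        then obtain y where y: "\<And>s. y s \<in> vecs Y" "\<And>s. nrm Y (y s) \<le> 1"
          "\<And>s. op_norm Y scalars (G s) - d < norm (G s (y s))" by metis
        \<comment> \<open>Multiplying by phases makes all values nonnegative.\<close>
        define z where "z = (\<lambda>s. smul Y (inverse (G s (y s)) * of_real (norm (G s (y s)))) (y s))"
        have z_in: "z s \<in> vecs Y" for s using y by (simp add: z_def Y.scale_in)
        have z_norm: "nrm Y (z s) \<le> 1" for s
        proof (cases "G s (y s) = 0")
          case True
          then show ?thesis by (simp add: z_def)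
        next
          case False
          then show ?thesis using y by (simp add: z_def Y.nrm_scale norm_mult norm_inverse)
        qed
        have Gz: "G s (z s) = of_real (norm (G s (y s)))" for s
        proof -
          interpret Gs: op Y scalars "G s" by (rule Y.op_dual[OF G_in])
          show ?thesis using y by (cases "G s (y s) = 0") (simp_all add: z_def Gs.scale Gs.zero)
        qed
        have "(\<Sum>s\<in>N. op_norm Y scalars (G s)) \<le> (\<Sum>s\<in>N. norm (G s (y s)) + d)"
          using y(3) by (intro sum_mono) (smt (verit))
        also have "\<dots> = (\<Sum>s\<in>N. norm (G s (y s))) + real (card N) * d" by (simp add: sum.distrib)
        also have "real (card N) * d \<le> e" using e by (simp add: d_def field_simps)
        also have "(\<Sum>s\<in>N. norm (G s (y s))) = norm (\<Sum>s\<in>N. G s (z s))"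
          by (simp add: Gz sum_nonneg flip: of_real_sum)
        also have "(\<Sum>s\<in>N. G s (z s)) = g z" using z_in by (intro g_sum[symmetric])
        also have "norm (g z) \<le> 1"
          using order_trans[OF gq q_le[of 1 z]] z_in z_norm by (simp add: p(2))
        finally show "(\<Sum>s\<in>N. op_norm Y scalars (G s)) \<le> 1 + e" by simp
      qed
      define H where "H = (\<lambda>e. \<Sum>s\<in>N. smul (dual Y) (a s e) (G s))"
      have H_in: "H e \<in> vecs (dual Y)" for e
        unfolding H_def by (intro DY.sum_in DY.scale_in G_in)
      have sum_fun: "(\<Sum>s\<in>N. \<phi> s) x = (\<Sum>s\<in>N. \<phi> s x)" for \<phi> :: "'w \<Rightarrow> 'b \<Rightarrow> 'k" and x :: 'b
        by (induction N rule: infinite_finite_induct) auto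
      have H_val: "H e y = (\<Sum>s\<in>N. a s e * G s y)" for e y
        unfolding H_def sum_fun by simp
      have SH_val: "S (H e) x = (\<Sum>s\<in>N. a s e * S (G s) x)" for e x
      proof -
        have "S (H e) = (\<Sum>s\<in>N. S (smul (dual Y) (a s e) (G s)))"
          unfolding H_def by (intro S.sum DY.scale_in G_in)
        also have "\<dots> = (\<Sum>s\<in>N. smul (dual X) (a s e) (S (G s)))"
          by (intro sum.cong refl S.scale G_in)
        finally show ?thesis by (simp add: sum_fun)
      qed
      have H_0: "H e = 0" if e: "e \<in> B - B\<^sub>1" for e
      proof (rule Y.dual_eqI[OF H_in DY.zero_in])
        fix y assume y: "y \<in> vecs Y"
        interpret GG: op Y scalars "G s" for s by (rule Y.op_dual[OF G_in])
        have "(\<lambda>x. smul Y (a x e) y) = (\<lambda>x. \<Sum>e'\<in>B - B\<^sub>1. smul Y (a x e') (if e' = e then y else 0))"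
          using e finB by (intro ext) (simp add: if_distrib[of "smul Y _"] cong: if_cong)
        then have "(\<lambda>x. smul Y (a x e) y) \<in> M" unfolding M_def using y by force
        from gM[OF this] have "(\<Sum>s\<in>N. G s (smul Y (a s e) y)) = 0"
          using g_sum[of "\<lambda>x. smul Y (a x e) y"] y by (simp add: Y.scale_in)
        then show "H e y = 0 y" using y by (simp add: H_val GG.scale)
      qed
      interpret SG: op X scalars "S (G s)" for s by (rule X.op_dual[OF S.in_vecs[OF G_in]])
      have "g r\<^sub>0 = (\<Sum>s\<in>N. G s (r\<^sub>0 s))"
        unfolding r\<^sub>0_def using y\<^sub>1 by (intro g_sum Y.sum_in Y.scale_in)
      also have "\<dots> = (\<Sum>s\<in>N. \<Sum>e\<in>B\<^sub>1. a s e * G s (y\<^sub>1 e))"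
      proof (intro sum.cong refl)
        fix s
        interpret Gs: op Y scalars "G s" by (rule Y.op_dual[OF G_in])
        show "G s (r\<^sub>0 s) = (\<Sum>e\<in>B\<^sub>1. a s e * G s (y\<^sub>1 e))"
          unfolding r\<^sub>0_def using y\<^sub>1 by (simp add: Gs.sum Gs.scale Y.scale_in)
      qed
      also have "\<dots> = (\<Sum>e\<in>B\<^sub>1. H e (y\<^sub>1 e))" unfolding H_val by (rule sum.swap)
      also have "\<dots> = (\<Sum>e\<in>B\<^sub>1. S (H e) e)"
        using Sj[OF H_in] y\<^sub>1 by (intro sum.cong refl) (metis (no_types))
      also have "\<dots> = (\<Sum>e\<in>B. S (H e) e)"
        using finB B(1) by (intro sum.mono_neutral_left) (auto simp: H_0 S.zero)
      also have "\<dots> = (\<Sum>s\<in>N. \<Sum>e\<in>B. a s e * S (G s) e)" unfolding SH_val by (rule sum.swap)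
      also have "\<dots> = (\<Sum>s\<in>N. S (G s) s)"
      proof (intro sum.cong refl)
        fix s assume s: "s \<in> N"
        have "S (G s) s = S (G s) (\<Sum>e\<in>B. smul X (a s e) e)" using a_sum s N(2) by force
        also have "\<dots> = (\<Sum>e\<in>B. S (G s) (smul X (a s e) e))"
          using BX by (intro SG.sum X.scale_in) auto
        also have "\<dots> = (\<Sum>e\<in>B. a s e * S (G s) e)"
          using BX by (intro sum.cong refl) (auto simp: SG.scale)
        finally show "(\<Sum>e\<in>B. a s e * S (G s) e) = S (G s) s" ..
      qed
      finally have "norm (g r\<^sub>0) \<le> (\<Sum>s\<in>N. norm (S (G s) s))" by (simp add: norm_sum)
      also have "\<dots> \<le> (\<Sum>s\<in>N. K * op_norm Y scalars (G s) * 2)"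
      proof (rule sum_mono)
        fix s assume s: "s \<in> N"
        have "norm (S (G s) s) \<le> K * op_norm Y scalars (G s) * nrm X s"
          by (rule S_bound[OF G_in NX[OF s]])
        also have "\<dots> \<le> K * op_norm Y scalars (G s) * 2"
          using N(3)[OF s] K0 Y.dual_norm_ge_0[OF G_in] by (intro mult_left_mono) auto
        finally show "norm (S (G s) s) \<le> K * op_norm Y scalars (G s) * 2" .
      qed
      also have "\<dots> = 2 * K * (\<Sum>s\<in>N. op_norm Y scalars (G s))"
        by (simp add: sum_distrib_left mult_ac)
      also have "\<dots> \<le> 2 * K * 1" using G_norm K0 by (intro mult_left_mono) auto
      finally show "norm (g r\<^sub>0) \<le> 2 * K" by simp
    qed simp
    then obtain u where u: "\<And>e. u e \<in> vecs Y"
      and qu: "q (r\<^sub>0 - (\<lambda>x. \<Sum>e\<in>B - B\<^sub>1. smul Y (a x e) (u e))) < 2 * K + 1"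
      unfolding M_def by blast
    define w where "w = (\<lambda>e. if e \<in> B\<^sub>1 then y\<^sub>1 e else - u e)"
    define r where "r = (\<lambda>x. \<Sum>e\<in>B. smul Y (a x e) (w e))"
    have w_in: "w e \<in> vecs Y" for e by (simp add: w_def y\<^sub>1 u Y.neg_in)
    have r_split: "r x = r\<^sub>0 x - (\<Sum>e\<in>B - B\<^sub>1. smul Y (a x e) (u e))" for x
    proof -
      have "r x = (\<Sum>e\<in>B\<^sub>1. smul Y (a x e) (w e)) + (\<Sum>e\<in>B - B\<^sub>1. smul Y (a x e) (w e))"
        unfolding r_def using B(1) finB by (simp add: sum.subset_diff add.commute)
      then show ?thesis by (simp add: w_def r\<^sub>0_def sum_negf)
    qed
    have r_in: "r x \<in> vecs Y" for x unfolding r_def by (intro Y.sum_in Y.scale_in w_in)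
    have normed_F: "normed_space (sub X F)" by (rule X.normed_sub[OF F_sub FX])
    have r_lin: "linear_map (sub X F) Y r"
      by (auto simp: linear_map_def r_in)
        (auto simp: r_def a_add a_scale Y.scale_left_distrib sum.distrib Y.scale_sum_right)
    interpret r: op "sub X F" Y r using normed_F Y r_lin by (simp add: op_def normed_def op_axioms_def)
    have r_bdd: "bounded_op (sub X F) Y r"
    proof (rule r.bounded_opI)
      fix x assume "x \<in> vecs (sub X F)"
      then have x: "x \<in> F" by simp
      have "nrm Y (r x) \<le> (\<Sum>e\<in>B. nrm Y (smul Y (a x e) (w e)))"
        unfolding r_def by (intro Y.nrm_sum Y.scale_in w_in)
      also have "\<dots> \<le> (\<Sum>e\<in>B. (C * nrm X x) * nrm Y (w e))"
        using a_bound[OF x] by (intro sum_mono) (auto simp: Y.nrm_scale w_in Y.nrm_ge_0 intro!: mult_right_mono)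
      finally show "nrm Y (r x) \<le> (C * (\<Sum>e\<in>B. nrm Y (w e))) * nrm (sub X F) x"
        by (simp add: sum_distrib_left mult_ac)
    qed
    have r_net: "nrm Y (r s) \<le> 2 * K + 1" if s: "s \<in> N" for s
    proof -
      have "nrm Y (r s) = p (r s)" by (simp add: p(2) r_in)
      also have "\<dots> \<le> q (r\<^sub>0 - (\<lambda>x. \<Sum>e\<in>B - B\<^sub>1. smul Y (a x e) (u e)))"
        using q_ge[OF s, of "r\<^sub>0 - (\<lambda>x. \<Sum>e\<in>B - B\<^sub>1. smul Y (a x e) (u e))"] by (simp add: r_split)
      finally show ?thesis using qu by simp
    qed
    let ?R = "op_norm (sub X F) Y r"
    have R0: "?R \<ge> 0" using r_bdd by (rule r.op_norm_ge_0)
    \<comment> \<open>The net controls the norm of \<open>r\<close> up to half of itself, which is finite and can be absorbed.\<close>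
    have unit: "nrm Y (r x) \<le> 2 * K + 1 + ?R / 2" if x: "x \<in> F" "nrm X x \<le> 1" for x
    proof -
      obtain s where s: "s \<in> N" "nrm X (x - s) \<le> 1 / 2" using N(4)[OF x] by blast
      have sF: "s \<in> F" using s N(2) by blast
      have xs: "x - s \<in> F" using x(1) sF F_sub by (rule X.subspace_diff[rotated])
      have "nrm Y (r x) \<le> nrm Y (r s) + nrm Y (r (x - s))"
        using Y.nrm_le_diff[of "r x" "r s"] x(1) sF by (simp add: r_in r.diff)
      also have "nrm Y (r (x - s)) \<le> ?R * nrm X (x - s)"
        using r.le_op_norm[OF r_bdd, of "x - s"] xs by simp
      also have "\<dots> \<le> ?R * (1 / 2)" using s(2) R0 by (rule mult_left_mono)
      finally show ?thesis using r_net[OF s(1)] by simp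
    qed
    have "?R \<le> 2 * K + 1 + ?R / 2"
    proof (rule r.op_norm_le)
      fix x assume "x \<in> vecs (sub X F)"
      then have x: "x \<in> F" "x \<in> vecs X" using FX by auto
      show "nrm Y (r x) \<le> (2 * K + 1 + ?R / 2) * nrm (sub X F) x"
      proof (cases "x = 0")
        case True
        then show ?thesis by (simp add: r.zero)
      next
        case False
        then have n: "nrm X x > 0" using X.nrm_ge_0[OF x(2)] X.nrm_eq_0[OF x(2)] by simp
        let ?c = "of_real (inverse (nrm X x)) :: 'k"
        have "nrm Y (r (smul X ?c x)) \<le> 2 * K + 1 + ?R / 2"
          using x n by (intro unit X.subspace_scale F_sub) (auto simp: X.nrm_scale norm_inverse)
        then have "inverse (nrm X x) * nrm Y (r x) \<le> 2 * K + 1 + ?R / 2"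
          using r.scale[of x ?c] x(1) n by (simp add: Y.nrm_scale r_in norm_inverse)
        then show ?thesis using n by (simp add: field_simps)
      qed
    qed (use K0 R0 in simp)
    then have "?R \<le> 4 * K + 2" by simp
    moreover have "r (j y) = y" if y: "y \<in> vecs Y" and jy: "j y \<in> F" for y
    proof -
      have T: "j y \<in> ?T" using y jy by blast
      have "r (j y) = r\<^sub>0 (j y)" using a_T[OF T] by (simp add: r_split)
      have r\<^sub>0_in: "r\<^sub>0 x \<in> vecs Y" for x unfolding r\<^sub>0_def using y\<^sub>1 by (intro Y.sum_in Y.scale_in)
      have "j (r\<^sub>0 (j y)) = (\<Sum>e\<in>B\<^sub>1. smul X (a (j y) e) e)"
        unfolding r\<^sub>0_def using y\<^sub>1 by (simp add: j.sum j.scale Y.scale_in)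
      also have "\<dots> = (\<Sum>e\<in>B. smul X (a (j y) e) e)"
        using finB B(1) a_T[OF T] by (intro sum.mono_neutral_left) auto
      also have "\<dots> = j y" by (rule a_sum[OF jy])
      finally have "j (r\<^sub>0 (j y) - y) = 0" using y r\<^sub>0_in by (simp add: j.diff)
      then have "r\<^sub>0 (j y) - y = 0" using y r\<^sub>0_in by (intro inj Y.diff_in)
      with \<open>r (j y) = r\<^sub>0 (j y)\<close> show ?thesis by simp
    qed
    ultimately show ?thesis using r_bdd by blast
  qed
  moreover have "4 * K + 2 > 0" using K0 by simp
  ultimately show ?thesis using j unfolding locally_complemented_def by blast
qed

section \<open>Tensor products\<close>

lemma tensor_space_simps [simp]:
  "vecs (tensor_space E \<nu>) = {tensor_sum E xs | xs. set xs \<subseteq> tuples E}"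
  "smul (tensor_space E \<nu>) = (\<lambda>c z \<phi>. c * z \<phi>)" "nrm (tensor_space E \<nu>) = \<nu>"
  by (simp_all add: tensor_space_def)

lemma tensor_sum_simps [simp]:
  "tensor_sum E [] = 0"
  "tensor_sum E (x # xs) = elementary_tensor E x + tensor_sum E xs"
  "tensor_sum E (xs @ ys) = tensor_sum E xs + tensor_sum E ys"
  by (simp_all add: tensor_sum_def)

lemma elementary_tensor_in: "x \<in> tuples E \<Longrightarrow> elementary_tensor E x \<in> vecs (tensor_space E \<nu>)"
  by (auto intro!: exI[of _ "[x]"])

lemma elementary_tensor_sub:
  "elementary_tensor (\<lambda>i. sub (E i) (M i)) = elementary_tensor E"
  by (simp add: elementary_tensor_def ambient_form_def fun_eq_iff)

lemma tensor_sum_sub: "tensor_sum (\<lambda>i. sub (E i) (M i)) = tensor_sum E"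
  by (simp add: tensor_sum_def elementary_tensor_sub fun_eq_iff)

lemma in_tuples_iff: "x \<in> tuples E \<longleftrightarrow> (\<forall>i. x i \<in> vecs (E i))"
  by (simp add: tuples_def)

lemma vector_space_tensors:
  "vector_space (\<lambda>c (z :: ('m, 'k::field, 'u) tensor) \<phi>. c * z \<phi>)"
  by unfold_locales (auto simp: algebra_simps fun_eq_iff)

text \<open>
  Elementary tensors are evaluations of multilinear forms on the ambient spaces, so multilinearity
  holds for arbitrary vectors and not only for those in the spaces \<open>E i\<close>.
\<close>

lemma elementary_tensor_add:
  "elementary_tensor E (x(i := u + v)) = elementary_tensor E (x(i := u)) + elementary_tensor E (x(i := v))"
proof
  fix \<phi>
  show "elementary_tensor E (x(i := u + v)) \<phi> =
    (elementary_tensor E (x(i := u)) + elementary_tensor E (x(i := v))) \<phi>"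
  proof (cases "ambient_form E \<phi>")
    case True
    then interpret Vector_Spaces.linear "smul (E i)" "(*)" "\<lambda>t. \<phi> (x(i := t))"
      by (simp add: ambient_form_def)
    show ?thesis using True by (simp add: elementary_tensor_def add)
  qed (simp add: elementary_tensor_def)
qed

lemma elementary_tensor_scale:
  "elementary_tensor E (x(i := smul (E i) c u)) = (\<lambda>\<phi>. c * elementary_tensor E (x(i := u)) \<phi>)"
proof
  fix \<phi>
  show "elementary_tensor E (x(i := smul (E i) c u)) \<phi> = c * elementary_tensor E (x(i := u)) \<phi>"
  proof (cases "ambient_form E \<phi>")
    case True
    then interpret Vector_Spaces.linear "smul (E i)" "(*)" "\<lambda>t. \<phi> (x(i := t))"
      by (simp add: ambient_form_def)
    show ?thesis using True by (simp add: elementary_tensor_def scale)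
  qed (simp add: elementary_tensor_def)
qed

lemma tensor_map_sum:
  fixes E G :: "'m \<Rightarrow> ('k::{real_normed_field,euclidean_space}, 'u::ab_group_add) nspace"
  assumes E: "\<And>i. normed_space (E i)" and T: "\<And>i. linear_map (E i) (G i) (T i)"
    and xs: "set xs \<subseteq> tuples E"
  shows "tensor_map E G T (tensor_sum E xs) = tensor_sum G (map (\<lambda>x i. T i (x i)) xs)"
proof -
  have upd: "(\<lambda>k. T k ((x(i := t)) k)) = (\<lambda>k. T k (x k))(i := T i t)" for x i t by auto
  have "tensor_map E G T (tensor_sum E xs) = (\<Sum>x\<leftarrow>xs. elementary_tensor G (\<lambda>i. T i (x i)))"
    unfolding tensor_map_def
  proof (rule tensor_lift_sum[OF E vector_space_tensors _ _ xs])
    fix x i u v assume "u \<in> vecs (E i)" "v \<in> vecs (E i)"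
    then show "elementary_tensor G (\<lambda>k. T k ((x(i := u + v)) k)) =
      elementary_tensor G (\<lambda>k. T k ((x(i := u)) k)) + elementary_tensor G (\<lambda>k. T k ((x(i := v)) k))"
      using T[of i] unfolding upd by (simp add: linear_map_def elementary_tensor_add)
  next
    fix x i c u assume "u \<in> vecs (E i)"
    then show "elementary_tensor G (\<lambda>k. T k ((x(i := smul (E i) c u)) k)) =
      (\<lambda>\<phi>. c * elementary_tensor G (\<lambda>k. T k ((x(i := u)) k)) \<phi>)"
      using T[of i] unfolding upd by (simp add: linear_map_def elementary_tensor_scale)
  qed
  then show ?thesis by (simp add: tensor_sum_def comp_def)
qed

locale tensor_norm_loc =
  fixes \<alpha> :: "('m::finite \<Rightarrow> ('k::{real_normed_field,euclidean_space}, 'u::ab_group_add) nspace) \<Rightarrow>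
      ('m, 'k, 'u) tensor \<Rightarrow> real"
  assumes tensor_norm: "tensor_norm \<alpha>"
begin

lemma normed_tensor: "(\<And>i. normed_space (E i)) \<Longrightarrow> normed_space (tensor_space E (\<alpha> E))"
  using tensor_norm unfolding tensor_norm_def by blast

lemma injective_le:
  "\<lbrakk>\<And>i. normed_space (E i); z \<in> vecs (tensor_space E (\<alpha> E))\<rbrakk> \<Longrightarrow> injective_norm E z \<le> \<alpha> E z"
  using tensor_norm unfolding tensor_norm_def by blast

lemma elementary_le:
  assumes E: "\<And>i. normed_space (E i)" and x: "x \<in> tuples E"
  shows "\<alpha> E (elementary_tensor E x) \<le> (\<Prod>i\<in>UNIV. nrm (E i) (x i))"
proof -
  have "\<alpha> E (elementary_tensor E x) \<le> projective_norm E (elementary_tensor E x)"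
    using tensor_norm E elementary_tensor_in[OF x] unfolding tensor_norm_def by blast
  also have "\<dots> \<le> (\<Sum>y\<leftarrow>[x]. \<Prod>i\<in>UNIV. nrm (E i) (y i))"
    unfolding projective_norm_def
  proof (rule cINF_lower)
    have nonneg: "0 \<le> nrm (E i) (y i)" if "y \<in> tuples E" for y i
      using that normed.nrm_ge_0[of "E i"] E by (simp add: normed_def in_tuples_iff)
    show "bdd_below ((\<lambda>xs. \<Sum>x\<leftarrow>xs. \<Prod>i\<in>UNIV. nrm (E i) (x i)) `
        {xs. set xs \<subseteq> tuples E \<and> elementary_tensor E x = tensor_sum E xs})"
      by (rule bdd_belowI2[of _ 0]) (auto intro!: sum_list_nonneg prod_nonneg nonneg)
  qed (use x in auto)
  finally show ?thesis by simp
qed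

lemma
  assumes E: "\<And>i. normed_space (E i)" and G: "\<And>i. normed_space (G i)"
    and T: "\<And>i. bounded_op (E i) (G i) (T i)"
  shows tensor_map_op: "op (tensor_space E (\<alpha> E)) (tensor_space G (\<alpha> G)) (tensor_map E G T)"
    and tensor_map_bound: "\<And>c z. \<lbrakk>\<And>i. op_norm (E i) (G i) (T i) \<le> c; z \<in> vecs (tensor_space E (\<alpha> E))\<rbrakk> \<Longrightarrow>
        \<alpha> G (tensor_map E G T z) \<le> c ^ CARD('m) * \<alpha> E z"
proof -
  interpret TE: normed "tensor_space E (\<alpha> E)" by unfold_locales (rule normed_tensor[OF E])
  have b: "bounded_op (tensor_space E (\<alpha> E)) (tensor_space G (\<alpha> G)) (tensor_map E G T)"
    and n: "op_norm (tensor_space E (\<alpha> E)) (tensor_space G (\<alpha> G)) (tensor_map E G T)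
          \<le> (\<Prod>i\<in>UNIV. op_norm (E i) (G i) (T i))"
    using tensor_norm E G T unfolding tensor_norm_def by blast+
  show op: "op (tensor_space E (\<alpha> E)) (tensor_space G (\<alpha> G)) (tensor_map E G T)"
    by (rule op_of_bounded[OF normed_tensor[OF E] normed_tensor[OF G] b])
  fix c z
  assume c: "\<And>i. op_norm (E i) (G i) (T i) \<le> c" and z: "z \<in> vecs (tensor_space E (\<alpha> E))"
  have "(\<Prod>i\<in>UNIV. op_norm (E i) (G i) (T i)) \<le> (\<Prod>i\<in>(UNIV :: 'm set). c)"
    using c op.op_norm_ge_0[OF op_of_bounded[OF E G T] T] by (intro prod_mono) auto
  then have n': "op_norm (tensor_space E (\<alpha> E)) (tensor_space G (\<alpha> G)) (tensor_map E G T) \<le> c ^ CARD('m)"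
    using n by simp
  have "\<alpha> G (tensor_map E G T z) \<le>
      op_norm (tensor_space E (\<alpha> E)) (tensor_space G (\<alpha> G)) (tensor_map E G T) * \<alpha> E z"
    using op.le_op_norm[OF op b z] by simp
  also have "\<dots> \<le> c ^ CARD('m) * \<alpha> E z"
    using n' TE.nrm_ge_0[OF z] by (intro mult_right_mono) simp_all
  finally show "\<alpha> G (tensor_map E G T z) \<le> c ^ CARD('m) * \<alpha> E z" .
qed

text \<open>
  The inclusions of the smaller subspaces into the larger ones have norm at most \<open>1\<close>, and their
  tensor product fixes every tensor.
\<close>

lemma subspace_tensor_mono:
  assumes E: "\<And>i. normed_space (E i)"
    and M: "\<And>i. module.subspace (smul (E i)) (M i)" "\<And>i. module.subspace (smul (E i)) (M' i)"
      "\<And>i. M i \<subseteq> M' i" "\<And>i. M' i \<subseteq> vecs (E i)"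
    and z: "z \<in> vecs (tensor_space (\<lambda>i. sub (E i) (M i)) (\<alpha> (\<lambda>i. sub (E i) (M i))))"
  shows "\<alpha> (\<lambda>i. sub (E i) (M' i)) z \<le> \<alpha> (\<lambda>i. sub (E i) (M i)) z"
proof -
  have sub: "normed_space (sub (E i) (L i))"
    if "\<And>i. module.subspace (smul (E i)) (L i)" "\<And>i. L i \<subseteq> vecs (E i)" for i L
    using normed.normed_sub[of "E i"] E that by (simp add: normed_def)
  have nM: "normed_space (sub (E i) (M i))" and nM': "normed_space (sub (E i) (M' i))" for i
    using sub[OF M(1) order_trans[OF M(3,4)]] sub[OF M(2,4)] by blast+
  have lin: "linear_map (sub (E i) (M i)) (sub (E i) (M' i)) (\<lambda>x. x)" for i
    using M(3) by (auto simp: linear_map_def)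
  have id_op: "op (sub (E i) (M i)) (sub (E i) (M' i)) (\<lambda>x. x)" for i
    using nM nM' lin by (simp add: op_def normed_def op_axioms_def)
  have b: "bounded_op (sub (E i) (M i)) (sub (E i) (M' i)) (\<lambda>x. x)" for i
    by (rule op.bounded_opI[OF id_op, of _ 1]) simp
  have n: "op_norm (sub (E i) (M i)) (sub (E i) (M' i)) (\<lambda>x. x) \<le> 1" for i
    by (rule op.op_norm_le[OF id_op]) auto
  obtain xs where xs: "z = tensor_sum (\<lambda>i. sub (E i) (M i)) xs"
    "set xs \<subseteq> tuples (\<lambda>i. sub (E i) (M i))" using z by auto
  have "tensor_map (\<lambda>i. sub (E i) (M i)) (\<lambda>i. sub (E i) (M' i)) (\<lambda>_ x. x) z = z"
    unfolding xs(1) by (subst tensor_map_sum[OF nM lin xs(2)]) (simp add: tensor_sum_sub)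
  then show ?thesis using tensor_map_bound[OF nM nM' b n z] by simp
qed

end

subsection \<open>Products of functionals\<close>

definition product_functional ::
    "('m::finite \<Rightarrow> ('k::{real_normed_field,euclidean_space}, 'u::ab_group_add) nspace) \<Rightarrow>
     ('m \<Rightarrow> 'u \<Rightarrow> 'k) \<Rightarrow> ('m, 'k, 'u) tensor \<Rightarrow> 'k" where
  "product_functional E h = tensor_lift E (\<lambda>x. \<Prod>i\<in>UNIV. h i (x i))"

lemma product_functional_sum:
  fixes E :: "'m::finite \<Rightarrow> ('k::{real_normed_field,euclidean_space}, 'u::ab_group_add) nspace"
  assumes E: "\<And>i. normed_space (E i)" and h: "\<And>i. h i \<in> vecs (dual (E i))"
    and xs: "set xs \<subseteq> tuples E"
  shows "product_functional E h (tensor_sum E xs) = (\<Sum>x\<leftarrow>xs. \<Prod>i\<in>UNIV. h i (x i))"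
  unfolding product_functional_def
proof (rule tensor_lift_sum[OF E _ _ _ xs])
  show "vector_space ((*) :: 'k \<Rightarrow> 'k \<Rightarrow> 'k)" by unfold_locales (auto simp: algebra_simps)
  have upd: "(\<Prod>k\<in>UNIV. h k ((x(i := t)) k)) = h i t * (\<Prod>k\<in>UNIV - {i}. h k (x k))" for x i t
  proof -
    have "(\<Prod>k\<in>UNIV. h k ((x(i := t)) k)) =
        h i ((x(i := t)) i) * (\<Prod>k\<in>UNIV - {i}. h k ((x(i := t)) k))"
      by (rule prod.remove) auto
    also have "(\<Prod>k\<in>UNIV - {i}. h k ((x(i := t)) k)) = (\<Prod>k\<in>UNIV - {i}. h k (x k))"
      by (intro prod.cong) auto
    finally show ?thesis by simp
  qed
  have op: "op (E i) scalars (h i)" for i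
    using normed.op_dual[OF _ h] E by (simp add: normed_def)
  show "(\<Prod>k\<in>UNIV. h k ((x(i := u + v)) k)) =
      (\<Prod>k\<in>UNIV. h k ((x(i := u)) k)) + (\<Prod>k\<in>UNIV. h k ((x(i := v)) k))"
    if "u \<in> vecs (E i)" "v \<in> vecs (E i)" for x i u v
    unfolding upd using op.add[OF op that] by (simp add: distrib_right)
  show "(\<Prod>k\<in>UNIV. h k ((x(i := smul (E i) c u)) k)) = c * (\<Prod>k\<in>UNIV. h k ((x(i := u)) k))"
    if "u \<in> vecs (E i)" for x i c u
    unfolding upd using op.scale[OF op that] by simp
qed

text \<open>
  The injective norm is the supremum over functionals of norm at most \<open>1\<close>, and the general case
  follows by scaling. The supremum is over a bounded set because the representation of \<open>z\<close> as a sum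
  of elementary tensors bounds all values at once; a vanishing factor is treated separately as it
  cannot be normalized.
\<close>

lemma product_functional_le:
  fixes E :: "'m::finite \<Rightarrow> ('k::{real_normed_field,euclidean_space}, 'u::ab_group_add) nspace"
  assumes E: "\<And>i. normed_space (E i)" and h: "\<And>i. h i \<in> vecs (dual (E i))"
    and z: "z \<in> vecs (tensor_space E \<nu>)"
  shows "norm (product_functional E h z) \<le> (\<Prod>i\<in>UNIV. op_norm (E i) scalars (h i)) * injective_norm E z"
proof -
  obtain xs where xs: "z = tensor_sum E xs" "set xs \<subseteq> tuples E" using z by auto
  have n: "normed (E i)" for i using E by (simp add: normed_def)
  have val: "product_functional E f z = (\<Sum>x\<leftarrow>xs. \<Prod>i\<in>UNIV. f i (x i))"
    if "\<And>i. f i \<in> vecs (dual (E i))" for f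
    unfolding xs(1) using that by (rule product_functional_sum[OF E _ xs(2)])
  let ?U = "{f. \<forall>i. f i \<in> vecs (dual (E i)) \<and> nrm (dual (E i)) (f i) \<le> 1}"
  have bdd: "bdd_above ((\<lambda>f. norm (product_functional E f z)) ` ?U)"
  proof (rule bdd_aboveI2)
    fix f assume "f \<in> ?U"
    then have f: "\<And>i. f i \<in> vecs (dual (E i))" "\<And>i. op_norm (E i) scalars (f i) \<le> 1" by auto
    have le: "norm (\<Prod>i\<in>UNIV. f i (x i)) \<le> (\<Prod>i\<in>UNIV. nrm (E i) (x i))" if "x \<in> tuples E" for x
      unfolding prod_norm[symmetric]
    proof (rule prod_mono, intro conjI norm_ge_zero)
      fix i
      have x: "x i \<in> vecs (E i)" using that by (simp add: in_tuples_iff)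
      have "norm (f i (x i)) \<le> op_norm (E i) scalars (f i) * nrm (E i) (x i)"
        by (rule normed.dual_le[OF n f(1) x])
      also have "\<dots> \<le> 1 * nrm (E i) (x i)"
        using f(2) normed.nrm_ge_0[OF n x] by (rule mult_right_mono)
      finally show "norm (f i (x i)) \<le> nrm (E i) (x i)" by simp
    qed
    show "norm (product_functional E f z) \<le> (\<Sum>x\<leftarrow>xs. \<Prod>i\<in>UNIV. nrm (E i) (x i))"
      unfolding val[OF f(1)] using xs(2)
    proof (induction xs)
      case (Cons x xs)
      then show ?case using norm_triangle_mono[OF le[of x] Cons.IH] by simp
    qed simp
  qed
  show ?thesis
  proof (cases "\<exists>i. op_norm (E i) scalars (h i) = 0")
    case True
    then obtain i where i: "op_norm (E i) scalars (h i) = 0" by blast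
    have "h i u = 0" if "u \<in> vecs (E i)" for u
      using normed.dual_le[OF n h that] i by simp
    then have "(\<Prod>i\<in>UNIV. h i (x i)) = 0" if "x \<in> tuples E" for x
      using that by (intro prod_zero) (auto simp: in_tuples_iff)
    then have "product_functional E h z = 0"
      unfolding val[OF h] using xs(2) by (induction xs) auto
    moreover have "(\<Prod>i\<in>UNIV. op_norm (E i) scalars (h i)) = 0"
      using i by (intro prod_zero) auto
    ultimately show ?thesis by (simp only: norm_zero mult_zero_left order_refl)
  next
    case False
    define c where "c = (\<lambda>i. op_norm (E i) scalars (h i))"
    have c: "c i > 0" for i
      using False normed.dual_norm_ge_0[OF n h, of i] unfolding c_def by (metis order_le_less)
    define f where "f = (\<lambda>i u. of_real (inverse (c i)) * h i u)"
    have f_in: "f i \<in> vecs (dual (E i))" for i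
      unfolding f_def by (rule normed.dual_scale_in[OF n h])
    have "nrm (dual (E i)) (smul (dual (E i)) (of_real (inverse (c i))) (h i)) = 1" for i
      using normed.nrm_scale[of "dual (E i)" "h i"] normed.normed_dual[OF n] h c[of i]
      by (simp add: normed_def norm_inverse flip: c_def[THEN fun_cong])
    then have f_norm: "nrm (dual (E i)) (f i) \<le> 1" for i by (simp add: f_def)
    have hf: "h i u = of_real (c i) * f i u" for i u using c[of i] by (simp add: f_def)
    have "product_functional E h z = of_real (\<Prod>i\<in>UNIV. c i) * product_functional E f z"
      unfolding val[OF h] val[OF f_in] by (simp add: hf prod.distrib sum_list_const_mult)
    then have "norm (product_functional E h z) =
        (\<Prod>i\<in>UNIV. c i) * norm (product_functional E f z)"
      using c by (simp add: norm_mult prod_nonneg less_imp_le del: of_real_prod)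
    also have "\<dots> \<le> (\<Prod>i\<in>UNIV. c i) * injective_norm E z"
    proof (rule mult_left_mono)
      have "norm (product_functional E f z) \<le> (SUP f\<in>?U. norm (product_functional E f z))"
        using f_in f_norm by (intro cSUP_upper[OF _ bdd]) auto
      then show "norm (product_functional E f z) \<le> injective_norm E z"
        by (simp add: injective_norm_def product_functional_def)
    qed (use c in \<open>simp add: prod_nonneg less_imp_le\<close>)
    finally show ?thesis by (simp add: c_def)
  qed
qed

section \<open>Completed tensor powers\<close>

lemma bounded_op_comp:
  assumes T: "bounded_op A B T" and U: "bounded_op B C U"
    and nonneg: "\<And>x. x \<in> vecs B \<Longrightarrow> 0 \<le> nrm B x"
  shows "bounded_op A C (\<lambda>x. U (T x))"
proof -
  obtain K where K: "\<And>x. x \<in> vecs A \<Longrightarrow> nrm B (T x) \<le> K * nrm A x"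
    using T by (auto simp: bounded_op_def)
  obtain L where L: "\<And>x. x \<in> vecs B \<Longrightarrow> nrm C (U x) \<le> L * nrm B x"
    using U by (auto simp: bounded_op_def)
  have T_in: "T x \<in> vecs B" if "x \<in> vecs A" for x
    using T that by (simp add: bounded_op_def linear_map_def)
  have "nrm C (U (T x)) \<le> (max L 0 * K) * nrm A x" if x: "x \<in> vecs A" for x
  proof -
    have "nrm C (U (T x)) \<le> L * nrm B (T x)" by (rule L[OF T_in[OF x]])
    also have "\<dots> \<le> max L 0 * nrm B (T x)" using nonneg[OF T_in[OF x]] by (intro mult_right_mono) auto
    also have "\<dots> \<le> max L 0 * (K * nrm A x)" using K[OF x] by (intro mult_left_mono) auto
    finally show ?thesis by (simp add: mult.assoc)
  qed
  with T U show ?thesis by (auto simp: bounded_op_def linear_map_def)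
qed

lemma form_space_simps [simp]:
  "vecs (form_space E C \<iota>) = form_of E \<iota> ` vecs (dual C)"
  "smul (form_space E C \<iota>) = (\<lambda>c \<phi> x. c * \<phi> x)"
  "nrm (form_space E C \<iota>) =
     (\<lambda>\<phi>. nrm (dual C) (the_inv_into (vecs (dual C)) (form_of E \<iota>) \<phi>))"
  by (simp_all add: form_space_def)

locale completed_power = tensor_norm_loc \<alpha> + E: normed E
  for \<alpha> :: "('m::finite \<Rightarrow> ('k::{real_normed_field,euclidean_space}, 'u::ab_group_add) nspace) \<Rightarrow>
      ('m, 'k, 'u) tensor \<Rightarrow> real"
    and E :: "('k, 'u) nspace" +
  fixes C :: "('k, 'c::ab_group_add) nspace" and \<iota> :: "('m, 'k, 'u) tensor \<Rightarrow> 'c"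
  assumes is_compl: "is_completion (tensor_power \<alpha> E) C \<iota>"
begin

abbreviation N :: "('k, ('m, 'k, 'u) tensor) nspace" where
  "N \<equiv> tensor_power \<alpha> E"

abbreviation elem :: "('m \<Rightarrow> 'u) \<Rightarrow> ('m, 'k, 'u) tensor" where
  "elem \<equiv> elementary_tensor (\<lambda>_. E)"

abbreviation tup :: "('m \<Rightarrow> 'u) set" where
  "tup \<equiv> tuples (\<lambda>_. E)"

lemma normed_power: "normed_space N"
  unfolding tensor_power_def by (intro normed_tensor E.normed)

sublocale completion N C \<iota>
  by unfold_locales (rule normed_power, rule is_compl)

lemma power_simps [simp]:
  "vecs N = {tensor_sum (\<lambda>_. E) xs | xs. set xs \<subseteq> tup}" "nrm N = \<alpha> (\<lambda>_. E)"
  "smul N = (\<lambda>c z \<phi>. c * z \<phi>)"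
  by (simp_all add: tensor_power_def)

lemma elem_in: "x \<in> tup \<Longrightarrow> elem x \<in> vecs N"
  unfolding tensor_power_def by (rule elementary_tensor_in)

lemma \<iota>_elem_in: "x \<in> tup \<Longrightarrow> \<iota> (elem x) \<in> vecs C"
  using elem_in by (rule \<iota>.in_vecs)

lemma functional_tensor_sum:
  assumes f: "linear_map C scalars f" and xs: "set xs \<subseteq> tup"
  shows "f (\<iota> (tensor_sum (\<lambda>_. E) xs)) = (\<Sum>x\<leftarrow>xs. f (\<iota> (elem x)))"
proof -
  interpret f: op C scalars f using C.normed normed_scalars f by (simp add: op_def normed_def op_axioms_def)
  show ?thesis using xs
  proof (induction xs)
    case Nil
    show ?case unfolding tensor_sum_simps(1) \<iota>.zero f.zero by simp
  next
    case (Cons x xs)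
    have in_N: "elem x \<in> vecs N" "tensor_sum (\<lambda>_. E) xs \<in> vecs N"
      using Cons.prems by (auto intro: elem_in simp del: power_simps) auto
    then have split: "f (\<iota> (elem x + tensor_sum (\<lambda>_. E) xs)) = f (\<iota> (elem x)) + f (\<iota> (tensor_sum (\<lambda>_. E) xs))"
      unfolding \<iota>.add[OF in_N] by (intro f.add \<iota>.in_vecs)
    have IH: "f (\<iota> (tensor_sum (\<lambda>_. E) xs)) = (\<Sum>x\<leftarrow>xs. f (\<iota> (elem x)))" using Cons by simp
    show ?case unfolding tensor_sum_simps(2) split IH by simp
  qed
qed

text \<open>
  Elementary tensors span a dense subspace of the completion.
\<close>

lemma functional_eqI:
  assumes f: "bounded_op C scalars f" and g: "bounded_op C scalars g"
    and eq: "\<And>x. x \<in> tup \<Longrightarrow> f (\<iota> (elem x)) = g (\<iota> (elem x))" and c: "c \<in> vecs C"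
  shows "f c = g c"
proof (rule bounded_op_eqI[OF normed_scalars f g _ c])
  fix z assume "z \<in> vecs N"
  then obtain xs where xs: "z = tensor_sum (\<lambda>_. E) xs" "set xs \<subseteq> tup" by auto
  have "(\<Sum>x\<leftarrow>xs. f (\<iota> (elem x))) = (\<Sum>x\<leftarrow>xs. g (\<iota> (elem x)))"
    using xs(2) eq by (intro arg_cong[of _ _ sum_list] map_cong) auto
  then show "f (\<iota> z) = g (\<iota> z)"
    using f g xs by (simp add: bounded_op_def functional_tensor_sum)
qed

lemma inj_form_of: "inj_on (form_of E \<iota>) (vecs (dual C))"
proof (rule inj_onI)
  fix f g assume f: "f \<in> vecs (dual C)" and g: "g \<in> vecs (dual C)"
    and eq: "form_of E \<iota> f = form_of E \<iota> g"
  show "f = g"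
  proof (rule C.dual_eqI[OF f g], rule functional_eqI)
    fix x assume "x \<in> tup"
    then show "f (\<iota> (elem x)) = g (\<iota> (elem x))"
      using fun_cong[OF eq, of x] by (simp add: form_of_def)
  qed (use f g in \<open>auto simp: in_dual_iff\<close>)
qed

abbreviation form_inv where
  "form_inv \<equiv> the_inv_into (vecs (dual C)) (form_of E \<iota>)"

lemma form_inv_of [simp]: "f \<in> vecs (dual C) \<Longrightarrow> form_inv (form_of E \<iota> f) = f"
  by (rule the_inv_into_f_f[OF inj_form_of])

lemma form_norm_ge_0: "\<phi> \<in> vecs (form_space E C \<iota>) \<Longrightarrow> 0 \<le> nrm (form_space E C \<iota>) \<phi>"
  using C.dual_norm_ge_0 by auto

lemma form_of_add: "form_of E \<iota> (f + g) = form_of E \<iota> f + form_of E \<iota> g"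
  by (auto simp: form_of_def fun_eq_iff)

lemma form_of_scale: "form_of E \<iota> (\<lambda>x. c * f x) = (\<lambda>x. c * form_of E \<iota> f x)"
  by (auto simp: form_of_def fun_eq_iff)

lemma bounded_form_of: "bounded_op (dual C) (form_space E C \<iota>) (form_of E \<iota>)"
  unfolding bounded_op_def linear_map_def
  by (auto simp: form_of_add form_of_scale intro!: exI[of _ 1])

lemma bounded_form_inv: "bounded_op (form_space E C \<iota>) (dual C) form_inv"
proof -
  interpret DC: normed "dual C" by unfold_locales (rule C.normed_dual)
  show ?thesis
    unfolding bounded_op_def linear_map_def
    using DC.add_in DC.scale_in
    by (auto simp flip: form_of_add form_of_scale intro!: exI[of _ 1])
qed

text \<open>
  Boundedness of \<open>h\<^sub>1 \<otimes> \<dots> \<otimes> h\<^sub>m\<close> is the inequality \<open>\<epsilon> \<le> \<alpha>\<close>.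
\<close>

lemma ex_product_functional:
  assumes h: "\<And>i. h i \<in> vecs (dual E)"
  shows "\<exists>f\<in>vecs (dual N). (\<forall>x\<in>tup. f (elem x) = (\<Prod>i\<in>UNIV. h i (x i))) \<and>
           op_norm N scalars f \<le> (\<Prod>i\<in>UNIV. op_norm E scalars (h i))"
proof -
  define L where "L = product_functional (\<lambda>_. E) h"
  have L: "L (tensor_sum (\<lambda>_. E) xs) = (\<Sum>x\<leftarrow>xs. \<Prod>i\<in>UNIV. h i (x i))" if "set xs \<subseteq> tup" for xs
    unfolding L_def using E.normed h that by (rule product_functional_sum)
  let ?P = "\<Prod>i\<in>UNIV. op_norm E scalars (h i)"
  have P: "?P \<ge> 0" using E.dual_norm_ge_0[OF h] by (intro prod_nonneg) auto
  define f where "f = (\<lambda>z. if z \<in> vecs N then L z else 0)"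
  have bound: "norm (f z) \<le> ?P * nrm N z" if z: "z \<in> vecs N" for z
  proof -
    have z': "z \<in> vecs (tensor_space (\<lambda>_. E) (\<alpha> (\<lambda>_. E)))" using z by (simp add: tensor_power_def)
    have "norm (L z) \<le> ?P * injective_norm (\<lambda>_. E) z"
      unfolding L_def by (rule product_functional_le[OF E.normed h z'])
    also have "\<dots> \<le> ?P * \<alpha> (\<lambda>_. E) z"
      using injective_le[OF E.normed z'] P by (rule mult_left_mono)
    finally show ?thesis using z by (simp add: f_def del: power_simps(1))
  qed
  have f_in: "f \<in> vecs (dual N)"
  proof (rule N.dualI[OF _ _ bound])
    fix z z' assume z: "z \<in> vecs N" "z' \<in> vecs N"
    then obtain xs ys where xs: "z = tensor_sum (\<lambda>_. E) xs" "set xs \<subseteq> tup"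
      and ys: "z' = tensor_sum (\<lambda>_. E) ys" "set ys \<subseteq> tup" by auto
    have "z + z' = tensor_sum (\<lambda>_. E) (xs @ ys)" by (simp add: xs ys)
    then have "L (z + z') = L z + L z'" using xs ys L[of "xs @ ys"] by (simp add: L)
    then show "f (z + z') = f z + f z'" using z by (simp add: f_def N.add_in del: power_simps)
  next
    fix c z assume z: "z \<in> vecs N"
    then obtain xs where xs: "z = tensor_sum (\<lambda>_. E) xs" "set xs \<subseteq> tup" by auto
    \<comment> \<open>The scalar is absorbed into one arbitrarily chosen factor.\<close>
    define i :: 'm where "i = undefined"
    define m where "m = (\<lambda>x :: 'm \<Rightarrow> 'u. x(i := smul E c (x i)))"
    have h_op: "op E scalars (h k)" for k by (rule E.op_dual[OF h])
    have m_prod: "(\<Prod>k\<in>UNIV. h k (m x k)) = c * (\<Prod>k\<in>UNIV. h k (x k))" if "x \<in> tup" for x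
    proof -
      have rest: "(\<Prod>k\<in>UNIV - {i}. h k (m x k)) = (\<Prod>k\<in>UNIV - {i}. h k (x k))"
        by (intro prod.cong) (auto simp: m_def)
      have hi: "h i (m x i) = c * h i (x i)"
        using that op.scale[OF h_op, of "x i" i c] by (simp add: m_def in_tuples_iff)
      show ?thesis
        unfolding prod.remove[of UNIV i "\<lambda>k. h k (m x k)", OF finite UNIV_I]
          prod.remove[of UNIV i "\<lambda>k. h k (x k)", OF finite UNIV_I] rest hi by (simp add: mult.assoc)
    qed
    have ms: "set (map m xs) \<subseteq> tup"
      using xs(2) by (auto simp: m_def in_tuples_iff E.scale_in subset_iff)
    have "elem (m x) = (\<lambda>\<phi>. c * elem x \<phi>)" for x
      using elementary_tensor_scale[of "\<lambda>_. E" x i c "x i"] by (simp add: m_def)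
    then have "smul N c z = tensor_sum (\<lambda>_. E) (map m xs)"
      unfolding xs(1) by (induction xs) (auto simp: fun_eq_iff distrib_left)
    then have "L (smul N c z) = (\<Sum>x\<leftarrow>xs. \<Prod>k\<in>UNIV. h k (m x k))"
      using L[OF ms] by (simp add: comp_def)
    also have "\<dots> = (\<Sum>x\<leftarrow>xs. c * (\<Prod>k\<in>UNIV. h k (x k)))"
      using xs(2) m_prod by (intro arg_cong[of _ _ sum_list] map_cong) auto
    also have "\<dots> = c * L z" using xs by (simp add: L sum_list_const_mult)
    finally show "f (smul N c z) = c * f z" using z by (simp add: f_def N.scale_in del: power_simps)
  qed (auto simp: f_def)
  moreover have "op_norm N scalars f \<le> ?P" by (rule N.dual_norm_le[OF f_in P bound])
  moreover have "f (elem x) = (\<Prod>i\<in>UNIV. h i (x i))" if "x \<in> tup" for x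
    using elem_in[OF that] L[of "[x]"] that by (simp add: f_def del: power_simps)
  ultimately show ?thesis by blast
qed

end

section \<open>Embeddings of completed tensor powers\<close>

locale power_embedding = Y: completed_power \<alpha> Y CY \<iota>Y + X: completed_power \<alpha> X CX \<iota>X
  for \<alpha> :: "('m::finite \<Rightarrow> ('k::{real_normed_field,euclidean_space}, 'u::ab_group_add) nspace) \<Rightarrow>
      ('m, 'k, 'u) tensor \<Rightarrow> real"
    and Y :: "('k, 'u) nspace" and CY :: "('k, 'c::ab_group_add) nspace" and \<iota>Y
    and X :: "('k, 'u) nspace" and CX :: "('k, 'd::ab_group_add) nspace" and \<iota>X +
  fixes j :: "'u \<Rightarrow> 'u"
  assumes j_bounded: "bounded_op Y X j"
begin

sublocale j: op Y X j
  using Y.E.normed X.E.normed j_bounded by (rule op_of_bounded)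

abbreviation jj where
  "jj \<equiv> tensor_map (\<lambda>_. Y) (\<lambda>_. X) (\<lambda>_. j)"

abbreviation J where
  "J \<equiv> completed_op (tensor_power \<alpha> Y) CY \<iota>Y CX \<iota>X jj"

lemma j_tup: "y \<in> Y.tup \<Longrightarrow> (\<lambda>i. j (y i)) \<in> X.tup"
  by (simp add: in_tuples_iff j.in_vecs)

lemma jj_sum: "set ys \<subseteq> Y.tup \<Longrightarrow>
    jj (tensor_sum (\<lambda>_. Y) ys) = tensor_sum (\<lambda>_. X) (map (\<lambda>y i. j (y i)) ys)"
  by (rule tensor_map_sum[OF Y.E.normed j.lin])

lemma jj_elem: "y \<in> Y.tup \<Longrightarrow> jj (Y.elem y) = X.elem (\<lambda>i. j (y i))"
  using jj_sum[of "[y]"] by simp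

lemma J_spec: "bounded_op CY CX J" "z \<in> vecs Y.N \<Longrightarrow> J (\<iota>Y z) = \<iota>X (jj z)"
proof -
  let ?c = "op_norm Y X j"
  have op: "op Y.N X.N jj"
    using Y.tensor_map_op[OF Y.E.normed X.E.normed j_bounded] by (simp add: tensor_power_def)
  have bound: "nrm X.N (jj z) \<le> ?c ^ CARD('m) * nrm Y.N z" if "z \<in> vecs Y.N" for z
    using Y.tensor_map_bound[OF Y.E.normed X.E.normed j_bounded order_refl] that by simp
  interpret jj: op Y.N X.N jj by (rule op)
  have "linear_map Y.N CX (\<lambda>z. \<iota>X (jj z))"
    using jj.in_vecs by (simp add: linear_map_def jj.add jj.scale X.\<iota>.add X.\<iota>.scale X.\<iota>.in_vecs
        del: Y.power_simps X.power_simps)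
  moreover have "nrm CX (\<iota>X (jj z)) \<le> ?c ^ CARD('m) * nrm Y.N z" if "z \<in> vecs Y.N" for z
    using bound[OF that] X.isometry[OF jj.in_vecs[OF that]] by simp
  ultimately have "\<exists>T. linear_map CY CX T \<and> (\<forall>x\<in>vecs CY. nrm CX (T x) \<le> ?c ^ CARD('m) * nrm CY x) \<and>
      (\<forall>z\<in>vecs Y.N. T (\<iota>Y z) = \<iota>X (jj z))"
    using j.op_norm_ge_0[OF j_bounded] by (intro Y.extend X.banach) auto
  then have "\<exists>T. bounded_op CY CX T \<and> (\<forall>z\<in>vecs Y.N. T (\<iota>Y z) = \<iota>X (jj z))"
    unfolding bounded_op_def by blast
  from someI_ex[OF this] show "bounded_op CY CX J" "z \<in> vecs Y.N \<Longrightarrow> J (\<iota>Y z) = \<iota>X (jj z)"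
    unfolding completed_op_def by auto
qed

text \<open>
  The condition \<open>D\<close> of the introduction, tested only on elementary tensors. In this form it refers
  neither to the completed operator nor to the identification of functionals with forms.
\<close>

definition extension_operator :: "(('c \<Rightarrow> 'k) \<Rightarrow> ('d \<Rightarrow> 'k)) \<Rightarrow> bool" where
  "extension_operator S \<longleftrightarrow> bounded_op (dual CY) (dual CX) S \<and>
     (\<forall>f\<in>vecs (dual CY). \<forall>y\<in>Y.tup. S f (\<iota>X (X.elem (\<lambda>i. j (y i)))) = f (\<iota>Y (Y.elem y)))"

lemma extension_operator_iff:
  "extension_operator S \<longleftrightarrow> bounded_op (dual CY) (dual CX) S \<and>
     (\<forall>f\<in>vecs (dual CY). \<forall>c\<in>vecs CY. S f (J c) = f c)"
proof -
  have J_elem: "J (\<iota>Y (Y.elem y)) = \<iota>X (X.elem (\<lambda>i. j (y i)))" if "y \<in> Y.tup" for y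
    using J_spec(2)[OF Y.elem_in[OF that]] jj_elem[OF that] by simp
  have "S f (J c) = f c"
    if S: "extension_operator S" and f: "f \<in> vecs (dual CY)" and c: "c \<in> vecs CY" for f c
  proof (rule Y.functional_eqI[OF _ _ _ c])
    have "S f \<in> vecs (dual CX)"
      using S f by (simp add: extension_operator_def bounded_op_def linear_map_def)
    then show "bounded_op CY scalars (\<lambda>c. S f (J c))"
      using X.C.nrm_ge_0 by (intro bounded_op_comp[OF J_spec(1)]) (auto simp: in_dual_iff)
    show "bounded_op CY scalars f" using f by (simp add: in_dual_iff)
    show "S f (J (\<iota>Y (Y.elem y))) = f (\<iota>Y (Y.elem y))" if "y \<in> Y.tup" for y
      using S f that by (simp add: J_elem extension_operator_def)
  qed
  then show ?thesis
    using Y.\<iota>_elem_in J_elem unfolding extension_operator_def by (metis (no_types, lifting))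
qed

lemma powers_locally_complemented_iff:
  "locally_complemented CY CX J \<longleftrightarrow> (\<exists>S. extension_operator S)"
proof
  assume "locally_complemented CY CX J"
  from dual_operator_of_locally_complemented[OF Y.C.normed X.C.normed this]
  show "\<exists>S. extension_operator S" unfolding extension_operator_iff by blast
next
  assume "\<exists>S. extension_operator S"
  then show "locally_complemented CY CX J"
    using locally_complemented_of_dual_operator[OF Y.C.normed X.C.normed J_spec(1)]
    unfolding extension_operator_iff by blast
qed

lemma restrict_form_of_iff:
  "restrict_form Y j (form_of X \<iota>X g) = form_of Y \<iota>Y f \<longleftrightarrow>
     (\<forall>y\<in>Y.tup. g (\<iota>X (X.elem (\<lambda>i. j (y i)))) = f (\<iota>Y (Y.elem y)))"
  using j_tup by (auto simp: restrict_form_def form_of_def fun_eq_iff)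

lemma forms_complemented_iff:
  "has_bounded_right_inverse (form_space X CX \<iota>X) (form_space Y CY \<iota>Y) (restrict_form Y j) \<longleftrightarrow>
     (\<exists>S. extension_operator S)"
proof
  assume "has_bounded_right_inverse (form_space X CX \<iota>X) (form_space Y CY \<iota>Y) (restrict_form Y j)"
  then obtain T where T: "bounded_op (form_space Y CY \<iota>Y) (form_space X CX \<iota>X) T"
    "\<And>\<psi>. \<psi> \<in> vecs (form_space Y CY \<iota>Y) \<Longrightarrow> restrict_form Y j (T \<psi>) = \<psi>"
    unfolding has_bounded_right_inverse_def by blast
  let ?S = "\<lambda>f. X.form_inv (T (form_of Y \<iota>Y f))"
  have "bounded_op (dual CY) (dual CX) ?S"
    by (intro bounded_op_comp[OF _ X.bounded_form_inv X.form_norm_ge_0]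
        bounded_op_comp[OF Y.bounded_form_of T(1) Y.form_norm_ge_0])
  moreover have "?S f (\<iota>X (X.elem (\<lambda>i. j (y i)))) = f (\<iota>Y (Y.elem y))"
    if f: "f \<in> vecs (dual CY)" and y: "y \<in> Y.tup" for f y
  proof -
    have \<psi>: "form_of Y \<iota>Y f \<in> vecs (form_space Y CY \<iota>Y)" using f by simp
    then have "T (form_of Y \<iota>Y f) \<in> vecs (form_space X CX \<iota>X)"
      using T(1) unfolding bounded_op_def linear_map_def by blast
    then obtain g where g: "g \<in> vecs (dual CX)" "T (form_of Y \<iota>Y f) = form_of X \<iota>X g" by auto
    then show ?thesis using T(2)[OF \<psi>] y by (simp add: restrict_form_of_iff)
  qed
  ultimately show "\<exists>S. extension_operator S" unfolding extension_operator_def by blast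
next
  assume "\<exists>S. extension_operator S"
  then obtain S where S: "bounded_op (dual CY) (dual CX) S"
    "\<And>f y. \<lbrakk>f \<in> vecs (dual CY); y \<in> Y.tup\<rbrakk> \<Longrightarrow>
       S f (\<iota>X (X.elem (\<lambda>i. j (y i)))) = f (\<iota>Y (Y.elem y))"
    unfolding extension_operator_def by blast
  let ?T = "\<lambda>\<psi>. form_of X \<iota>X (S (Y.form_inv \<psi>))"
  have "bounded_op (form_space Y CY \<iota>Y) (form_space X CX \<iota>X) ?T"
    by (intro bounded_op_comp[OF _ X.bounded_form_of] bounded_op_comp[OF Y.bounded_form_inv S(1)])
      (simp_all add: Y.C.dual_norm_ge_0 X.C.dual_norm_ge_0)
  moreover have "restrict_form Y j (?T \<psi>) = \<psi>" if \<psi>: "\<psi> \<in> vecs (form_space Y CY \<iota>Y)" for \<psi>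
  proof -
    obtain f where f: "f \<in> vecs (dual CY)" "\<psi> = form_of Y \<iota>Y f" using \<psi> by auto
    then show ?thesis using S(2)[OF f(1)] by (simp add: restrict_form_of_iff)
  qed
  ultimately show "has_bounded_right_inverse (form_space X CX \<iota>X) (form_space Y CY \<iota>Y) (restrict_form Y j)"
    unfolding has_bounded_right_inverse_def by blast
qed

text \<open>
  The operator \<open>R A\<close> is the tensor power of the local projection on the span of \<open>A\<close>. It is meaningful
  only on tensors over this span, and every tensor over \<open>X\<close> is eventually of this kind. The bound
  \<open>\<lambda>\<^sup>m \<alpha>\<close> refers to the norm of the tensor power of the span; finite generation provides subspaces
  on which this norm exceeds the one over \<open>X\<close> by less than \<open>\<epsilon>\<close>, and larger subspaces only decrease
  it. The limit is a functional on the algebraic tensor power, which is then extended to the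
  completion.
\<close>

lemma extension_operator_of_locally_complemented:
  assumes fg: "finitely_generated \<alpha>" and lc: "locally_complemented Y X j"
  shows "\<exists>S. extension_operator S"
proof -
  obtain l where "l > 0"
    and ex: "\<And>F. fd_subspace X F \<Longrightarrow> \<exists>r. bounded_op (sub X F) Y r \<and> op_norm (sub X F) Y r \<le> l \<and>
             (\<forall>y\<in>vecs Y. j y \<in> F \<longrightarrow> r (j y) = y)"
    using lc unfolding locally_complemented_def by blast
  have "\<forall>A. \<exists>r. finite A \<and> A \<subseteq> vecs X \<longrightarrow> bounded_op (sub X (X.E.span A)) Y r \<and>
      op_norm (sub X (X.E.span A)) Y r \<le> l \<and> (\<forall>y\<in>vecs Y. j y \<in> X.E.span A \<longrightarrow> r (j y) = y)"
    using ex unfolding fd_subspace_def by blast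
  then obtain r where r: "\<And>A. \<lbrakk>finite A; A \<subseteq> vecs X\<rbrakk> \<Longrightarrow> bounded_op (sub X (X.E.span A)) Y (r A)"
    "\<And>A. \<lbrakk>finite A; A \<subseteq> vecs X\<rbrakk> \<Longrightarrow> op_norm (sub X (X.E.span A)) Y (r A) \<le> l"
    "\<And>A y. \<lbrakk>finite A; A \<subseteq> vecs X; y \<in> vecs Y; j y \<in> X.E.span A\<rbrakk> \<Longrightarrow> r A (j y) = y"
    by metis
  have span_vecs: "X.E.span A \<subseteq> vecs X" if "A \<subseteq> vecs X" for A
    by (rule X.E.span_minimal[OF that X.E.vecs_subspace])
  have normed_sub: "normed_space (sub X (X.E.span A))" if "A \<subseteq> vecs X" for A
    by (rule X.E.normed_sub[OF X.E.subspace_span span_vecs[OF that]])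
  define F where "F = (\<lambda>A (i::'m). sub X (X.E.span A))"
  define R where "R = (\<lambda>A. tensor_map (F A) (\<lambda>_. Y) (\<lambda>_. r A))"
  have F_sum: "tensor_sum (F A) = tensor_sum (\<lambda>_. X)" for A
    unfolding F_def by (rule tensor_sum_sub)
  have F_tuples: "x \<in> tuples (F A) \<longleftrightarrow> range x \<subseteq> X.E.span A" for x A
    by (auto simp: F_def in_tuples_iff)
  have nF: "normed_space (F A i)" if "A \<subseteq> vecs X" for A i
    unfolding F_def using that by (rule normed_sub)
  have rb: "bounded_op (F A i) Y (r A)" "op_norm (F A i) Y (r A) \<le> l"
    if "finite A" "A \<subseteq> vecs X" for A i
    unfolding F_def using that by (rule r)+
  let ?T = "\<lambda>A. tensor_space (F A) (\<alpha> (F A))"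
  have R_op: "op (?T A) Y.N (R A)" if "finite A" "A \<subseteq> vecs X" for A
    unfolding R_def tensor_power_def
    by (rule Y.tensor_map_op[OF nF Y.E.normed rb(1)]) (use that in auto)
  have R_le: "nrm Y.N (R A z) \<le> l ^ CARD('m) * \<alpha> (F A) z"
    if "finite A" "A \<subseteq> vecs X" "z \<in> vecs (?T A)" for A z
    unfolding R_def Y.power_simps
    by (rule Y.tensor_map_bound[OF nF Y.E.normed rb(1)]) (use that rb(2) in auto)
  let ?F = "finite_subsets_at_top (vecs X)"
  have large: "eventually (\<lambda>A. finite A \<and> A \<subseteq> vecs X \<and> Z \<subseteq> X.E.span A) ?F"
    if Z: "finite Z" "Z \<subseteq> vecs X" for Z
    unfolding eventually_finite_subsets_at_top
    using Z by (intro exI[of _ Z]) (auto intro: X.E.span_base)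
  have large_tuples: "eventually (\<lambda>A. finite A \<and> A \<subseteq> vecs X \<and> set xs \<subseteq> tuples (F A)) ?F"
    if xs: "set xs \<subseteq> X.tup" for xs
  proof -
    have "eventually (\<lambda>A. finite A \<and> A \<subseteq> vecs X \<and> (\<Union>x\<in>set xs. range x) \<subseteq> X.E.span A) ?F"
      using xs by (intro large) (auto simp: in_tuples_iff subset_iff)
    then show ?thesis by eventually_elim (simp add: F_tuples subset_iff, blast)
  qed
  have large_tensor: "eventually (\<lambda>A. finite A \<and> A \<subseteq> vecs X \<and> z \<in> vecs (?T A)) ?F"
    if z: "z \<in> vecs X.N" for z
  proof -
    obtain xs where xs: "z = tensor_sum (\<lambda>_. X) xs" "set xs \<subseteq> X.tup" using z by auto
    from large_tuples[OF xs(2)] show ?thesis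
      by eventually_elim (auto simp: xs(1) F_sum)
  qed
  have "\<exists>S. bounded_op (dual CY) (dual X.N) S \<and>
    (\<forall>f\<in>vecs (dual CY). \<forall>z\<in>vecs X.N. \<forall>c. eventually (\<lambda>A. \<iota>Y (R A z) = c) ?F \<longrightarrow> S f z = f c)"
  proof (rule ex_dual_operator_of_net[OF X.normed_power Y.C.normed, where l = "l ^ CARD('m)"])
    fix z z' assume z: "z \<in> vecs X.N" and z': "z' \<in> vecs X.N"
    show "eventually (\<lambda>A. \<iota>Y (R A (z + z')) = \<iota>Y (R A z) + \<iota>Y (R A z')) ?F"
      using large_tensor[OF z] large_tensor[OF z']
    proof eventually_elim
      case (elim A)
      then interpret R: op "?T A" Y.N "R A" by (intro R_op) auto
      have "R A (z + z') = R A z + R A z'" "R A z \<in> vecs Y.N" "R A z' \<in> vecs Y.N"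
        using elim R.add R.in_vecs by blast+
      then show ?case by (simp add: Y.\<iota>.add del: Y.power_simps)
    qed
  next
    fix c z assume z: "z \<in> vecs X.N"
    show "eventually (\<lambda>A. \<iota>Y (R A (smul X.N c z)) = smul CY c (\<iota>Y (R A z))) ?F"
      using large_tensor[OF z]
    proof eventually_elim
      case (elim A)
      then interpret R: op "?T A" Y.N "R A" by (intro R_op) auto
      have "R A (smul (?T A) c z) = smul Y.N c (R A z)" "R A z \<in> vecs Y.N"
        using elim R.scale R.in_vecs by blast+
      moreover have "smul X.N c z = smul (?T A) c z" by simp
      ultimately show ?case by (simp add: Y.\<iota>.scale del: Y.power_simps X.power_simps tensor_space_simps)
    qed
  next
    fix z assume z: "z \<in> vecs X.N"
    show "eventually (\<lambda>A. \<iota>Y (R A z) \<in> vecs CY) ?F"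
      using large_tensor[OF z]
      by eventually_elim (intro Y.\<iota>.in_vecs op.in_vecs[OF R_op], auto)
  next
    fix z and e :: real assume z: "z \<in> vecs X.N" and e: "e > 0"
    obtain xs where xs: "z = tensor_sum (\<lambda>_. X) xs" "set xs \<subseteq> X.tup" using z by auto
    let ?c = "l ^ CARD('m)"
    have c: "?c > 0" using \<open>l > 0\<close> by simp
    let ?V = "{\<alpha> (\<lambda>i. sub X (M i)) z | M. (\<forall>i. fd_subspace X (M i)) \<and>
        z \<in> vecs (tensor_space (\<lambda>i. sub X (M i)) (\<alpha> (\<lambda>i. sub X (M i))))}"
    have Inf: "\<alpha> (\<lambda>_. X) z = Inf ?V"
      using fg X.E.normed z unfolding finitely_generated_def tensor_power_def by simp
    have ne: "?V \<noteq> {}"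
    proof -
      let ?Z = "\<Union>x\<in>set xs. range x"
      have Z: "finite ?Z" "?Z \<subseteq> vecs X" using xs(2) by (auto simp: in_tuples_iff subset_iff)
      then have fd: "fd_subspace X (X.E.span ?Z)" unfolding fd_subspace_def by blast
      have "set xs \<subseteq> tuples (F ?Z)"
        using X.E.span_superset[of ?Z] by (simp add: F_tuples subset_iff) blast
      then have mem: "z \<in> vecs (?T ?Z)" by (auto simp: xs(1) F_sum)
      have "\<alpha> (F ?Z) z \<in> ?V"
        by (rule CollectI, rule exI[of _ "\<lambda>_. X.E.span ?Z"], intro conjI allI fd)
          (use mem in \<open>simp_all only: F_def\<close>)
      then show ?thesis by (metis (no_types) empty_iff)
    qed
    have "Inf ?V < \<alpha> (\<lambda>_. X) z + e / ?c" unfolding Inf[symmetric] using e c by simp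
    from cInf_lessD[OF ne this] obtain v where "v \<in> ?V" "v < \<alpha> (\<lambda>_. X) z + e / ?c" ..
    then obtain M where M: "\<And>i. fd_subspace X (M i)"
      "z \<in> vecs (tensor_space (\<lambda>i. sub X (M i)) (\<alpha> (\<lambda>i. sub X (M i))))"
      "\<alpha> (\<lambda>i. sub X (M i)) z < \<alpha> (\<lambda>_. X) z + e / ?c" by blast
    obtain B where B: "\<And>i. finite (B i)" "\<And>i. B i \<subseteq> vecs X" "\<And>i. M i = X.E.span (B i)"
      using M(1) unfolding fd_subspace_def by metis
    have "eventually (\<lambda>A. finite A \<and> A \<subseteq> vecs X \<and> (\<Union>i. B i) \<subseteq> X.E.span A) ?F"
      using B by (intro large) auto
    then show "eventually (\<lambda>A. nrm CY (\<iota>Y (R A z)) \<le> ?c * nrm X.N z + e) ?F"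
      using large_tensor[OF z]
    proof eventually_elim
      case (elim A)
      have MA: "M i \<subseteq> X.E.span A" for i
        unfolding B(3) using elim by (intro X.E.span_minimal X.E.subspace_span) auto
      have "\<alpha> (F A) z \<le> \<alpha> (\<lambda>i. sub X (M i)) z"
        unfolding F_def
        by (rule Y.subspace_tensor_mono[OF X.E.normed _ X.E.subspace_span MA _ M(2)])
          (use elim span_vecs in \<open>auto simp: B(3)\<close>)
      then have "?c * \<alpha> (F A) z \<le> ?c * (\<alpha> (\<lambda>_. X) z + e / ?c)"
        using M(3) c by (intro mult_left_mono) auto
      also have "\<dots> = ?c * nrm X.N z + e" using \<open>l > 0\<close> by (simp add: distrib_left)
      finally have "?c * \<alpha> (F A) z \<le> ?c * nrm X.N z + e" .
      moreover have "nrm CY (\<iota>Y (R A z)) = nrm Y.N (R A z)"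
        using elim by (intro Y.isometry op.in_vecs[OF R_op]) auto
      moreover have "nrm Y.N (R A z) \<le> ?c * \<alpha> (F A) z" using elim by (intro R_le) auto
      ultimately show ?case by linarith
    qed
  qed (use \<open>l > 0\<close> in auto)
  then obtain S where S: "bounded_op (dual CY) (dual X.N) S"
    "\<And>f z c. \<lbrakk>f \<in> vecs (dual CY); z \<in> vecs X.N; eventually (\<lambda>A. \<iota>Y (R A z) = c) ?F\<rbrakk> \<Longrightarrow> S f z = f c"
    by blast
  obtain T where T: "bounded_op (dual X.N) (dual CX) T"
    "\<And>f z. \<lbrakk>f \<in> vecs (dual X.N); z \<in> vecs X.N\<rbrakk> \<Longrightarrow> T f (\<iota>X z) = f z"
    using X.ex_dual_extension by blast
  have "bounded_op (dual CY) (dual CX) (\<lambda>f. T (S f))"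
    by (rule bounded_op_comp[OF S(1) T(1)]) (simp add: X.N.dual_norm_ge_0)
  moreover have "T (S f) (\<iota>X (X.elem (\<lambda>i. j (y i)))) = f (\<iota>Y (Y.elem y))"
    if f: "f \<in> vecs (dual CY)" and y: "y \<in> Y.tup" for f y
  proof -
    let ?jy = "\<lambda>i. j (y i)"
    have jy: "X.elem ?jy \<in> vecs X.N" using j_tup[OF y] by (rule X.elem_in)
    have Sf: "S f \<in> vecs (dual X.N)" using S(1) f unfolding bounded_op_def linear_map_def by blast
    have "eventually (\<lambda>A. finite A \<and> A \<subseteq> vecs X \<and> set [?jy] \<subseteq> tuples (F A)) ?F"
      using j_tup[OF y] by (intro large_tuples) simp
    then have "eventually (\<lambda>A. \<iota>Y (R A (X.elem ?jy)) = \<iota>Y (Y.elem y)) ?F"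
    proof eventually_elim
      case (elim A)
      have "R A (tensor_sum (F A) [?jy]) = tensor_sum (\<lambda>_. Y) (map (\<lambda>x i. r A (x i)) [?jy])"
        unfolding R_def using nF rb elim
        by (intro tensor_map_sum) (auto simp: bounded_op_def)
      moreover have "r A (j (y i)) = y i" for i
        using r(3)[of A "y i"] elim y by (simp add: F_def in_tuples_iff)
      ultimately have "R A (X.elem ?jy) = Y.elem y" by (simp add: F_sum)
      then show ?case by simp
    qed
    from S(2)[OF f jy this] show ?thesis using T(2)[OF Sf jy] by simp
  qed
  ultimately show ?thesis unfolding extension_operator_def by blast
qed

text \<open>
  The required operator from \<open>Y\<^sup>*\<close> to \<open>X\<^sup>*\<close> is the composition \<open>e \<circ> S \<circ> P\<close>: here
  \<open>P f = f \<otimes> g \<otimes> \<dots> \<otimes> g\<close>, and \<open>e\<close> restricts a functional to the tensors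
  \<open>x \<otimes> j y\<^sub>0 \<otimes> \<dots> \<otimes> j y\<^sub>0\<close>. The factor with index \<open>k\<close> is the distinguished one.
\<close>

lemma locally_complemented_of_extension_operator:
  assumes S: "extension_operator S"
  shows "locally_complemented Y X j"
proof (cases "vecs Y = {0}")
  case True
  have "\<exists>r. bounded_op (sub X F) Y r \<and> op_norm (sub X F) Y r \<le> 1 \<and> (\<forall>y\<in>vecs Y. j y \<in> F \<longrightarrow> r (j y) = y)"
    if F: "fd_subspace X F" for F
  proof -
    obtain B where "B \<subseteq> vecs X" "F = X.E.span B" using F unfolding fd_subspace_def by blast
    then have nF: "normed_space (sub X F)"
      using X.E.normed_sub X.E.span_minimal[OF _ X.E.vecs_subspace] X.E.subspace_span by blast
    have "linear_map (sub X F) Y (\<lambda>_. 0)" by (simp add: linear_map_def)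
    then interpret Z: op "sub X F" Y "\<lambda>_. 0"
      using nF Y.E.normed by (simp add: op_def normed_def op_axioms_def)
    have nonneg: "0 \<le> nrm X x" if "x \<in> F" for x using Z.E.nrm_ge_0[of x] that by simp
    have "bounded_op (sub X F) Y (\<lambda>_. 0)" by (rule Z.bounded_opI[of 0]) simp
    moreover have "op_norm (sub X F) Y (\<lambda>_. 0) \<le> 1" by (rule Z.op_norm_le) (use nonneg in auto)
    ultimately show ?thesis using True by (intro exI[of _ "\<lambda>_. 0"]) auto
  qed
  then show ?thesis unfolding locally_complemented_def using j_bounded by (auto intro: exI[of _ 1])
next
  case False
  then obtain y\<^sub>0 where y\<^sub>0: "y\<^sub>0 \<in> vecs Y" "y\<^sub>0 \<noteq> 0" using Y.E.zero_in by blast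
  then obtain g where g: "g \<in> vecs (dual Y)" "g y\<^sub>0 = 1" using Y.E.ex_dual_eq_1 by blast
  define k :: 'm where "k = undefined"
  define h where "h = (\<lambda>f i. if i = k then f else g)"
  have h_in: "h f i \<in> vecs (dual Y)" if "f \<in> vecs (dual Y)" for f i using that g by (simp add: h_def)
  have h_prod: "(\<Prod>i\<in>UNIV. P (h f i) i) = P f k * (\<Prod>i\<in>UNIV - {k}. P g i)"
    for f and P :: "('u \<Rightarrow> 'k) \<Rightarrow> 'm \<Rightarrow> 'a::comm_monoid_mult"
  proof -
    have "(\<Prod>i\<in>UNIV. P (h f i) i) = P (h f k) k * (\<Prod>i\<in>UNIV - {k}. P (h f i) i)"
      by (rule prod.remove) auto
    also have "(\<Prod>i\<in>UNIV - {k}. P (h f i) i) = (\<Prod>i\<in>UNIV - {k}. P g i)"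
      by (intro prod.cong) (auto simp: h_def)
    finally show ?thesis by (simp add: h_def)
  qed
  have "\<forall>f\<in>vecs (dual Y). \<exists>p. p \<in> vecs (dual Y.N) \<and>
      (\<forall>y\<in>Y.tup. p (Y.elem y) = (\<Prod>i\<in>UNIV. h f i (y i))) \<and>
      op_norm Y.N scalars p \<le> (\<Prod>i\<in>UNIV. op_norm Y scalars (h f i))"
  proof
    fix f assume f: "f \<in> vecs (dual Y)"
    from Y.ex_product_functional[of "h f", OF h_in[OF f]]
    show "\<exists>p. p \<in> vecs (dual Y.N) \<and> (\<forall>y\<in>Y.tup. p (Y.elem y) = (\<Prod>i\<in>UNIV. h f i (y i))) \<and>
      op_norm Y.N scalars p \<le> (\<Prod>i\<in>UNIV. op_norm Y scalars (h f i))" by blast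
  qed
  from bchoice[OF this] obtain p where p_spec: "\<forall>f\<in>vecs (dual Y). p f \<in> vecs (dual Y.N) \<and>
      (\<forall>y\<in>Y.tup. p f (Y.elem y) = (\<Prod>i\<in>UNIV. h f i (y i))) \<and>
      op_norm Y.N scalars (p f) \<le> (\<Prod>i\<in>UNIV. op_norm Y scalars (h f i))" ..
  have p: "p f \<in> vecs (dual Y.N)"
    "y \<in> Y.tup \<Longrightarrow> p f (Y.elem y) = (\<Prod>i\<in>UNIV. h f i (y i))"
    "op_norm Y.N scalars (p f) \<le> (\<Prod>i\<in>UNIV. op_norm Y scalars (h f i))"
    if "f \<in> vecs (dual Y)" for f y
    using p_spec that by blast+
  obtain T where T: "bounded_op (dual Y.N) (dual CY) T"
    "\<And>f z. \<lbrakk>f \<in> vecs (dual Y.N); z \<in> vecs Y.N\<rbrakk> \<Longrightarrow> T f (\<iota>Y z) = f z"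
    using Y.ex_dual_extension by blast
  interpret DY: normed "dual Y" by unfold_locales (rule Y.E.normed_dual)
  interpret DCY: normed "dual CY" by unfold_locales (rule Y.C.normed_dual)
  interpret T: op "dual Y.N" "dual CY" T
    using Y.N.normed_dual Y.C.normed_dual T(1) by (rule op_of_bounded)
  have S_bounded: "bounded_op (dual CY) (dual CX) S" using S by (simp add: extension_operator_def)
  interpret S: op "dual CY" "dual CX" S
    using Y.C.normed_dual X.C.normed_dual S_bounded by (rule op_of_bounded)
  define P where "P = (\<lambda>f. T (p f))"
  have P_in: "P f \<in> vecs (dual CY)" if "f \<in> vecs (dual Y)" for f
    unfolding P_def using p(1)[OF that] by (rule T.in_vecs)
  have P_elem: "P f (\<iota>Y (Y.elem y)) = f (y k) * (\<Prod>i\<in>UNIV - {k}. g (y i))"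
    if "f \<in> vecs (dual Y)" "y \<in> Y.tup" for f y
    using T(2)[OF p(1)[OF that(1)] Y.elem_in[OF that(2)]] p(2)[OF that]
      h_prod[of "\<lambda>u i. u (y i)" f] by (simp add: P_def)
  have P_eqI: "q = P f" if "q \<in> vecs (dual CY)" "f \<in> vecs (dual Y)"
    "\<And>y. y \<in> Y.tup \<Longrightarrow> q (\<iota>Y (Y.elem y)) = f (y k) * (\<Prod>i\<in>UNIV - {k}. g (y i))" for q f
  proof (rule Y.C.dual_eqI[OF that(1) P_in[OF that(2)]], rule Y.functional_eqI)
    show "bounded_op CY scalars q" "bounded_op CY scalars (P f)"
      using that(1) P_in[OF that(2)] by (auto simp: in_dual_iff)
    show "q (\<iota>Y (Y.elem y)) = P f (\<iota>Y (Y.elem y))" if y: "y \<in> Y.tup" for y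
      using P_elem[OF \<open>f \<in> vecs (dual Y)\<close> y] \<open>\<And>y. y \<in> Y.tup \<Longrightarrow> q (\<iota>Y (Y.elem y)) = _\<close>[OF y] by simp
  qed
  have P_bounded: "bounded_op (dual Y) (dual CY) P" unfolding bounded_op_def
  proof
    show "linear_map (dual Y) (dual CY) P" unfolding linear_map_def
    proof (intro conjI ballI allI P_in)
      fix f f' assume f: "f \<in> vecs (dual Y)" and f': "f' \<in> vecs (dual Y)"
      show "P (f + f') = P f + P f'"
        by (rule P_eqI[symmetric])
          (use f f' in \<open>simp_all add: P_in P_elem DCY.add_in DY.add_in distrib_right\<close>)
    next
      fix c f assume f: "f \<in> vecs (dual Y)"
      show "P (smul (dual Y) c f) = smul (dual CY) c (P f)"
        by (rule P_eqI[symmetric])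
          (use f DCY.scale_in[OF P_in[OF f]] DY.scale_in[OF f] in \<open>simp_all add: P_elem mult.assoc\<close>)
    qed
    let ?K = "op_norm (dual Y.N) (dual CY) T"
    let ?Q = "\<Prod>i\<in>UNIV - {k}. op_norm Y scalars g"
    have "nrm (dual CY) (P f) \<le> (?K * ?Q) * nrm (dual Y) f" if f: "f \<in> vecs (dual Y)" for f
    proof -
      have "nrm (dual CY) (P f) \<le> ?K * nrm (dual Y.N) (p f)"
        unfolding P_def by (rule T.le_op_norm[OF T(1) p(1)[OF f]])
      also have "\<dots> \<le> ?K * (op_norm Y scalars f * ?Q)"
        using p(3)[OF f] T.op_norm_ge_0[OF T(1)]
        unfolding h_prod[of "\<lambda>u i. op_norm Y scalars u"] by (intro mult_left_mono) simp_all
      finally show ?thesis by (simp add: mult_ac)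
    qed
    then show "\<exists>C. \<forall>f\<in>vecs (dual Y). nrm (dual CY) (P f) \<le> C * nrm (dual Y) f" by blast
  qed
  define t where "t = (\<lambda>x :: 'u. (\<lambda>_ :: 'm. j y\<^sub>0)(k := x))"
  have t_in: "t x \<in> X.tup" if "x \<in> vecs X" for x
    using that j.in_vecs[OF y\<^sub>0(1)] by (simp add: t_def in_tuples_iff)
  let ?Q = "nrm X (j y\<^sub>0) ^ (CARD('m) - 1)"
  have t_norm: "nrm CX (\<iota>X (X.elem (t x))) \<le> ?Q * nrm X x" if x: "x \<in> vecs X" for x
  proof -
    have "nrm CX (\<iota>X (X.elem (t x))) = \<alpha> (\<lambda>_. X) (X.elem (t x))"
      using X.isometry[OF X.elem_in[OF t_in[OF x]]] by simp
    also have "\<dots> \<le> (\<Prod>i\<in>UNIV. nrm X (t x i))"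
      using X.E.normed t_in[OF x] by (rule Y.elementary_le)
    also have "\<dots> = nrm X (t x k) * (\<Prod>i\<in>UNIV - {k}. nrm X (t x i))" by (rule prod.remove) auto
    also have "(\<Prod>i\<in>UNIV - {k}. nrm X (t x i)) = (\<Prod>i\<in>UNIV - {k}. nrm X (j y\<^sub>0))"
      by (intro prod.cong) (auto simp: t_def)
    also have "t x k = x" by (simp add: t_def)
    finally show ?thesis by (simp add: mult.commute card_Diff_singleton)
  qed
  define e where "e = (\<lambda>(\<Phi> :: 'd \<Rightarrow> 'k) x. if x \<in> vecs X then \<Phi> (\<iota>X (X.elem (t x))) else 0)"
  have e_bound: "norm (e \<Phi> x) \<le> (?Q * op_norm CX scalars \<Phi>) * nrm X x"
    if \<Phi>: "\<Phi> \<in> vecs (dual CX)" and x: "x \<in> vecs X" for \<Phi> x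
  proof -
    have "norm (e \<Phi> x) \<le> op_norm CX scalars \<Phi> * nrm CX (\<iota>X (X.elem (t x)))"
      using X.C.dual_le[OF \<Phi> X.\<iota>_elem_in[OF t_in[OF x]]] x by (simp add: e_def)
    also have "\<dots> \<le> op_norm CX scalars \<Phi> * (?Q * nrm X x)"
      using t_norm[OF x] X.C.dual_norm_ge_0[OF \<Phi>] by (rule mult_left_mono)
    finally show ?thesis by (simp add: mult_ac)
  qed
  have e_in: "e \<Phi> \<in> vecs (dual X)" if \<Phi>: "\<Phi> \<in> vecs (dual CX)" for \<Phi>
  proof (rule X.E.dualI[OF _ _ e_bound[OF \<Phi>]])
    interpret \<Phi>: op CX scalars \<Phi> by (rule X.C.op_dual[OF \<Phi>])
    fix x x' assume x: "x \<in> vecs X" and x': "x' \<in> vecs X"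
    have "X.elem (t (x + x')) = X.elem (t x) + X.elem (t x')"
      unfolding t_def by (rule elementary_tensor_add)
    then show "e \<Phi> (x + x') = e \<Phi> x + e \<Phi> x'"
      using x x' X.elem_in[OF t_in[OF x]] X.elem_in[OF t_in[OF x']]
      by (simp add: e_def X.E.add_in X.\<iota>.add \<Phi>.add X.\<iota>.in_vecs del: X.power_simps)
  next
    interpret \<Phi>: op CX scalars \<Phi> by (rule X.C.op_dual[OF \<Phi>])
    fix c x assume x: "x \<in> vecs X"
    have "X.elem (t (smul X c x)) = smul X.N c (X.elem (t x))"
      unfolding t_def X.power_simps by (rule elementary_tensor_scale)
    then show "e \<Phi> (smul X c x) = c * e \<Phi> x"
      using x X.elem_in[OF t_in[OF x]]
      by (simp add: e_def X.E.scale_in X.\<iota>.scale \<Phi>.scale X.\<iota>.in_vecs del: X.power_simps)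
  qed (auto simp: e_def)
  have e_bounded: "bounded_op (dual CX) (dual X) e" unfolding bounded_op_def
  proof
    show "linear_map (dual CX) (dual X) e"
      using e_in by (auto simp: linear_map_def e_def fun_eq_iff)
    have "nrm (dual X) (e \<Phi>) \<le> ?Q * nrm (dual CX) \<Phi>" if \<Phi>: "\<Phi> \<in> vecs (dual CX)" for \<Phi>
      using X.E.dual_norm_le[OF e_in[OF \<Phi>] _ e_bound[OF \<Phi>]] X.C.dual_norm_ge_0[OF \<Phi>]
        X.E.nrm_ge_0[OF j.in_vecs[OF y\<^sub>0(1)]] by simp
    then show "\<exists>C. \<forall>\<Phi>\<in>vecs (dual CX). nrm (dual X) (e \<Phi>) \<le> C * nrm (dual CX) \<Phi>" by blast
  qed
  have "bounded_op (dual Y) (dual X) (\<lambda>f. e (S (P f)))"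
    by (intro bounded_op_comp[OF _ e_bounded] bounded_op_comp[OF P_bounded S_bounded])
      (simp_all add: Y.C.dual_norm_ge_0 X.C.dual_norm_ge_0)
  moreover have "e (S (P f)) (j y) = f y" if f: "f \<in> vecs (dual Y)" and y: "y \<in> vecs Y" for f y
  proof -
    let ?y = "(\<lambda>_ :: 'm. y\<^sub>0)(k := y)"
    have y_in: "?y \<in> Y.tup" using y y\<^sub>0(1) by (simp add: in_tuples_iff)
    have "t (j y) = (\<lambda>i. j (?y i))" by (auto simp: t_def)
    then have "e (S (P f)) (j y) = S (P f) (\<iota>X (X.elem (\<lambda>i. j (?y i))))"
      using j.in_vecs[OF y] by (simp add: e_def)
    also have "\<dots> = P f (\<iota>Y (Y.elem ?y))"
      using S P_in[OF f] y_in unfolding extension_operator_def by blast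
    also have "\<dots> = f y" using P_elem[OF f y_in] g(2) by simp
    finally show ?thesis .
  qed
  ultimately show ?thesis
    by (intro locally_complemented_of_dual_operator[OF Y.E.normed X.E.normed j_bounded])
qed

end

theorem theorem2:
  fixes Y X :: "('k::{real_normed_field,euclidean_space}, 'u::ab_group_add) nspace"
    and j :: "'u \<Rightarrow> 'u"
    and \<alpha> :: "('m::finite \<Rightarrow> ('k, 'u) nspace) \<Rightarrow> ('m, 'k, 'u) tensor \<Rightarrow> real"
    and CY :: "('k, 'c::ab_group_add) nspace" and \<iota>Y :: "('m, 'k, 'u) tensor \<Rightarrow> 'c"
    and CX :: "('k, 'd::ab_group_add) nspace" and \<iota>X :: "('m, 'k, 'u) tensor \<Rightarrow> 'd"
  assumes "banach_space Y" and "banach_space X" and "embedding Y X j"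
    and "tensor_norm \<alpha>" and "finitely_generated \<alpha>"
    and "is_completion (tensor_power \<alpha> Y) CY \<iota>Y"
    and "is_completion (tensor_power \<alpha> X) CX \<iota>X"
  shows "(locally_complemented Y X j \<longleftrightarrow>
            locally_complemented CY CX
              (completed_op (tensor_power \<alpha> Y) CY \<iota>Y CX \<iota>X
                 (tensor_map (\<lambda>_. Y) (\<lambda>_. X) (\<lambda>_. j)))) \<and>
         (locally_complemented Y X j \<longleftrightarrow>
            has_bounded_right_inverse (form_space X CX \<iota>X) (form_space Y CY \<iota>Y)
              (restrict_form Y j))"
proof -
  interpret power_embedding \<alpha> Y CY \<iota>Y X CX \<iota>X j
    by unfold_locales
      (use assms in \<open>auto simp: banach_space_def embedding_def\<close>)
  have "locally_complemented Y X j \<longleftrightarrow> (\<exists>S. extension_operator S)"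
    using extension_operator_of_locally_complemented[OF assms(5)]
      locally_complemented_of_extension_operator by blast
  then show ?thesis
    by (simp add: powers_locally_complemented_iff forms_complemented_iff)
qed

end
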